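(* Let $\Phi$ be a stationary Poisson process on $\mathbb R^d$ of non-zero intensity $\gamma$ and let $\{U_{k,n}\}_{k,n\ge1}$ be i.i.d. $B_1$-valued random vectors independent of $\Phi$. Let $Y_1\colon\mathbf N\to\{0,1\}$ and $Y_2\colon\mathbf N\to B_1$ be measurable functions such that $Y_i(\varphi)=Y_i(\varphi\cap B_1)$ for all $\varphi\in\mathbf N$, $i\in\{1,2\}$, and set $Y_i(x,\varphi):=Y_i(\varphi-x)$ for $x\in\mathbb R^d$. Define point processes $\Phi_k$ recursively by $\Phi_0:=\Phi$ and, given $\Phi_{k-1}=\sum_i\delta_{x_i}$, $$\Phi_k:=\sum_i\delta_{x_i+Y_1(x_i,\Phi_{k-1})\,(Y_2(x_i,\Phi_{k-1})+U_{k,i})},\quad k\ge1 .$$ Then for all $k\ge1$, $$\lim_{r\to\infty}\lambda_d(B_r)^{-1}\operatorname{Var}[\Phi_k(B_r)]=\lim_{r\to\infty}\lambda_d(B_r)^{-1}\operatorname{Var}[\Phi(B_r)]=\gamma .$$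
   Context: $\lambda_d$ is Lebesgue measure on $\mathbb R^d$; $B_r$ is the ball of radius $r$ centred at $0$. $\mathbf N$ is the space of locally finite counting measures on $\mathbb R^d$ (multiplicities allowed) with the $\sigma$-field generated by evaluations; $\varphi\cap B$ is the restriction of $\varphi$ to $B$; $\varphi-x$ is the translate $\varphi(\cdot+x)$. The representation $\Phi_{k-1}=\sum_i\delta_{x_i}$ enumerates the points (with multiplicity); the enumeration at step $k$ does not depend on $\{U_{k,i}:i\ge1\}$ (e.g. the points may be indexed by the points of $\Phi$ they originate from), so each point of $\Phi_{k-1}$ receives its own independent vector $U_{k,i}$. *)

theory Defs
  imports "HOL-Probability.Probability"
begin

definition counting_measures :: "'a::euclidean_space measure set" where
  "counting_measures =
    {\<phi>. sets \<phi> = sets borel \<and>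
        (\<forall>B\<in>sets borel. emeasure \<phi> B = \<infinity> \<or> (\<exists>n::nat. emeasure \<phi> B = of_nat n)) \<and>
        (\<forall>B\<in>sets borel. bounded B \<longrightarrow> emeasure \<phi> B < \<infinity>)}"

text \<open>The space of locally finite counting measures with the \<open>\<sigma>\<close>-field generated by the
  evaluations, built like \<^const>\<open>subprob_algebra\<close>.\<close>

definition counting_space :: "'a::euclidean_space measure measure" where
  "counting_space =
    (SUP B\<in>sets borel. vimage_algebra counting_measures (\<lambda>\<phi>. emeasure \<phi> B) borel)"

text \<open>\<open>restrict_to \<phi> B\<close> is \<open>\<phi> \<inter> B\<close>, i.e. \<open>A \<mapsto> \<phi> (A \<inter> B)\<close>, kept as a measure on the whole space
  (unlike \<^const>\<open>restrict_space\<close>); \<open>translate \<phi> x\<close> is \<open>\<phi> - x\<close>, i.e. \<open>A \<mapsto> \<phi> (A + x)\<close>.\<close>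

definition restrict_to :: "'a::euclidean_space measure \<Rightarrow> 'a set \<Rightarrow> 'a measure" where
  "restrict_to \<phi> B = density \<phi> (indicator B)"

definition translate :: "'a::euclidean_space measure \<Rightarrow> 'a \<Rightarrow> 'a measure" where
  "translate \<phi> x = distr \<phi> borel (\<lambda>y. y - x)"

text \<open>\<open>sum_dirac I x\<close> is \<open>\<Sum>i\<in>I. \<delta>\<^bsub>x i\<^esub>\<close>: the image of counting measure on \<open>I\<close> under \<open>x\<close>.\<close>

definition sum_dirac :: "nat set \<Rightarrow> (nat \<Rightarrow> 'a::euclidean_space) \<Rightarrow> 'a measure" where
  "sum_dirac I x = distr (count_space I) borel x"

text \<open>The points of \<open>\<phi>\<close> are enumerated by \<open>1 \<le> i \<le> \<phi>(UNIV)\<close>, so that configurations with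
  finitely many points are covered too; values of an enumeration beyond that range are
  irrelevant.\<close>

definition point_indices :: "'a::euclidean_space measure \<Rightarrow> nat set" where
  "point_indices \<phi> = {i. 1 \<le> i \<and> of_nat i \<le> emeasure \<phi> UNIV}"

definition enumerates :: "(nat \<Rightarrow> 'a::euclidean_space) \<Rightarrow> 'a measure \<Rightarrow> bool" where
  "enumerates x \<phi> \<longleftrightarrow> \<phi> = sum_dirac (point_indices \<phi>) x"

definition displace ::
  "('a::euclidean_space measure \<Rightarrow> real) \<Rightarrow> ('a measure \<Rightarrow> 'a) \<Rightarrow>
    (nat \<Rightarrow> 'a) \<Rightarrow> (nat \<Rightarrow> 'a) \<Rightarrow> 'a measure \<Rightarrow> 'a measure" where
  "displace Y1 Y2 x u \<phi> = sum_dirac (point_indices \<phi>)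
    (\<lambda>i. x i + Y1 (translate \<phi> (x i)) *\<^sub>R (Y2 (translate \<phi> (x i)) + u i))"

text \<open>The Poisson law on \<open>[0, \<infinity>]\<close>, including the degenerate parameters \<open>0\<close> and \<open>\<infinity>\<close>;
  the library's \<^const>\<open>poisson_pmf\<close> is specified for positive real parameters only.\<close>

definition poisson_law :: "ennreal \<Rightarrow> ennreal measure" where
  "poisson_law r =
    (if r = 0 then return borel 0
     else if r = \<infinity> then return borel \<infinity>
     else distr (measure_pmf (poisson_pmf (enn2real r))) borel of_nat)"

definition poisson_process ::
  "'w measure \<Rightarrow> 'a::euclidean_space measure \<Rightarrow> ('w \<Rightarrow> 'a measure) \<Rightarrow> bool" where
  "poisson_process M \<Lambda> \<Phi> \<longleftrightarrow>
    sets \<Lambda> = sets borel \<and>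
    \<Phi> \<in> measurable M counting_space \<and>
    (\<forall>B\<in>sets borel. distr M borel (\<lambda>\<omega>. emeasure (\<Phi> \<omega>) B) = poisson_law (emeasure \<Lambda> B)) \<and>
    (\<forall>(n::nat) B. (\<forall>i<n. B i \<in> sets borel) \<and> disjoint_family_on B {..<n} \<longrightarrow>
       prob_space.indep_vars M (\<lambda>_. borel) (\<lambda>i \<omega>. emeasure (\<Phi> \<omega>) (B i)) {..<n})"

definition stationary :: "'w measure \<Rightarrow> ('w \<Rightarrow> 'a::euclidean_space measure) \<Rightarrow> bool" where
  "stationary M \<Phi> \<longleftrightarrow>
    (\<forall>x. distr M counting_space (\<lambda>\<omega>. translate (\<Phi> \<omega>) x) = distr M counting_space \<Phi>)"

text \<open>The intensity of a stationary point process is the expected number of points in the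
  unit cube.\<close>

definition intensity :: "'w measure \<Rightarrow> ('w \<Rightarrow> 'a::euclidean_space measure) \<Rightarrow> ennreal" where
  "intensity M \<Phi> = (\<integral>\<^sup>+\<omega>. emeasure (\<Phi> \<omega>) (cbox 0 One) \<partial>M)"

definition stationary_poisson_process ::
  "'w measure \<Rightarrow> real \<Rightarrow> ('w \<Rightarrow> 'a::euclidean_space measure) \<Rightarrow> bool" where
  "stationary_poisson_process M \<gamma> \<Phi> \<longleftrightarrow>
    (\<exists>\<Lambda>. poisson_process M \<Lambda> \<Phi>) \<and> stationary M \<Phi> \<and> intensity M \<Phi> = ennreal \<gamma>"

text \<open>The library's \<open>indep_var\<close> requires both variables to take values in the same type; this
  is the same notion for different value types.\<close>

definition indep_rvs ::
  "'w measure \<Rightarrow> 'b measure \<Rightarrow> ('w \<Rightarrow> 'b) \<Rightarrow> 'c measure \<Rightarrow> ('w \<Rightarrow> 'c) \<Rightarrow> bool" where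
  "indep_rvs M N1 A1 N2 A2 \<longleftrightarrow>
    A1 \<in> measurable M N1 \<and> A2 \<in> measurable M N2 \<and>
    prob_space.indep_set M {A1 -` S \<inter> space M |S. S \<in> sets N1} {A2 -` S \<inter> space M |S. S \<in> sets N2}"

definition var_count :: "'w measure \<Rightarrow> ('w \<Rightarrow> 'a::euclidean_space measure) \<Rightarrow> 'a set \<Rightarrow> real" where
  "var_count M \<Phi> B = prob_space.variance M (\<lambda>\<omega>. measure (\<Phi> \<omega>) B)"

end

theory Submission
  imports Defs
begin

text \<open>
  Each step only moves points by at most 2, so \<open>\<Phi>\<^sub>k(B\<^sub>r) - \<Phi>\<^sub>k\<^sub>-\<^sub>1(B\<^sub>r)\<close> is the number of points
  entering \<open>B\<^sub>r\<close> minus the number of those leaving it, and only points close to the sphere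
  contribute. Splitting these into unit cells, the contributions of distant cells are independent
  and all second moments are uniformly bounded; hence the variance of the difference is of order
  \<open>r\<^sup>d\<^sup>-\<^sup>1 = o(\<lambda>\<^sub>d(B\<^sub>r))\<close>, and the asymptotic variance does not change in a step. For \<open>\<Phi>\<^sub>0\<close> it is
  \<open>\<gamma>\<close>, the mean being \<open>\<gamma> \<lambda>\<^sub>d\<close>.

  The independence of distant cells propagates from step to step as follows. Given the points
  before the step, the Laplace functional of the (start, end) pairs is
  \<open>exp (- \<integral> H(\<phi>, x) \<phi>(dx))\<close> with \<open>H\<close> local, whatever the enumeration; so Laplace
  functionals of the pairs over distant regions factorise, because those regions are independent
  under \<open>\<Phi>\<^sub>k\<^sub>-\<^sub>1\<close>. Factorising Laplace functionals in turn imply independence, since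
  probability generating functions determine the joint law of finitely many counts.
\<close>

text \<open>The obstacle is that marks are attached through a global enumeration: which
  \<open>U k i\<close> a point receives may depend on the whole configuration, so displaced points
  in distant regions are not visibly functions of independent inputs. Freezing the enumerated points
  and averaging over the marks removes this: only finitely many points start near a bounded set,
  each gives an independent factor, and since the marks are identically distributed the product
  depends on the configuration alone. For the freezing, the configuration must be a function of the
  enumerating sequence, which is independent of the marks; almost surely there are infinitely many
  points, so the index set is \<open>{1..}\<close> and the sequence determines the configuration.
  Recording start and end of each move as one point of a product space turns the entering and
  leaving numbers into ordinary counts of a point process. The covariance of the old count with the
  boundary term is absorbed by AM-GM, with a weight tending to 0 slowly enough. All constants come
  from two lengths: a move is at most 2 long, and a cell lies within the dimension of its
  corner.\<close>

section \<open>The space of counting measures: restriction, translation and joint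
  measurability\<close>

lemma counting_measuresD:
  assumes "\<phi> \<in> counting_measures"
  shows sets_counting: "sets \<phi> = sets borel"
    and space_counting: "space \<phi> = UNIV"
    and emeasure_counting: "B \<in> sets borel \<Longrightarrow> emeasure \<phi> B = \<infinity> \<or> (\<exists>n::nat. emeasure \<phi> B = of_nat n)"
    and emeasure_counting_finite: "B \<in> sets borel \<Longrightarrow> bounded B \<Longrightarrow> emeasure \<phi> B < \<infinity>"
  using assms sets_eq_imp_space_eq[of \<phi> borel] unfolding counting_measures_def by auto

lemma measurable_counting: "\<phi> \<in> counting_measures \<Longrightarrow> measurable \<phi> N = measurable borel N"
  by (intro measurable_cong_sets sets_counting refl)

lemma counting_measure_nat:
  assumes "\<phi> \<in> counting_measures" "B \<in> sets borel" "bounded B"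
  obtains n :: nat where "emeasure \<phi> B = of_nat n" "measure \<phi> B = real n"
proof -
  from emeasure_counting[OF assms(1,2)] emeasure_counting_finite[OF assms]
  obtain n :: nat where "emeasure \<phi> B = of_nat n" by auto
  then show ?thesis using that[of n] by (simp add: measure_def)
qed

lemma space_counting_space: "space counting_space = counting_measures"
  by (auto simp add: counting_space_def space_Sup_eq_UN intro!: exI[of _ "{}"])

lemma measurable_emeasure_counting_space [measurable]:
  "B \<in> sets borel \<Longrightarrow> (\<lambda>\<phi>. emeasure \<phi> B) \<in> borel_measurable counting_space"
  by (auto intro!: measurable_Sup1 measurable_vimage_algebra1 simp: counting_space_def)

lemma measurable_measure_counting_space [measurable]:
  assumes "B \<in> sets borel" shows "(\<lambda>\<phi>. measure \<phi> B) \<in> borel_measurable counting_space"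
  unfolding measure_def
  by (rule borel_measurable_enn2real[OF measurable_emeasure_counting_space[OF assms]])

lemma measurable_counting_spaceI:
  assumes "\<And>x. x \<in> space N \<Longrightarrow> K x \<in> counting_measures"
    and "\<And>B. B \<in> sets borel \<Longrightarrow> (\<lambda>x. emeasure (K x) B) \<in> borel_measurable N"
  shows "K \<in> measurable N counting_space"
  using assms by (auto intro!: measurable_Sup2 measurable_vimage_algebra2 simp: counting_space_def)

lemma
  assumes "\<phi> \<in> counting_measures" and [measurable]: "B \<in> sets borel"
  shows restrict_to_counting: "restrict_to \<phi> B \<in> counting_measures"
    and emeasure_restrict_to: "\<And>C. C \<in> sets borel \<Longrightarrow> emeasure (restrict_to \<phi> B) C = emeasure \<phi> (C \<inter> B)"
proof -
  note [measurable_cong] = sets_counting[OF assms(1)]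
  show e: "emeasure (restrict_to \<phi> B) C = emeasure \<phi> (C \<inter> B)" if [measurable]: "C \<in> sets borel" for C
    unfolding restrict_to_def
    by (subst emeasure_density) (auto simp: Int_commute indicator_inter_arith[symmetric])
  have "bounded (C \<inter> B)" if "bounded C" for C
    using that by (rule bounded_subset) auto
  then show "restrict_to \<phi> B \<in> counting_measures"
    using emeasure_counting[OF assms(1)] emeasure_counting_finite[OF assms(1)]
    unfolding counting_measures_def mem_Collect_eq
    by (auto simp: e simp del: infinity_ennreal_def) (auto simp: restrict_to_def sets_counting[OF assms(1)])
qed

lemma
  assumes "\<phi> \<in> counting_measures"
  shows translate_counting: "translate \<phi> x \<in> counting_measures"
    and emeasure_translate: "\<And>C. C \<in> sets borel \<Longrightarrow> emeasure (translate \<phi> x) C = emeasure \<phi> {y. y - x \<in> C}"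
proof -
  note [measurable_cong] = sets_counting[OF assms(1)]
  show e: "emeasure (translate \<phi> x) C = emeasure \<phi> {y. y - x \<in> C}" if [measurable]: "C \<in> sets borel" for C
    unfolding translate_def
    by (subst emeasure_distr) (auto simp: vimage_def space_counting[OF assms])
  have "bounded {y. y - x \<in> C}" if "bounded C" for C
  proof -
    have "{y. y - x \<in> C} = (+) x ` C" by (auto simp: image_iff) (metis add.commute diff_add_cancel)
    with bounded_translation[OF that] show ?thesis by simp
  qed
  then show "translate \<phi> x \<in> counting_measures"
    using emeasure_counting[OF assms(1)] emeasure_counting_finite[OF assms(1)]
    unfolding counting_measures_def mem_Collect_eq
    by (auto simp: e simp del: infinity_ennreal_def) (auto simp: translate_def)
qed

lemma counting_measures_eqI:
  assumes "\<phi> \<in> counting_measures" "\<psi> \<in> counting_measures"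
    and "\<And>B. B \<in> sets borel \<Longrightarrow> emeasure \<phi> B = emeasure \<psi> B"
  shows "\<phi> = \<psi>"
  using assms by (intro measure_eqI) (auto simp: sets_counting)

text \<open>Seen from \<open>x\<close>, the unit ball is \<open>cball x 1\<close>, which
  \<open>K\<close> does not cut. Locality of \<open>Y1\<close> and \<open>Y2\<close> is used in this
  form: at \<open>x\<close> they cannot tell \<open>\<phi>\<close> from its restriction to
  \<open>K\<close>.\<close>

lemma restrict_translate_restrict:
  assumes "\<phi> \<in> counting_measures" "K \<in> sets borel" "cball x 1 \<subseteq> K"
  shows "restrict_to (translate (restrict_to \<phi> K) x) (cball 0 1) = restrict_to (translate \<phi> x) (cball 0 1)"
proof (rule counting_measures_eqI)
  note [simp] = assms restrict_to_counting translate_counting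
  fix B :: "'a set" assume [measurable]: "B \<in> sets borel"
  have "{y. y - x \<in> B \<and> norm (y - x) \<le> 1} \<inter> K = {y. y - x \<in> B \<and> norm (y - x) \<le> 1}"
    using assms(3) by (auto simp: dist_norm norm_minus_commute subset_eq)
  then show "emeasure (restrict_to (translate (restrict_to \<phi> K) x) (cball 0 1)) B =
      emeasure (restrict_to (translate \<phi> x) (cball 0 1)) B"
    by (simp add: emeasure_restrict_to emeasure_translate)
qed (simp_all add: assms restrict_to_counting translate_counting)

lemma restrict_to_measurable:
  assumes "B \<in> sets borel" "\<Phi> \<in> measurable N counting_space"
  shows "(\<lambda>\<omega>. restrict_to (\<Phi> \<omega>) B) \<in> measurable N counting_space"
proof (rule measurable_counting_spaceI)
  note [measurable] = assms
  have c: "\<omega> \<in> space N \<Longrightarrow> \<Phi> \<omega> \<in> counting_measures" for \<omega>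
    using measurable_space[OF assms(2)] by (simp add: space_counting_space)
  then show "\<omega> \<in> space N \<Longrightarrow> restrict_to (\<Phi> \<omega>) B \<in> counting_measures" for \<omega>
    by (simp add: assms restrict_to_counting)
  fix C :: "'a set" assume [measurable]: "C \<in> sets borel"
  have "(\<lambda>\<omega>. emeasure (\<Phi> \<omega>) (C \<inter> B)) \<in> borel_measurable N" by measurable
  then show "(\<lambda>\<omega>. emeasure (restrict_to (\<Phi> \<omega>) B) C) \<in> borel_measurable N"
    by (subst measurable_cong[OF emeasure_restrict_to]) (auto simp: assms c)
qed

text \<open>Dynkin class argument starting from rectangles. Boundedness of \<open>K\<close> keeps
  all masses finite, so that complements can be handled by subtraction.\<close>

lemma measurable_emeasure_counting_bounded:
  assumes K [measurable]: "K \<in> sets borel" "bounded K" and S: "S \<in> sets (N \<Otimes>\<^sub>M (borel :: 'a::euclidean_space measure))"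
  shows "(\<lambda>p. emeasure (snd p) {y\<in>K. (fst p, y) \<in> S}) \<in> borel_measurable (N \<Otimes>\<^sub>M counting_space)"
    (is "_ \<in> borel_measurable ?P")
proof -
  have sec: "{y\<in>K. (a, y) \<in> S} \<in> sets borel"
    if "S \<in> sets (N \<Otimes>\<^sub>M (borel :: 'a measure))" for S a
  proof -
    have "{y\<in>K. (a, y) \<in> S} = K \<inter> Pair a -` S" by auto
    then show ?thesis using sets_Pair1[OF that, of a] K by auto
  qed
  have "sets (N \<Otimes>\<^sub>M (borel :: 'a measure)) = sigma_sets (space N \<times> UNIV) {A \<times> B | A B. A \<in> sets N \<and> B \<in> sets borel}"
    by (simp add: sets_pair_measure)
  with S have *: "S \<in> sigma_sets (space N \<times> UNIV) {A \<times> B | A B. A \<in> sets N \<and> B \<in> sets (borel :: 'a measure)}"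
    by simp
  have "Int_stable {A \<times> B | A B. A \<in> sets N \<and> B \<in> sets (borel :: 'a measure)}"
    unfolding Int_stable_def mem_Collect_eq
  proof (intro ballI, elim CollectE exE conjE)
    fix S T :: "('b \<times> 'a) set" and A A' B B'
    assume "S = A \<times> B" "A \<in> sets N" "B \<in> sets borel" "T = A' \<times> B'" "A' \<in> sets N" "B' \<in> sets borel"
    then have "S \<inter> T = (A \<inter> A') \<times> (B \<inter> B')" "A \<inter> A' \<in> sets N" "B \<inter> B' \<in> sets borel" by auto
    then show "\<exists>A B. S \<inter> T = A \<times> B \<and> A \<in> sets N \<and> B \<in> sets borel" by blast
  qed
  moreover have "{A \<times> B | A B. A \<in> sets N \<and> B \<in> sets (borel :: 'a measure)} \<subseteq> Pow (space N \<times> UNIV)"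
    using sets.sets_into_space by blast
  ultimately show ?thesis using *
  proof (induction rule: sigma_sets_induct_disjoint)
    case (basic S)
    then obtain A B where [simp]: "S = A \<times> B" and [measurable]: "A \<in> sets N" "B \<in> sets borel" by auto
    have "(\<lambda>p. indicator A (fst p) * emeasure (snd p) (K \<inter> B)) \<in> borel_measurable ?P"
      by measurable
    also have "(\<lambda>p. indicator A (fst p) * emeasure (snd p) (K \<inter> B)) = (\<lambda>p. emeasure (snd p) {y\<in>K. (fst p, y) \<in> S})"
      by (rule ext) (simp add: indicator_def Int_def)
    finally show ?case .
  next
    case (compl S)
    then have S: "S \<in> sets (N \<Otimes>\<^sub>M borel)" by (simp add: sets_pair_measure)
    have eq: "emeasure (snd p) {y\<in>K. (fst p, y) \<in> space N \<times> UNIV - S} = emeasure (snd p) K - emeasure (snd p) {y\<in>K. (fst p, y) \<in> S}"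
      if "p \<in> space ?P" for p
    proof -
      from that have c: "snd p \<in> counting_measures" and "fst p \<in> space N"
        by (auto simp: space_pair_measure space_counting_space)
      then have "{y\<in>K. (fst p, y) \<in> space N \<times> UNIV - S} = K - {y\<in>K. (fst p, y) \<in> S}" by auto
      moreover have "emeasure (snd p) {y\<in>K. (fst p, y) \<in> S} < \<infinity>"
        by (rule emeasure_counting_finite[OF c sec[OF S]]) (rule bounded_subset[OF K(2)], auto)
      ultimately show ?thesis
        using sec[OF S] by (subst emeasure_Diff[symmetric]) (auto simp: sets_counting[OF c])
    qed
    show ?case by (subst measurable_cong[OF eq], assumption) (intro borel_measurable_minus_ennreal compl(2) measurable_compose[OF measurable_snd measurable_emeasure_counting_space[OF K(1)]])
  next
    case (union F)
    then have F: "\<And>i. F i \<in> sets (N \<Otimes>\<^sub>M borel)" by (auto simp: sets_pair_measure)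
    have eq: "emeasure (snd p) {y\<in>K. (fst p, y) \<in> \<Union> (range F)} = (\<Sum>i. emeasure (snd p) {y\<in>K. (fst p, y) \<in> F i})"
      if "p \<in> space ?P" for p
    proof -
      from that have c: "snd p \<in> counting_measures" by (auto simp: space_pair_measure space_counting_space)
      have "{y\<in>K. (fst p, y) \<in> \<Union> (range F)} = (\<Union>i. {y\<in>K. (fst p, y) \<in> F i})" by auto
      moreover have "disjoint_family (\<lambda>i. {y\<in>K. (fst p, y) \<in> F i})"
        using union(1) unfolding disjoint_family_on_def by blast
      ultimately show ?thesis
        using sec[OF F] by (subst suminf_emeasure) (auto simp: sets_counting[OF c])
    qed
    show ?case by (subst measurable_cong[OF eq], assumption) (intro borel_measurable_suminf_order union.IH)
  qed simp
qed

text \<open>Here the integrating measure itself varies measurably. Standard induction over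
  nonnegative functions; sections of a set may have infinite mass, so the indicator case exhausts
  the space by balls of integer radius.\<close>

lemma measurable_nn_integral_counting:
  assumes "f \<in> borel_measurable (N \<Otimes>\<^sub>M (borel :: 'a::euclidean_space measure))"
  shows "(\<lambda>p. \<integral>\<^sup>+y. f (fst p, y) \<partial>snd p) \<in> borel_measurable (N \<Otimes>\<^sub>M counting_space)"
    (is "_ \<in> borel_measurable ?P")
  using assms
proof (induction rule: borel_measurable_induct)
  case (cong f g)
  have "(\<integral>\<^sup>+y. g (fst p, y) \<partial>snd p) = (\<integral>\<^sup>+y. f (fst p, y) \<partial>snd p)" if "p \<in> space ?P" for p
  proof -
    from that have "space (snd p) = UNIV" "fst p \<in> space N"
      by (auto simp: space_pair_measure space_counting_space space_counting)
    then show ?thesis using cong(3) by (intro nn_integral_cong) (auto simp: space_pair_measure)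
  qed
  with cong(4) show ?case by (subst measurable_cong) auto
next
  case (set S)
  have "(\<integral>\<^sup>+y. indicator S (fst p, y) \<partial>snd p) = (SUP n. emeasure (snd p) {y\<in>cball 0 (real n). (fst p, y) \<in> S})"
    if "p \<in> space ?P" for p
  proof -
    from that have c: "snd p \<in> counting_measures" by (auto simp: space_pair_measure space_counting_space)
    have S1: "Pair (fst p) -` S \<in> sets borel" using sets_Pair1[OF set, of "fst p"] by simp
    have S2: "{y\<in>cball 0 (real n). (fst p, y) \<in> S} \<in> sets borel" for n
    proof -
      have "{y\<in>cball 0 (real n). (fst p, y) \<in> S} = cball 0 (real n) \<inter> Pair (fst p) -` S" by auto
      then show ?thesis using S1 by auto
    qed
    have "(\<integral>\<^sup>+y. indicator S (fst p, y) \<partial>snd p) = (\<integral>\<^sup>+y. indicator (Pair (fst p) -` S) y \<partial>snd p)"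
      by (intro nn_integral_cong) (auto simp: indicator_def)
    also have "\<dots> = emeasure (snd p) (Pair (fst p) -` S)"
      using S1 by (simp add: sets_counting[OF c])
    also have "Pair (fst p) -` S = (\<Union>n. {y\<in>cball 0 (real n). (fst p, y) \<in> S})"
      using real_arch_simple by auto
    also have "emeasure (snd p) \<dots> = (SUP n. emeasure (snd p) {y\<in>cball 0 (real n). (fst p, y) \<in> S})"
      using S2 by (intro SUP_emeasure_incseq[symmetric]) (auto simp: incseq_def sets_counting[OF c])
    finally show ?thesis .
  qed
  moreover have "(\<lambda>p. SUP n. emeasure (snd p) {y\<in>cball 0 (real n). (fst p, y) \<in> S}) \<in> borel_measurable ?P"
    by (intro borel_measurable_SUP measurable_emeasure_counting_bounded set) auto
  ultimately show ?case by (subst measurable_cong) auto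
next
  case (mult u v)
  have eq: "(\<integral>\<^sup>+y. v * u (fst p, y) \<partial>snd p) = v * (\<integral>\<^sup>+y. u (fst p, y) \<partial>snd p)"
    if "p \<in> space ?P" for p
  proof -
    from that have c: "snd p \<in> counting_measures" "fst p \<in> space N" by (auto simp: space_pair_measure space_counting_space)
    then show ?thesis using measurable_Pair2[OF mult(2)]
      by (intro nn_integral_cmult) (auto simp: measurable_counting[OF c(1)])
  qed
  show ?case by (subst measurable_cong[OF eq], assumption) (use mult(4) in measurable)
next
  case (add u v)
  have eq: "(\<integral>\<^sup>+y. v (fst p, y) + u (fst p, y) \<partial>snd p) = (\<integral>\<^sup>+y. v (fst p, y) \<partial>snd p) + (\<integral>\<^sup>+y. u (fst p, y) \<partial>snd p)"
    if "p \<in> space ?P" for p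
  proof -
    from that have c: "snd p \<in> counting_measures" "fst p \<in> space N" by (auto simp: space_pair_measure space_counting_space)
    then show ?thesis using measurable_Pair2[OF add.hyps(1)] measurable_Pair2[OF add.hyps(3)]
      by (intro nn_integral_add) (auto simp: measurable_counting[OF c(1)])
  qed
  show ?case by (subst measurable_cong[OF eq], assumption) (intro borel_measurable_add add.IH)
next
  case (seq U)
  have eq: "(\<integral>\<^sup>+y. (SUP i. U i) (fst p, y) \<partial>snd p) = (SUP i. (\<integral>\<^sup>+y. U i (fst p, y) \<partial>snd p))"
    if "p \<in> space ?P" for p
  proof -
    from that have c: "snd p \<in> counting_measures" "fst p \<in> space N" by (auto simp: space_pair_measure space_counting_space)
    show ?thesis unfolding SUP_apply using measurable_Pair2[OF seq(1) c(2)] seq.hyps(3)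
      by (intro nn_integral_monotone_convergence_SUP)
        (auto simp: measurable_counting[OF c(1)] incseq_def le_fun_def)
  qed
  show ?case by (subst measurable_cong[OF eq], assumption) (intro borel_measurable_SUP seq.IH, simp)
qed

lemma measurable_nn_integral_counting':
  assumes [measurable]: "(\<lambda>(a, y). f a y) \<in> borel_measurable (N \<Otimes>\<^sub>M (borel :: 'a::euclidean_space measure))"
    and [measurable]: "\<Phi> \<in> measurable N counting_space"
  shows "(\<lambda>a. \<integral>\<^sup>+y. f a y \<partial>\<Phi> a) \<in> borel_measurable N"
proof -
  have "(\<lambda>a. (a, \<Phi> a)) \<in> measurable N (N \<Otimes>\<^sub>M counting_space)" by measurable
  from measurable_compose[OF this measurable_nn_integral_counting[OF assms(1)]]
  show ?thesis by simp
qed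

text \<open>Joint measurability in configuration and shift is what makes \<open>Y1\<close> and
  \<open>Y2\<close> measurable when evaluated at random points of a random configuration.\<close>

lemma translate_measurable:
  "(\<lambda>p. translate (fst p) (snd p)) \<in> measurable (counting_space \<Otimes>\<^sub>M borel) (counting_space :: 'a::euclidean_space measure measure)"
proof (rule measurable_counting_spaceI)
  let ?N = "counting_space \<Otimes>\<^sub>M borel :: ('a measure \<times> 'a) measure"
  have c: "p \<in> space ?N \<Longrightarrow> fst p \<in> counting_measures" for p
    by (auto simp: space_pair_measure space_counting_space)
  then show "p \<in> space ?N \<Longrightarrow> translate (fst p) (snd p) \<in> counting_measures" for p
    by (simp add: translate_counting)
  fix B :: "'a set" assume [measurable]: "B \<in> sets borel"
  have "(\<lambda>p. \<integral>\<^sup>+y. indicator B (y - snd p) \<partial>fst p) \<in> borel_measurable ?N"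
    by (rule measurable_nn_integral_counting') measurable
  moreover have "(\<integral>\<^sup>+y. indicator B (y - snd p) \<partial>fst p) = emeasure (translate (fst p) (snd p)) B"
    if "p \<in> space ?N" for p
  proof -
    have [measurable]: "{y. y - snd p \<in> B} \<in> sets borel" by measurable
    have "(\<integral>\<^sup>+y. indicator B (y - snd p) \<partial>fst p) = (\<integral>\<^sup>+y. indicator {y. y - snd p \<in> B} y \<partial>fst p)"
      by (intro nn_integral_cong) (auto simp: indicator_def)
    also have "\<dots> = emeasure (translate (fst p) (snd p)) B"
      using c[OF that] by (simp add: emeasure_translate sets_counting)
    finally show ?thesis .
  qed
  ultimately show "(\<lambda>p. emeasure (translate (fst p) (snd p)) B) \<in> borel_measurable ?N"
    by (subst measurable_cong) (auto simp: eq_commute)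
qed

subsection \<open>Independence from factorising Laplace functionals\<close>

context prob_space
begin

lemma integrable_bounded:
  fixes f :: "'a \<Rightarrow> real"
  assumes "f \<in> borel_measurable M" "\<And>x. \<bar>f x\<bar> \<le> c"
  shows "integrable M f"
  using assms by (intro integrable_const_bound[where B = c]) auto

text \<open>\<open>Z\<close> acts as a signed weight, and the hypothesis says that the power series
  in \<open>s\<close> with coefficients E(1[N = m] Z) vanishes on (0,1). By induction the
  coefficients below \<open>m\<close> are 0; dividing by \<open>s ^ m\<close> and letting
  \<open>s\<close> tend to 0 isolates the coefficient \<open>m\<close>, by dominated
  convergence.\<close>

lemma pgf_zero_imp_coefficient_zero:
  fixes N :: "'a \<Rightarrow> nat" and Z :: "'a \<Rightarrow> real"
  assumes N [measurable]: "N \<in> measurable M (count_space UNIV)"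
    and Z [measurable]: "Z \<in> borel_measurable M" and c: "\<And>x. \<bar>Z x\<bar> \<le> c"
    and zero: "\<And>s. 0 < s \<Longrightarrow> s < 1 \<Longrightarrow> expectation (\<lambda>x. s ^ N x * Z x) = 0"
  shows "expectation (\<lambda>x. of_bool (N x = m) * Z x) = 0"
proof (induction m rule: less_induct)
  case (less m)
  have c0: "0 \<le> c" using c[of undefined] by linarith
  have z: "expectation (\<lambda>x. s ^ (N x - m) * of_bool (m \<le> N x) * Z x) = 0" if s: "0 < s" "s < 1" for s :: real
  proof -
    have int1: "integrable M (\<lambda>x. s ^ n * (of_bool (N x = n) * Z x))" for n
      using c c0 s by (intro integrable_mult_right integrable_bounded[where c = c]) auto
    have int2: "integrable M (\<lambda>x. s ^ (N x - m) * of_bool (m \<le> N x) * Z x)"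
      using c c0 s power_le_one[of s]
      by (intro integrable_bounded[where c = c]) (auto simp: abs_mult mult_le_one intro!: order_trans[OF mult_left_le_one_le])
    have "0 = expectation (\<lambda>x. s ^ N x * Z x)"
      using zero[OF s] by simp
    also have "\<dots> = expectation (\<lambda>x. (\<Sum>n<m. s ^ n * (of_bool (N x = n) * Z x)) + s ^ m * (s ^ (N x - m) * of_bool (m \<le> N x) * Z x))"
    proof (intro Bochner_Integration.integral_cong refl)
      fix x
      show "s ^ N x * Z x = (\<Sum>n<m. s ^ n * (of_bool (N x = n) * Z x)) + s ^ m * (s ^ (N x - m) * of_bool (m \<le> N x) * Z x)"
      proof (cases "m \<le> N x")
        case True
        then have "(\<Sum>n<m. s ^ n * (of_bool (N x = n) * Z x)) = 0" by (intro sum.neutral) auto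
        then show ?thesis using True by (simp add: power_add[symmetric])
      next
        case False
        have "(\<Sum>n<m. s ^ n * (of_bool (N x = n) * Z x)) = (\<Sum>n<m. if n = N x then s ^ n * Z x else 0)"
          by (intro sum.cong) auto
        then show ?thesis using False by simp
      qed
    qed
    also have "\<dots> = (\<Sum>n<m. s ^ n * expectation (\<lambda>x. of_bool (N x = n) * Z x)) + s ^ m * expectation (\<lambda>x. s ^ (N x - m) * of_bool (m \<le> N x) * Z x)"
      using int1 int2 by (subst Bochner_Integration.integral_add) (auto simp: Bochner_Integration.integral_sum)
    also have "\<dots> = s ^ m * expectation (\<lambda>x. s ^ (N x - m) * of_bool (m \<le> N x) * Z x)"
      using less by simp
    finally show ?thesis using s by simp
  qed
  define s where "s k = 1 / (real k + 2)" for k :: nat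
  have s: "0 < s k" "s k < 1" for k by (auto simp: s_def)
  have s0: "s \<longlonglongrightarrow> 0" unfolding s_def by real_asymp
  have "(\<lambda>k. expectation (\<lambda>x. s k ^ (N x - m) * of_bool (m \<le> N x) * Z x)) \<longlonglongrightarrow> expectation (\<lambda>x. of_bool (N x = m) * Z x)"
  proof (rule integral_dominated_convergence[where w = "\<lambda>_. c"])
    show "AE x in M. (\<lambda>k. s k ^ (N x - m) * of_bool (m \<le> N x) * Z x) \<longlonglongrightarrow> of_bool (N x = m) * Z x"
    proof (rule AE_I2)
      fix x
      consider "N x < m" | "N x = m" | "N x > m" by linarith
      then show "(\<lambda>k. s k ^ (N x - m) * of_bool (m \<le> N x) * Z x) \<longlonglongrightarrow> of_bool (N x = m) * Z x"
      proof cases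
        case 3
        then have "(\<lambda>k. s k ^ (N x - m)) \<longlonglongrightarrow> 0 ^ (N x - m)" by (intro tendsto_intros s0)
        from tendsto_mult_right[OF this, of "Z x"] 3 show ?thesis by (auto simp: power_0_left)
      qed auto
    qed
    show "AE x in M. norm (s k ^ (N x - m) * of_bool (m \<le> N x) * Z x) \<le> c" for k
      using c c0 s power_le_one[of "s k"] less_imp_le[OF s(1)] less_imp_le[OF s(2)]
      by (auto simp: abs_mult intro!: order_trans[OF mult_left_le_one_le])
  qed auto
  then have "(\<lambda>k. 0) \<longlonglongrightarrow> expectation (\<lambda>x. of_bool (N x = m) * Z x)" by (simp add: z s)
  then show ?case by (simp add: LIMSEQ_const_iff)
qed

text \<open>One variable at a time. The factors of the other variables are bounded and can be
  absorbed into the weight, both as powers and as indicators; hence the induction over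
  \<open>J\<close> with \<open>Z\<close> arbitrary.\<close>

lemma joint_pgf_zero_imp_coefficient_zero:
  fixes N :: "'i \<Rightarrow> 'a \<Rightarrow> nat" and Z :: "'a \<Rightarrow> real"
  assumes "finite J" "\<And>j. j \<in> J \<Longrightarrow> N j \<in> measurable M (count_space UNIV)"
    and "Z \<in> borel_measurable M" and "\<And>x. \<bar>Z x\<bar> \<le> c"
    and "\<And>s. (\<And>j. 0 < s j \<and> s j < 1) \<Longrightarrow> expectation (\<lambda>x. (\<Prod>j\<in>J. s j ^ N j x) * Z x) = 0"
  shows "expectation (\<lambda>x. (\<Prod>j\<in>J. of_bool (N j x = m j)) * Z x) = 0"
  using assms
proof (induction J arbitrary: Z rule: finite_induct)
  case empty
  from empty.prems(4)[of "\<lambda>_. 1/2"] show ?case by simp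
next
  case (insert j J)
  note [measurable] = insert.prems(2) and c = insert.prems(3)
  have [measurable]: "N j \<in> measurable M (count_space UNIV)" "\<And>i. i \<in> J \<Longrightarrow> N i \<in> measurable M (count_space UNIV)"
    using insert.prems(1) by auto
  have "expectation (\<lambda>x. (\<Prod>j\<in>J. of_bool (N j x = m j)) * (of_bool (N j x = m j) * Z x)) = 0"
  proof (rule insert.IH)
    show "\<bar>of_bool (N j x = m j) * Z x\<bar> \<le> c" for x using c[of x] by auto
    fix s :: "'i \<Rightarrow> real" assume s: "\<And>i. 0 < s i \<and> s i < 1"
    have s01: "0 \<le> (\<Prod>j\<in>J. s j ^ N j x)" "(\<Prod>j\<in>J. s j ^ N j x) \<le> 1" for x
      using s less_imp_le[of "s _" 1] less_imp_le[of 0 "s _"] by (auto intro!: prod_nonneg prod_le_1 power_le_one)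
    have "expectation (\<lambda>x. of_bool (N j x = m j) * ((\<Prod>j\<in>J. s j ^ N j x) * Z x)) = 0"
    proof (rule pgf_zero_imp_coefficient_zero)
      show "\<bar>(\<Prod>j\<in>J. s j ^ N j x) * Z x\<bar> \<le> c" for x
        using s01[of x] c[of x] by (auto simp: abs_mult intro: order_trans[OF mult_left_le_one_le])
      fix t :: real assume t: "0 < t" "t < 1"
      have "expectation (\<lambda>x. (\<Prod>i\<in>insert j J. (s(j := t)) i ^ N i x) * Z x) = 0"
        by (rule insert.prems(4)) (use s t in auto)
      also have "(\<lambda>x. (\<Prod>i\<in>insert j J. (s(j := t)) i ^ N i x) * Z x) = (\<lambda>x. t ^ N j x * ((\<Prod>j\<in>J. s j ^ N j x) * Z x))"
      proof
        fix x
        have "(\<Prod>i\<in>J. (s(j := t)) i ^ N i x) = (\<Prod>j\<in>J. s j ^ N j x)"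
          using insert.hyps by (intro prod.cong) auto
        then show "(\<Prod>i\<in>insert j J. (s(j := t)) i ^ N i x) * Z x = t ^ N j x * ((\<Prod>j\<in>J. s j ^ N j x) * Z x)"
          using insert.hyps by simp
      qed
      finally show "expectation (\<lambda>x. t ^ N j x * ((\<Prod>j\<in>J. s j ^ N j x) * Z x)) = 0" .
    qed measurable
    then show "expectation (\<lambda>x. (\<Prod>j\<in>J. s j ^ N j x) * (of_bool (N j x = m j) * Z x)) = 0"
      by (simp add: ac_simps)
  qed auto
  then show ?case using insert.hyps by (simp add: ac_simps)
qed

text \<open>Factorisation says that the powers over \<open>J\<close> are uncorrelated with the
  centred powers over \<open>J'\<close>. Extracting coefficients in \<open>J\<close>, with the
  centred second factor as weight, replaces the first factor by indicators; then the same is done in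
  \<open>J'\<close>, with the centred indicator as weight.\<close>

lemma joint_pgf_factorises_imp_indep:
  fixes N :: "'i \<Rightarrow> 'a \<Rightarrow> nat" and N' :: "'j \<Rightarrow> 'a \<Rightarrow> nat"
  assumes fin: "finite J" "finite J'"
    and N [measurable]: "\<And>j. j \<in> J \<Longrightarrow> N j \<in> measurable M (count_space UNIV)" 
    and N' [measurable]: "\<And>j. j \<in> J' \<Longrightarrow> N' j \<in> measurable M (count_space UNIV)"
    and pgf: "\<And>(s :: 'i \<Rightarrow> real) (s' :: 'j \<Rightarrow> real). (\<And>j. 0 < s j \<and> s j < 1) \<Longrightarrow> (\<And>j. 0 < s' j \<and> s' j < 1) \<Longrightarrow>
      expectation (\<lambda>x. (\<Prod>j\<in>J. s j ^ N j x) * (\<Prod>j\<in>J'. s' j ^ N' j x)) =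
      expectation (\<lambda>x. \<Prod>j\<in>J. s j ^ N j x) * expectation (\<lambda>x. \<Prod>j\<in>J'. s' j ^ N' j x)"
  shows "expectation (\<lambda>x. (\<Prod>j\<in>J. of_bool (N j x = m j)) * (\<Prod>j\<in>J'. of_bool (N' j x = m' j)) :: real) =
      expectation (\<lambda>x. \<Prod>j\<in>J. of_bool (N j x = m j)) * expectation (\<lambda>x. \<Prod>j\<in>J'. of_bool (N' j x = m' j))"
proof -
  define P where "P s x = (\<Prod>j\<in>J. s j ^ N j x)" for s :: "'i \<Rightarrow> real" and x
  define P' where "P' s x = (\<Prod>j\<in>J'. s j ^ N' j x)" for s :: "'j \<Rightarrow> real" and x
  define I where "I x = (\<Prod>j\<in>J. of_bool (N j x = m j) :: real)" for x
  define I' where "I' x = (\<Prod>j\<in>J'. of_bool (N' j x = m' j) :: real)" for x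
  have [measurable]: "P s \<in> borel_measurable M" "P' s' \<in> borel_measurable M" "I \<in> borel_measurable M" "I' \<in> borel_measurable M" for s s'
    unfolding P_def P'_def I_def I'_def by measurable
  have P01: "0 \<le> P s x" "P s x \<le> 1" if "\<And>j. 0 < s j \<and> s j < 1" for s x
    using that less_imp_le[of "s _" 1] less_imp_le[of 0 "s _"] unfolding P_def by (auto intro!: prod_nonneg prod_le_1 power_le_one)
  have P'01: "0 \<le> P' s x" "P' s x \<le> 1" if "\<And>j. 0 < s j \<and> s j < 1" for s x
    using that less_imp_le[of "s _" 1] less_imp_le[of 0 "s _"] unfolding P'_def by (auto intro!: prod_nonneg prod_le_1 power_le_one)
  have I01: "0 \<le> I x" "I x \<le> 1" "0 \<le> I' x" "I' x \<le> 1" for x unfolding I_def I'_def by (auto intro!: prod_nonneg prod_le_1)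
  have int: "integrable M (P s)" "integrable M (\<lambda>x. P s x * P' s' x)" "integrable M (P' s')"
    "integrable M (\<lambda>x. I x * P' s' x)"
    if "\<And>j. 0 < s j \<and> s j < 1" "\<And>j. 0 < s' j \<and> s' j < 1" for s s'
    using P01[OF that(1)] P'01[OF that(2)] I01
    by (auto intro!: integrable_bounded[where c = 1] simp: abs_mult mult_le_one)
  have intI [simp]: "integrable M I" "integrable M I'" "integrable M (\<lambda>x. I' x * I x)"
    using I01 by (auto intro!: integrable_bounded[where c = 1] simp: abs_mult mult_le_one)
  have *: "expectation (\<lambda>x. I x * (P' s x - expectation (P' s))) = 0" if s: "\<And>j. 0 < s j \<and> s j < 1" for s
    unfolding I_def
  proof (rule joint_pgf_zero_imp_coefficient_zero[OF fin(1) N])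
    show "\<bar>P' s x - expectation (P' s)\<bar> \<le> 1 + \<bar>expectation (P' s)\<bar>" for x
    proof -
      have "0 \<le> P' s x" "P' s x \<le> 1" using P'01 s by auto
      then show ?thesis by linarith
    qed
    fix s' :: "'i \<Rightarrow> real" assume s': "\<And>j. 0 < s' j \<and> s' j < 1"
    have "expectation (\<lambda>x. P s' x * (P' s x - expectation (P' s))) =
        expectation (\<lambda>x. P s' x * P' s x) - expectation (P s') * expectation (P' s)"
      using int[of s' s] s s' by (simp add: right_diff_distrib)
    also have "\<dots> = 0" using pgf[of s' s] s s' by (simp add: P_def[abs_def] P'_def[abs_def])
    finally show "expectation (\<lambda>x. (\<Prod>j\<in>J. s' j ^ N j x) * (P' s x - expectation (P' s))) = 0"
      by (simp add: P_def)
  qed auto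
  have "expectation (\<lambda>x. I' x * (I x - expectation I)) = 0"
    unfolding I'_def
  proof (rule joint_pgf_zero_imp_coefficient_zero[OF fin(2) N'])
    show "\<bar>I x - expectation I\<bar> \<le> 1 + \<bar>expectation I\<bar>" for x
      using I01[of x] by linarith
    fix s :: "'j \<Rightarrow> real" assume s: "\<And>j. 0 < s j \<and> s j < 1"
    have "expectation (\<lambda>x. P' s x * (I x - expectation I)) = expectation (\<lambda>x. I x * P' s x) - expectation (P' s) * expectation I"
      using int[of "\<lambda>_. 1/2" s] s by (simp add: right_diff_distrib mult.commute)
    also have "\<dots> = expectation (\<lambda>x. I x * (P' s x - expectation (P' s)))"
      using int[of "\<lambda>_. 1/2" s] s by (simp add: right_diff_distrib mult.commute)
    finally show "expectation (\<lambda>x. (\<Prod>j\<in>J'. s j ^ N' j x) * (I x - expectation I)) = 0"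
      using *[OF s] by (simp add: P'_def)
  qed auto
  then have "expectation (\<lambda>x. I' x * I x) = expectation I' * expectation I"
    by (simp add: right_diff_distrib)
  then show ?thesis by (simp add: I_def[abs_def] I'_def[abs_def] mult.commute)
qed

end

section \<open>Test functions, and from Laplace functionals to independence of restrictions\<close>

text \<open>Simple functions are enough to recover joint generating functions of counts, and their
  integrals are finite combinations of counts. Nonnegativity keeps \<open>exp (- ...)\<close>
  between 0 and 1.\<close>

definition test_fun :: "'a::euclidean_space set \<Rightarrow> ('a \<Rightarrow> real) \<Rightarrow> bool" where
  "test_fun A h \<longleftrightarrow> simple_function borel h \<and> (\<forall>x. 0 \<le> h x) \<and> (\<forall>x. x \<notin> A \<longrightarrow> h x = 0)"

lemma test_funD:
  assumes "test_fun A h"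
  shows "simple_function borel h" "h \<in> borel_measurable borel" "\<And>x. 0 \<le> h x" "\<And>x. x \<notin> A \<Longrightarrow> h x = 0"
  using assms unfolding test_fun_def by (auto intro: borel_measurable_simple_function)

lemma test_fun_bounded:
  assumes "test_fun A h"
  obtains c where "0 \<le> c" "\<And>x. h x \<le> c"
proof -
  have "finite (range h)" using simple_functionD(1)[OF test_funD(1)[OF assms]] by simp
  then have "h x \<le> Max (range h)" for x by auto
  moreover have "0 \<le> Max (range h)" using test_funD(3)[OF assms] calculation order_trans by blast
  ultimately show ?thesis using that by blast
qed



lemma test_fun_add: "test_fun A h \<Longrightarrow> test_fun B g \<Longrightarrow> test_fun (A \<union> B) (\<lambda>x. h x + g x)"
  unfolding test_fun_def by (auto intro: simple_function_add)

lemma test_fun_integrable: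
  assumes "test_fun A h" "\<phi> \<in> counting_measures" "A \<in> sets borel" "bounded A"
  shows "integrable \<phi> h"
proof -
  obtain c where c: "0 \<le> c" "\<And>x. h x \<le> c" using test_fun_bounded[OF assms(1)] by blast
  have "integrable \<phi> (\<lambda>x. c * indicator A x)"
    using emeasure_counting_finite[OF assms(2-4)] assms(3)
    by (intro integrable_mult_right integrable_real_indicator) (auto simp: sets_counting[OF assms(2)])
  then show ?thesis
  proof (rule Bochner_Integration.integrable_bound)
    show "h \<in> borel_measurable \<phi>"
      using test_funD(2)[OF assms(1)] by (simp add: measurable_counting[OF assms(2)])
    show "AE x in \<phi>. norm (h x) \<le> norm (c * indicator A x)"
      using test_funD(3,4)[OF assms(1)] c by (intro AE_I2) (auto simp: indicator_def)
  qed
qed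

abbreviation (in prob_space) laplace :: "('a \<Rightarrow> 'b::euclidean_space measure) \<Rightarrow> ('b \<Rightarrow> real) \<Rightarrow> real" where
  "laplace \<Xi> h \<equiv> expectation (\<lambda>\<omega>. exp (- (\<integral>x. h x \<partial>\<Xi> \<omega>)))"

definition (in prob_space) laplace_factorises ::
  "('a \<Rightarrow> 'b::euclidean_space measure) \<Rightarrow> 'b set \<Rightarrow> 'b set \<Rightarrow> bool" where
  "laplace_factorises \<Xi> A B \<longleftrightarrow> (\<forall>g h. test_fun A g \<longrightarrow> test_fun B h \<longrightarrow>
    laplace \<Xi> (\<lambda>x. g x + h x) =
    laplace \<Xi> g * laplace \<Xi> h)"

text \<open>The cylinder events of the process seen in \<open>A\<close>. \<open>F\<close> is a
  relation between sets and counts, so that intersecting two events amounts to taking a union of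
  relations; contradictory prescriptions merely give the empty event. This makes the family a
  \<pi>-system.\<close>

definition count_events :: "'w measure \<Rightarrow> ('w \<Rightarrow> 'b::euclidean_space measure) \<Rightarrow> 'b set \<Rightarrow> 'w set set" where
  "count_events M \<Xi> A = {{\<omega>\<in>space M. \<forall>(C, n)\<in>F. measure (\<Xi> \<omega>) (C \<inter> A) = real n} | F. finite F \<and> fst ` F \<subseteq> sets borel}"

text \<open>The cylinder events generate everything observable in \<open>A\<close>: since
  \<open>A\<close> is bounded, each count is a natural number, so its countably many level sets
  determine it.\<close>

lemma restrict_to_measurable_count_events:
  assumes \<Xi>: "\<Xi> \<in> measurable M counting_space" and A: "A \<in> sets borel" "bounded A"
  shows "(\<lambda>\<omega>. restrict_to (\<Xi> \<omega>) A) \<in> measurable (sigma (space M) (count_events M \<Xi> A)) counting_space"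
    (is "_ \<in> measurable ?S _")
proof (rule measurable_counting_spaceI)
  have c: "\<omega> \<in> space M \<Longrightarrow> \<Xi> \<omega> \<in> counting_measures" for \<omega>
    using measurable_space[OF \<Xi>] by (simp add: space_counting_space)
  have P: "count_events M \<Xi> A \<subseteq> Pow (space M)" unfolding count_events_def by auto
  show "\<omega> \<in> space ?S \<Longrightarrow> restrict_to (\<Xi> \<omega>) A \<in> counting_measures" for \<omega>
    using c A P by (simp add: restrict_to_counting space_measure_of)
  fix C :: "'b set" assume C: "C \<in> sets borel"
  have nat: "\<exists>n::nat. emeasure (\<Xi> \<omega>) (C \<inter> A) = of_nat n \<and> measure (\<Xi> \<omega>) (C \<inter> A) = real n" if "\<omega> \<in> space M" for \<omega>
  proof -
    have "bounded (C \<inter> A)" using A(2) by (rule bounded_subset) auto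
    with counting_measure_nat[OF c[OF that], of "C \<inter> A"] A C show ?thesis by blast
  qed
  define N where "N \<omega> = nat \<lfloor>measure (\<Xi> \<omega>) (C \<inter> A)\<rfloor>" for \<omega>
  have "N \<in> measurable ?S (count_space UNIV)"
  proof (subst measurable_count_space_eq2_countable, intro conjI ballI)
    fix n :: nat
    have "N -` {n} \<inter> space M = {\<omega>\<in>space M. \<forall>(C, n)\<in>{(C, n)}. measure (\<Xi> \<omega>) (C \<inter> A) = real n}"
      using nat by (force simp: N_def)
    also have "\<dots> \<in> count_events M \<Xi> A" unfolding count_events_def mem_Collect_eq
      using C by (intro exI[of _ "{(C, n)}"]) auto
    finally show "N -` {n} \<inter> space ?S \<in> sets ?S"
      using P by (simp add: space_measure_of)
  qed auto
  then have "(\<lambda>\<omega>. of_nat (N \<omega>)) \<in> borel_measurable ?S"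
    by measurable
  moreover have "emeasure (restrict_to (\<Xi> \<omega>) A) C = of_nat (N \<omega>)" if "\<omega> \<in> space M" for \<omega>
    using nat[OF that] c[OF that] A C by (auto simp: emeasure_restrict_to N_def)
  ultimately show "(\<lambda>\<omega>. emeasure (restrict_to (\<Xi> \<omega>) A) C) \<in> borel_measurable ?S"
    using P by (subst measurable_cong[where g = "\<lambda>\<omega>. of_nat (N \<omega>)"]) (auto simp: space_measure_of)
qed

text \<open>With weights \<open>t p = - ln (s p)\<close>, \<open>exp\<close> of minus this integral
  is the product of the powers of \<open>s p\<close> with the counts as exponents. Laplace
  functionals thus contain the joint generating functions.\<close>

lemma test_fun_count_functional:
  fixes t :: "('b::euclidean_space set \<times> nat) \<Rightarrow> real"
  assumes F: "finite F" "fst ` F \<subseteq> sets borel" and t: "\<And>p. 0 \<le> t p" and A: "A \<in> sets borel" "bounded A"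
  shows "test_fun A (\<lambda>x. \<Sum>p\<in>F. t p * indicator (fst p \<inter> A) x)"
    and "\<phi> \<in> counting_measures \<Longrightarrow> (\<integral>x. (\<Sum>p\<in>F. t p * indicator (fst p \<inter> A) x) \<partial>\<phi>) = (\<Sum>p\<in>F. t p * measure \<phi> (fst p \<inter> A))"
proof -
  have "simple_function borel (\<lambda>x. \<Sum>p\<in>F. t p * indicator (fst p \<inter> A) x)"
    using F A by (intro simple_function_sum simple_function_mult simple_function_indicator) auto
  then show "test_fun A (\<lambda>x. \<Sum>p\<in>F. t p * indicator (fst p \<inter> A) x)"
    unfolding test_fun_def using t by (auto intro!: sum_nonneg)
  assume c: "\<phi> \<in> counting_measures"
  have i: "integrable \<phi> (indicator (fst p \<inter> A) :: 'b \<Rightarrow> real)" if "p \<in> F" for p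
  proof (rule integrable_real_indicator)
    show "fst p \<inter> A \<in> sets \<phi>" using that F A by (auto simp: sets_counting[OF c])
    show "emeasure \<phi> (fst p \<inter> A) < \<infinity>"
      using that F A by (intro emeasure_counting_finite[OF c]) (auto intro: bounded_subset)
  qed
  show "(\<integral>x. (\<Sum>p\<in>F. t p * indicator (fst p \<inter> A) x) \<partial>\<phi>) = (\<Sum>p\<in>F. t p * measure \<phi> (fst p \<inter> A))"
    using i by (subst Bochner_Integration.integral_sum) (auto simp: space_counting[OF c])
qed

context prob_space
begin

text \<open>Restricted to weighted sums of indicators, factorisation is that of joint generating
  functions, hence of the probabilities of cylinder events. These are \<pi>-systems, so independence
  extends to the generated \<sigma>-fields.\<close>

lemma laplace_factorises_imp_indep_restrict:
  assumes \<Xi>: "\<Xi> \<in> measurable M counting_space"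
    and A: "A \<in> sets borel" "bounded A" and B: "B \<in> sets borel" "bounded B"
    and L: "laplace_factorises \<Xi> A B"
  shows "indep_var counting_space (\<lambda>\<omega>. restrict_to (\<Xi> \<omega>) A) counting_space (\<lambda>\<omega>. restrict_to (\<Xi> \<omega>) B)"
proof -
  note [measurable] = \<Xi>
  have c: "\<omega> \<in> space M \<Longrightarrow> \<Xi> \<omega> \<in> counting_measures" for \<omega>
    using measurable_space[OF \<Xi>] by (simp add: space_counting_space)
  have ev: "count_events M \<Xi> A \<subseteq> events" if [measurable]: "A \<in> sets borel" for A
  proof
    fix E assume "E \<in> count_events M \<Xi> A"
    then obtain F where F: "finite F" "fst ` F \<subseteq> sets borel" 
      and E: "E = {\<omega>\<in>space M. \<forall>p\<in>F. measure (\<Xi> \<omega>) (fst p \<inter> A) = real (snd p)}"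
      unfolding count_events_def by (auto simp: case_prod_beta)
    have "{\<omega>\<in>space M. measure (\<Xi> \<omega>) (fst p \<inter> A) = real (snd p)} \<in> events" if "p \<in> F" for p
    proof -
      have [measurable]: "fst p \<in> sets borel" using that F by auto
      have "(\<lambda>\<omega>. measure (\<Xi> \<omega>) (fst p \<inter> A)) \<in> borel_measurable M" 
        by (rule measurable_compose[OF \<Xi> measurable_measure_counting_space]) measurable
      then show ?thesis by measurable
    qed
    with F show "E \<in> events" unfolding E by (intro sets.sets_Collect_finite_All) auto
  qed
  have stable: "Int_stable (count_events M \<Xi> A)" for A
    unfolding Int_stable_def count_events_def
  proof (intro ballI, elim CollectE exE conjE)
    fix S T F G assume *: "S = {\<omega>\<in>space M. \<forall>(C, n)\<in>F. measure (\<Xi> \<omega>) (C \<inter> A) = real n}" "finite F" "fst ` F \<subseteq> sets borel"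
      "T = {\<omega>\<in>space M. \<forall>(C, n)\<in>G. measure (\<Xi> \<omega>) (C \<inter> A) = real n}" "finite G" "fst ` G \<subseteq> sets borel"
    show "S \<inter> T \<in> {{\<omega>\<in>space M. \<forall>(C, n)\<in>F. measure (\<Xi> \<omega>) (C \<inter> A) = real n} | F. finite F \<and> fst ` F \<subseteq> sets borel}"
      using * by (intro CollectI exI[of _ "F \<union> G"]) auto
  qed
  have "indep_set (count_events M \<Xi> A) (count_events M \<Xi> B)"
  proof (rule indep_setI[OF ev[OF A(1)] ev[OF B(1)]])
    fix a b assume "a \<in> count_events M \<Xi> A" "b \<in> count_events M \<Xi> B"
    then obtain F G where F: "finite F" "fst ` F \<subseteq> sets borel" and G: "finite G" "fst ` G \<subseteq> sets borel"
      and a: "a = {\<omega>\<in>space M. \<forall>p\<in>F. measure (\<Xi> \<omega>) (fst p \<inter> A) = real (snd p)}"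
      and b: "b = {\<omega>\<in>space M. \<forall>p\<in>G. measure (\<Xi> \<omega>) (fst p \<inter> B) = real (snd p)}"
      unfolding count_events_def by (auto simp: case_prod_beta)
    \<comment> \<open>Counts in bounded sets are natural numbers, so rounding does not change them;
      it only supplies the type required of an exponent.\<close>
    define N where "N D p \<omega> = nat \<lfloor>measure (\<Xi> \<omega>) (fst p \<inter> D)\<rfloor>" for D and p :: "'b set \<times> nat" and \<omega>
    have N: "real (N D p \<omega>) = measure (\<Xi> \<omega>) (fst p \<inter> D)"
      if "\<omega> \<in> space M" "D \<in> sets borel" "bounded D" "fst p \<in> sets borel" for D p \<omega>
    proof -
      have "bounded (fst p \<inter> D)" using that(3) by (rule bounded_subset) auto
      with counting_measure_nat[OF c[OF that(1)], of "fst p \<inter> D"] that obtain n :: nat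
        where "measure (\<Xi> \<omega>) (fst p \<inter> D) = real n" by blast
      then show ?thesis by (simp add: N_def)
    qed
    have Nm: "N D p \<in> measurable M (count_space UNIV)" if [measurable]: "D \<in> sets borel" "fst p \<in> sets borel" for D p
    proof -
      have "(\<lambda>\<omega>. measure (\<Xi> \<omega>) (fst p \<inter> D)) \<in> borel_measurable M" 
        by (rule measurable_compose[OF \<Xi> measurable_measure_counting_space]) measurable
      then show ?thesis unfolding N_def by measurable
    qed
    have ind: "indicator {\<omega>\<in>space M. \<forall>p\<in>F. measure (\<Xi> \<omega>) (fst p \<inter> D) = real (snd p)} \<omega> = (\<Prod>p\<in>F. of_bool (N D p \<omega> = snd p) :: real)"
      if "\<omega> \<in> space M" "D \<in> sets borel" "bounded D" "finite F" "fst ` F \<subseteq> sets borel" for F D \<omega>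
    proof -
      have "measure (\<Xi> \<omega>) (fst p \<inter> D) = real (snd p) \<longleftrightarrow> N D p \<omega> = snd p" if "p \<in> F" for p
        using N[OF \<open>\<omega> \<in> space M\<close> \<open>D \<in> sets borel\<close> \<open>bounded D\<close>, of p] that \<open>fst ` F \<subseteq> sets borel\<close>
        by (metis image_subset_iff of_nat_eq_iff)
      then show ?thesis using that by (auto simp: indicator_def prod_zero_iff)
    qed
    have laplace: "(\<Prod>p\<in>F. s p ^ N D p \<omega>) = exp (- (\<integral>x. (\<Sum>p\<in>F. - ln (s p) * indicator (fst p \<inter> D) x) \<partial>\<Xi> \<omega>))"
      if "\<omega> \<in> space M" "D \<in> sets borel" "bounded D" "finite F" "fst ` F \<subseteq> sets borel" "\<And>p. 0 < s p \<and> s p < 1" for F D \<omega> and s :: "_ \<Rightarrow> real"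
    proof -
      have "s p ^ N D p \<omega> = exp (ln (s p) * measure (\<Xi> \<omega>) (fst p \<inter> D))" if "p \<in> F" for p
      proof -
        have "exp (ln (s p) * measure (\<Xi> \<omega>) (fst p \<inter> D)) = exp (ln (s p)) ^ N D p \<omega>"
          using N[OF \<open>\<omega> \<in> space M\<close> \<open>D \<in> sets borel\<close> \<open>bounded D\<close>, of p] that \<open>fst ` F \<subseteq> sets borel\<close>
          by (subst exp_of_nat2_mult[symmetric]) (auto simp: image_subset_iff)
        then show ?thesis using \<open>\<And>p. 0 < s p \<and> s p < 1\<close> by (simp add: exp_ln)
      qed
      then have "(\<Prod>p\<in>F. s p ^ N D p \<omega>) = exp (\<Sum>p\<in>F. ln (s p) * measure (\<Xi> \<omega>) (fst p \<inter> D))"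
        using that by (simp add: exp_sum)
      also have "\<dots> = exp (- (\<integral>x. (\<Sum>p\<in>F. - ln (s p) * indicator (fst p \<inter> D) x) \<partial>\<Xi> \<omega>))"
        using that by (subst test_fun_count_functional(2)[OF that(4,5) _ that(2,3) c[OF that(1)]])
          (auto simp: sum_negf less_imp_le)
      finally show ?thesis .
    qed
    have "expectation (\<lambda>x. (\<Prod>p\<in>F. of_bool (N A p x = snd p)) * (\<Prod>p\<in>G. of_bool (N B p x = snd p)) :: real) =
      expectation (\<lambda>x. \<Prod>p\<in>F. of_bool (N A p x = snd p)) * expectation (\<lambda>x. \<Prod>p\<in>G. of_bool (N B p x = snd p))"
    proof (rule joint_pgf_factorises_imp_indep[OF F(1) G(1)])
      fix s s' :: "'b set \<times> nat \<Rightarrow> real"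
      assume s: "\<And>j. 0 < s j \<and> s j < 1" and s': "\<And>j. 0 < s' j \<and> s' j < 1"
      define g where "g x = (\<Sum>p\<in>F. - ln (s p) * indicator (fst p \<inter> A) x)" for x
      define h where "h x = (\<Sum>p\<in>G. - ln (s' p) * indicator (fst p \<inter> B) x)" for x
      have g: "test_fun A g" and h: "test_fun B h" unfolding g_def h_def
        using s s' by (intro test_fun_count_functional(1) F G A B; simp add: less_imp_le)+
      have lg: "(\<Prod>j\<in>F. s j ^ N A j \<omega>) = exp (- (\<integral>x. g x \<partial>\<Xi> \<omega>))"
        and lh: "(\<Prod>j\<in>G. s' j ^ N B j \<omega>) = exp (- (\<integral>x. h x \<partial>\<Xi> \<omega>))" if "\<omega> \<in> space M" for \<omega>
        unfolding g_def h_def using laplace[OF that A F s] laplace[OF that B G s'] .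
      have "expectation (\<lambda>x. (\<Prod>j\<in>F. s j ^ N A j x) * (\<Prod>j\<in>G. s' j ^ N B j x)) =
          laplace \<Xi> (\<lambda>x. g x + h x)"
        using test_fun_integrable[OF g c A] test_fun_integrable[OF h c B]
        by (intro Bochner_Integration.integral_cong refl)
          (simp add: lg lh exp_add[symmetric])
      also have "\<dots> = laplace \<Xi> g * laplace \<Xi> h"
        using L g h by (auto simp: laplace_factorises_def)
      also have "laplace \<Xi> g = expectation (\<lambda>x. \<Prod>j\<in>F. s j ^ N A j x)"
        by (intro Bochner_Integration.integral_cong refl) (simp add: lg)
      also have "laplace \<Xi> h = expectation (\<lambda>x. \<Prod>j\<in>G. s' j ^ N B j x)"
        by (intro Bochner_Integration.integral_cong refl) (simp add: lh)
      finally show "expectation (\<lambda>x. (\<Prod>j\<in>F. s j ^ N A j x) * (\<Prod>j\<in>G. s' j ^ N B j x)) =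
        expectation (\<lambda>x. \<Prod>j\<in>F. s j ^ N A j x) * expectation (\<lambda>x. \<Prod>j\<in>G. s' j ^ N B j x)" .
    qed (use F G A B Nm in auto)
    moreover have prob_eq: "prob E = expectation f"
      if "E \<subseteq> space M" "\<And>\<omega>. \<omega> \<in> space M \<Longrightarrow> indicator E \<omega> = f \<omega>" for E and f :: "'a \<Rightarrow> real"
    proof -
      have "prob E = expectation (indicator E)" using that(1) by (simp add: Int_absorb2)
      also have "\<dots> = expectation f" using that(2) by (intro Bochner_Integration.integral_cong refl)
      finally show ?thesis .
    qed
    have "prob (a \<inter> b) = expectation (\<lambda>x. (\<Prod>p\<in>F. of_bool (N A p x = snd p)) * (\<Prod>p\<in>G. of_bool (N B p x = snd p)))"
      by (rule prob_eq) (auto simp: a b indicator_inter_arith ind[OF _ A F] ind[OF _ B G])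
    moreover have "prob a = expectation (\<lambda>x. \<Prod>p\<in>F. of_bool (N A p x = snd p))"
      by (rule prob_eq) (auto simp: a ind[OF _ A F])
    moreover have "prob b = expectation (\<lambda>x. \<Prod>p\<in>G. of_bool (N B p x = snd p))"
      by (rule prob_eq) (auto simp: b ind[OF _ B G])
    ultimately show "prob (a \<inter> b) = prob a * prob b" by simp
  qed
  from indep_set_sigma_sets[OF this stable stable]
  have indep: "indep_set (sigma_sets (space M) (count_events M \<Xi> A)) (sigma_sets (space M) (count_events M \<Xi> B))" .
  have sub: "sigma_sets (space M) {(\<lambda>\<omega>. restrict_to (\<Xi> \<omega>) A) -` S \<inter> space M | S. S \<in> sets counting_space}
      \<subseteq> sigma_sets (space M) (count_events M \<Xi> A)" if "A \<in> sets borel" "bounded A" for A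
  proof (rule sigma_sets_mono, safe)
    fix S :: "'b measure set" assume "S \<in> sets counting_space"
    have P: "count_events M \<Xi> A \<subseteq> Pow (space M)" unfolding count_events_def by auto
    from measurable_sets[OF restrict_to_measurable_count_events[OF \<Xi> that] \<open>S \<in> sets counting_space\<close>] P
    show "(\<lambda>\<omega>. restrict_to (\<Xi> \<omega>) A) -` S \<inter> space M \<in> sigma_sets (space M) (count_events M \<Xi> A)"
      by (simp add: space_measure_of sets_measure_of)
  qed
  show ?thesis
    unfolding indep_var_eq indep_sets2_eq
    using indep[unfolded indep_sets2_eq] sub[OF A] sub[OF B] restrict_to_measurable[OF A(1) \<Xi>] restrict_to_measurable[OF B(1) \<Xi>]
    by blast
qed

end

subsection \<open>The stationary Poisson process\<close>

lemma nn_integral_poisson_law: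
  assumes [measurable]: "f \<in> borel_measurable borel" and r: "0 < r"
    and f: "\<And>n. f (of_nat n) = ennreal (g n)" "\<And>n. 0 \<le> g n"
    and s: "(\<lambda>n. r ^ n / fact n * exp (- r) * g n) sums c"
  shows "(\<integral>\<^sup>+x. f x \<partial>poisson_law (ennreal r)) = ennreal c"
proof -
  have "(\<integral>\<^sup>+x. f x \<partial>poisson_law (ennreal r)) = (\<integral>\<^sup>+n. ennreal (g n) \<partial>measure_pmf (poisson_pmf r))"
    using r f by (simp add: poisson_law_def nn_integral_distr)
  also have "\<dots> = (\<Sum>n. ennreal (r ^ n / fact n * exp (- r) * g n))"
    using r f(2) by (simp add: nn_integral_measure_pmf nn_integral_count_space_nat ennreal_mult[symmetric])
  also have "\<dots> = ennreal c"
    using s r f(2) by (intro suminf_ennreal_eq) auto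
  finally show ?thesis .
qed

lemma power_Suc_over_fact_Suc: "r ^ Suc n / fact (Suc n) * real (Suc n) = r * (r ^ n / fact n)" for r :: real
  by (simp del: of_nat_Suc)

lemma poisson_first_moment:
  assumes r: "0 < r" shows "(\<integral>\<^sup>+x. x \<partial>poisson_law (ennreal r)) = ennreal r"
proof (rule nn_integral_poisson_law[where g = real])
  have "(\<lambda>n. r * exp (- r) * (r ^ n / fact n)) sums (r * exp (- r) * exp r)"
    using exp_converges[of r] by (intro sums_mult) (simp add: divide_inverse mult.commute)
  moreover have "(\<lambda>n. r ^ Suc n / fact (Suc n) * exp (- r) * real (Suc n)) = (\<lambda>n. r * exp (- r) * (r ^ n / fact n))"
    using power_Suc_over_fact_Suc[of r] by (simp only: fun_eq_iff) (metis mult.assoc mult.commute)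
  moreover have "r * exp (- r) * exp r = r" by (simp add: exp_minus)
  ultimately have "(\<lambda>n. r ^ Suc n / fact (Suc n) * exp (- r) * real (Suc n)) sums r"
    by simp
  then show "(\<lambda>n. r ^ n / fact n * exp (- r) * real n) sums r" by (subst (asm) sums_Suc_iff) simp
qed (use r in \<open>auto simp: ennreal_of_nat_eq_real_of_nat\<close>)

text \<open>One factor of the square cancels against the factorial and shifts the series, which
  gives E(N^2) = r E(N + 1) for N of Poisson law.\<close>

lemma poisson_second_moment:
  assumes r: "0 < r" shows "(\<integral>\<^sup>+x. x\<^sup>2 \<partial>poisson_law (ennreal r)) = ennreal (r\<^sup>2 + r)"
proof (rule nn_integral_poisson_law[where g = "\<lambda>n. (real n)\<^sup>2"])
  have e: "(\<lambda>n. r ^ n / fact n) sums exp r"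
    using exp_converges[of r] by (simp add: divide_inverse mult.commute)
  have "(\<lambda>n. r ^ Suc n / fact (Suc n) * real (Suc n)) = (\<lambda>n. r * (r ^ n / fact n))"
    by (simp only: power_Suc_over_fact_Suc)
  then have "(\<lambda>n. r ^ Suc n / fact (Suc n) * real (Suc n)) sums (r * exp r)" using sums_mult[OF e, of r] by simp
  then have e1: "(\<lambda>n. r ^ n / fact n * real n) sums (r * exp r)" by (subst (asm) sums_Suc_iff) simp
  have "(\<lambda>n. r * exp (- r) * (r ^ n / fact n * real n + r ^ n / fact n)) sums (r * exp (- r) * (r * exp r + exp r))"
    by (intro sums_mult sums_add e e1)
  moreover have "(\<lambda>n. r ^ Suc n / fact (Suc n) * exp (- r) * (real (Suc n))\<^sup>2) = (\<lambda>n. r * exp (- r) * (r ^ n / fact n * real n + r ^ n / fact n))"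
  proof
    fix n :: nat
    have "r ^ Suc n / fact (Suc n) * exp (- r) * (real (Suc n))\<^sup>2 = exp (- r) * real (Suc n) * (real (Suc n) * (r ^ Suc n / fact (Suc n)))"
      by (simp add: power2_eq_square)
    also have "real (Suc n) * (r ^ Suc n / fact (Suc n)) = r * (r ^ n / fact n)"
      using power_Suc_over_fact_Suc[of r n] by (simp only: mult.commute)
    finally show "r ^ Suc n / fact (Suc n) * exp (- r) * (real (Suc n))\<^sup>2 = r * exp (- r) * (r ^ n / fact n * real n + r ^ n / fact n)"
      by (simp add: algebra_simps)
  qed
  moreover have "r * exp (- r) * (r * exp r + exp r) = r\<^sup>2 + r"
    by (simp add: exp_minus field_simps power2_eq_square)
  ultimately have "(\<lambda>n. r ^ Suc n / fact (Suc n) * exp (- r) * (real (Suc n))\<^sup>2) sums (r\<^sup>2 + r)" by simp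
  then show "(\<lambda>n. r ^ n / fact n * exp (- r) * (real n)\<^sup>2) sums (r\<^sup>2 + r)" by (subst (asm) sums_Suc_iff) simp
qed (use r in \<open>auto simp: ennreal_of_nat_eq_real_of_nat ennreal_power\<close>)

lemma nn_integral_lborel_reflect:
  fixes f :: "'a::euclidean_space \<Rightarrow> ennreal"
  assumes [measurable]: "f \<in> borel_measurable borel"
  shows "(\<integral>\<^sup>+x. f x \<partial>lborel) = (\<integral>\<^sup>+u. f (y - u) \<partial>lborel)"
proof -
  have "(\<integral>\<^sup>+x. f x \<partial>lborel) = (\<integral>\<^sup>+x. f x \<partial>distr lborel borel (\<lambda>u. y + (-1) *\<^sub>R u))"
    by (subst lborel_affine[of "-1" y]) (simp_all add: density_1)
  then show ?thesis by (simp add: nn_integral_distr)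
qed

text \<open>Both sides are \<open>\<integral>\<integral> 1\<^sub>A(x) 1\<^sub>Q(y - x) \<Lambda>(dy) dx\<close>, with the substitution
  \<open>x = y - u\<close> after exchanging the integrals.\<close>

lemma translation_invariant_product:
  fixes \<Lambda> :: "'a::euclidean_space measure"
  assumes sets [measurable_cong]: "sets \<Lambda> = sets borel" and fin: "\<And>B. B \<in> sets borel \<Longrightarrow> bounded B \<Longrightarrow> emeasure \<Lambda> B < \<infinity>"
    and inv: "\<And>B x. B \<in> sets borel \<Longrightarrow> emeasure \<Lambda> {y. y - x \<in> B} = emeasure \<Lambda> B"
    and [measurable]: "A \<in> sets borel" "Q \<in> sets borel"
  shows "emeasure lborel A * emeasure \<Lambda> Q = emeasure lborel Q * emeasure \<Lambda> A"
proof -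
  interpret \<Lambda>: sigma_finite_measure \<Lambda>
  proof
    have "(\<Union>n. cball 0 (real n)) = (UNIV :: 'a set)" using real_arch_simple by auto
    then show "\<exists>C. countable C \<and> C \<subseteq> sets \<Lambda> \<and> \<Union>C = space \<Lambda> \<and> (\<forall>a\<in>C. emeasure \<Lambda> a \<noteq> \<infinity>)"
      using sets sets_eq_imp_space_eq[OF sets] fin[of "cball 0 (real _)"]
      by (intro exI[of _ "range (\<lambda>n. cball 0 (real n))"]) (auto simp: less_top)
  qed
  interpret pair_sigma_finite lborel \<Lambda> ..
  have ind: "(\<integral>\<^sup>+y. indicator B (y - x) \<partial>\<Lambda>) = emeasure \<Lambda> B" if [measurable]: "B \<in> sets borel" for B x
  proof -
    have "(\<integral>\<^sup>+y. indicator B (y - x) \<partial>\<Lambda>) = (\<integral>\<^sup>+y. indicator {y. y - x \<in> B} y \<partial>\<Lambda>)"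
      by (intro nn_integral_cong) (auto simp: indicator_def)
    then show ?thesis using inv[OF that, of x] by simp
  qed
  have "emeasure lborel A * emeasure \<Lambda> Q = (\<integral>\<^sup>+x. indicator A x * (\<integral>\<^sup>+y. indicator Q (y - x) \<partial>\<Lambda>) \<partial>lborel)"
    by (simp add: ind nn_integral_multc)
  also have "\<dots> = (\<integral>\<^sup>+x. \<integral>\<^sup>+y. indicator A x * indicator Q (y - x) \<partial>\<Lambda> \<partial>lborel)"
    by (simp add: nn_integral_cmult)
  also have "\<dots> = (\<integral>\<^sup>+y. \<integral>\<^sup>+x. indicator A x * indicator Q (y - x) \<partial>lborel \<partial>\<Lambda>)"
    by (rule Fubini'[symmetric]) measurable
  also have "\<dots> = (\<integral>\<^sup>+y. \<integral>\<^sup>+u. indicator Q u * indicator A (y - u) \<partial>lborel \<partial>\<Lambda>)"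
  proof (rule nn_integral_cong)
    fix y
    show "(\<integral>\<^sup>+x. indicator A x * indicator Q (y - x) \<partial>lborel) = (\<integral>\<^sup>+u. indicator Q u * indicator A (y - u) \<partial>lborel)"
      by (subst nn_integral_lborel_reflect[of _ y]) (auto simp: mult.commute)
  qed
  also have "\<dots> = (\<integral>\<^sup>+u. \<integral>\<^sup>+y. indicator Q u * indicator A (y - u) \<partial>\<Lambda> \<partial>lborel)"
    by (rule Fubini') measurable
  also have "\<dots> = (\<integral>\<^sup>+u. indicator Q u * (\<integral>\<^sup>+y. indicator A (y - u) \<partial>\<Lambda>) \<partial>lborel)"
    by (simp add: nn_integral_cmult)
  also have "\<dots> = emeasure lborel Q * emeasure \<Lambda> A"
    by (simp add: ind nn_integral_multc)
  finally show ?thesis .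
qed

lemma test_fun_integral_eq_sum:
  assumes g: "test_fun A g" and \<phi>: "\<phi> \<in> counting_measures" and A: "A \<in> sets borel" "bounded A"
  shows "(\<integral>x. g x \<partial>\<phi>) = (\<Sum>y\<in>range g - {0}. y * measure \<phi> (g -` {y}))"
proof -
  have fin: "finite (range g - {0})" using simple_functionD(1)[OF test_funD(1)[OF g]] by simp
  have sub: "g -` {y} \<subseteq> A" if "y \<noteq> 0" for y using test_funD(4)[OF g] that by auto
  have i: "integrable \<phi> (indicator (g -` {y}) :: 'a \<Rightarrow> real)" if "y \<noteq> 0" for y
  proof (rule integrable_real_indicator)
    have *: "g -` {y} \<in> sets borel" using measurable_sets_borel[OF test_funD(2)[OF g], of "{y}"] by simp
    then show "g -` {y} \<in> sets \<phi>" by (simp add: sets_counting[OF \<phi>])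
    show "emeasure \<phi> (g -` {y}) < \<infinity>"
      by (rule emeasure_counting_finite[OF \<phi> *]) (rule bounded_subset[OF A(2) sub[OF that]])
  qed
  have "(\<integral>x. g x \<partial>\<phi>) = (\<integral>x. (\<Sum>y\<in>range g - {0}. y * indicator (g -` {y}) x) \<partial>\<phi>)"
  proof (intro Bochner_Integration.integral_cong refl)
    fix x
    have "(\<Sum>y\<in>range g - {0}. y * indicator (g -` {y}) x) = (\<Sum>y\<in>range g - {0}. if y = g x then g x else 0)"
      by (intro sum.cong) (auto simp: indicator_def)
    also have "\<dots> = g x" using fin by (simp add: sum.delta)
    finally show "g x = (\<Sum>y\<in>range g - {0}. y * indicator (g -` {y}) x)" ..
  qed
  also have "\<dots> = (\<Sum>y\<in>range g - {0}. y * measure \<phi> (g -` {y}))"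
    using i by (subst Bochner_Integration.integral_sum) (auto simp: space_counting[OF \<phi>])
  finally show ?thesis .
qed

context prob_space
begin

text \<open>The nonzero level sets of \<open>g\<close> and \<open>h\<close> are pairwise disjoint
  because \<open>A\<close> and \<open>B\<close> are, so the counts on them are jointly independent;
  the Laplace functional is a product over the level sets.\<close>

lemma poisson_process_laplace_factorises:
  assumes P: "poisson_process M \<Lambda> \<Phi>"
    and A: "A \<in> sets borel" "bounded A" and B: "B \<in> sets borel" "bounded B" and disj: "A \<inter> B = {}"
  shows "laplace_factorises \<Phi> A B"
  unfolding laplace_factorises_def
proof (intro allI impI)
  fix g h assume g: "test_fun A g" and h: "test_fun B h"
  have \<Phi>: "\<Phi> \<in> measurable M counting_space" using P by (simp add: poisson_process_def)
  have c: "\<omega> \<in> space M \<Longrightarrow> \<Phi> \<omega> \<in> counting_measures" for \<omega>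
    using measurable_space[OF \<Phi>] by (simp add: space_counting_space)
  \<comment> \<open>The Boolean tag tells a value of \<open>g\<close> from the same value of
    \<open>h\<close>.\<close>
  define S where "S = (range g - {0}) \<times> {True} \<union> (range h - {0}) \<times> {False}"
  define D where "D p = (if snd p then g else h) -` {fst p}" for p :: "real \<times> bool"
  have "finite S" using simple_functionD(1)[OF test_funD(1)[OF g]] simple_functionD(1)[OF test_funD(1)[OF h]]
    by (auto simp: S_def)
  \<comment> \<open>Independence in \<open>poisson_process\<close> is stated for families indexed by
    an initial segment of the naturals, so the level sets are enumerated.\<close>
  then obtain e where e: "bij_betw e {..<card S} S"
    using ex_bij_betw_nat_finite atLeast0LessThan by metis
  have D [measurable]: "D p \<in> sets borel" for p
    using measurable_sets_borel[OF test_funD(2)[OF g], of "{fst p}"]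
      measurable_sets_borel[OF test_funD(2)[OF h], of "{fst p}"] by (auto simp: D_def)
  have eS: "e i \<in> S" if "i < card S" for i using e that by (auto simp: bij_betw_def)
  have "disjoint_family_on (\<lambda>i. D (e i)) {..<card S}"
    unfolding disjoint_family_on_def
  proof (intro ballI impI)
    fix i j assume *: "i \<in> {..<card S}" "j \<in> {..<card S}" "i \<noteq> j"
    then have "e i \<noteq> e j" using e by (auto simp: bij_betw_def inj_on_def)
    moreover have "e i \<in> S" "e j \<in> S" using * eS by auto
    moreover have gh: "g x = 0 \<or> h x = 0" for x
      using test_funD(4)[OF g] test_funD(4)[OF h] disj by blast
    moreover have "p = q" if "p \<in> S" "q \<in> S" "x \<in> D p" "x \<in> D q" for p q x
      using that gh[of x] by (cases p; cases q) (auto simp: S_def D_def split: if_splits)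
    ultimately show "D (e i) \<inter> D (e j) = {}"
      by blast
  qed
  then have "indep_vars (\<lambda>_. borel) (\<lambda>i \<omega>. emeasure (\<Phi> \<omega>) (D (e i))) {..<card S}"
    using P by (simp add: poisson_process_def)
  then have ind: "indep_vars (\<lambda>_. borel) (\<lambda>i \<omega>. exp (- (fst (e i) * measure (\<Phi> \<omega>) (D (e i))))) {..<card S}"
    unfolding measure_def
    by (rule indep_vars_compose2[where Y = "\<lambda>i x. exp (- (fst (e i) * enn2real x))"]) measurable
  define f where "f p \<omega> = exp (- (fst p * measure (\<Phi> \<omega>) (D p)))" for p \<omega>
  have pos: "0 \<le> fst p" if "p \<in> S" for p
    using that test_funD(3)[OF g] test_funD(3)[OF h] by (auto simp: S_def)
  have [measurable]: "f p \<in> borel_measurable M" for p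
    using measurable_compose[OF \<Phi> measurable_measure_counting_space[OF D[of p]]] unfolding f_def by measurable
  have int: "integrable M (f p)" if "p \<in> S" for p
    using pos[OF that] by (intro integrable_bounded[where c = 1]) (auto simp: f_def)
  have prod: "expectation (\<lambda>\<omega>. \<Prod>p\<in>T. f p \<omega>) = (\<Prod>p\<in>T. expectation (f p))" if "T \<subseteq> S" for T
  proof -
    define J where "J = {i\<in>{..<card S}. e i \<in> T}"
    have "T \<subseteq> e ` J"
    proof
      fix p assume "p \<in> T"
      with that e have "p \<in> e ` {..<card S}" by (auto simp: bij_betw_def)
      then obtain i where "i < card S" "e i = p" by auto
      with \<open>p \<in> T\<close> show "p \<in> e ` J" by (auto simp: J_def)
    qed
    then have J: "bij_betw e J T" using e unfolding bij_betw_def J_def by (auto simp: inj_on_def)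
    have "expectation (\<lambda>\<omega>. \<Prod>i\<in>J. f (e i) \<omega>) = (\<Prod>i\<in>J. expectation (f (e i)))"
    proof (rule indep_vars_lebesgue_integral)
      show "indep_vars (\<lambda>_. borel) (\<lambda>i. f (e i)) J"
        using indep_vars_subset[OF ind, of J] by (simp add: J_def f_def[abs_def] subset_eq)
    qed (auto simp: J_def intro!: int eS)
    then show ?thesis
      by (simp add: prod.reindex_bij_betw[OF J, of "\<lambda>p. f p _"] prod.reindex_bij_betw[OF J, of "\<lambda>p. expectation (f p)"])
  qed
  let ?G = "(range g - {0}) \<times> {True}" and ?H = "(range h - {0}) \<times> {False}"
  have G: "exp (- (\<integral>x. g x \<partial>\<Phi> \<omega>)) = (\<Prod>p\<in>?G. f p \<omega>)" and H: "exp (- (\<integral>x. h x \<partial>\<Phi> \<omega>)) = (\<Prod>p\<in>?H. f p \<omega>)"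
    if "\<omega> \<in> space M" for \<omega>
  proof -
    have "(\<Sum>y\<in>range g - {0}. y * measure (\<Phi> \<omega>) (g -` {y})) = (\<Sum>p\<in>?G. fst p * measure (\<Phi> \<omega>) (D p))"
      by (intro sum.reindex_bij_witness[of _ fst "\<lambda>y. (y, True)"]) (auto simp: D_def)
    then show "exp (- (\<integral>x. g x \<partial>\<Phi> \<omega>)) = (\<Prod>p\<in>?G. f p \<omega>)"
      using \<open>finite S\<close> by (simp add: test_fun_integral_eq_sum[OF g c[OF that] A] f_def S_def exp_sum sum_negf[symmetric])
    have "(\<Sum>y\<in>range h - {0}. y * measure (\<Phi> \<omega>) (h -` {y})) = (\<Sum>p\<in>?H. fst p * measure (\<Phi> \<omega>) (D p))"
      by (intro sum.reindex_bij_witness[of _ fst "\<lambda>y. (y, False)"]) (auto simp: D_def)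
    then show "exp (- (\<integral>x. h x \<partial>\<Phi> \<omega>)) = (\<Prod>p\<in>?H. f p \<omega>)"
      using \<open>finite S\<close> by (simp add: test_fun_integral_eq_sum[OF h c[OF that] B] f_def S_def exp_sum sum_negf[symmetric])
  qed
  have "laplace \<Phi> (\<lambda>x. g x + h x) = expectation (\<lambda>\<omega>. \<Prod>p\<in>S. f p \<omega>)"
  proof (intro Bochner_Integration.integral_cong refl)
    fix \<omega> assume \<omega>: "\<omega> \<in> space M"
    have "(\<Prod>p\<in>S. f p \<omega>) = (\<Prod>p\<in>?G. f p \<omega>) * (\<Prod>p\<in>?H. f p \<omega>)"
      unfolding S_def using \<open>finite S\<close> by (intro prod.union_disjoint) (auto simp: S_def)
    then show "exp (- (\<integral>x. g x + h x \<partial>\<Phi> \<omega>)) = (\<Prod>p\<in>S. f p \<omega>)"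
      using test_fun_integrable[OF g c[OF \<omega>] A] test_fun_integrable[OF h c[OF \<omega>] B]
      by (simp add: G[OF \<omega>, symmetric] H[OF \<omega>, symmetric] exp_add[symmetric])
  qed
  also have "\<dots> = (\<Prod>p\<in>?G. expectation (f p)) * (\<Prod>p\<in>?H. expectation (f p))"
    unfolding prod[OF order_refl] using \<open>finite S\<close>
    by (subst S_def, intro prod.union_disjoint) (auto simp: S_def)
  also have "\<dots> = expectation (\<lambda>\<omega>. \<Prod>p\<in>?G. f p \<omega>) * expectation (\<lambda>\<omega>. \<Prod>p\<in>?H. f p \<omega>)"
    by (subst (1 2) prod) (auto simp: S_def)
  also have "expectation (\<lambda>\<omega>. \<Prod>p\<in>?G. f p \<omega>) = laplace \<Phi> g"
    by (intro Bochner_Integration.integral_cong refl) (simp add: G)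
  also have "expectation (\<lambda>\<omega>. \<Prod>p\<in>?H. f p \<omega>) = laplace \<Phi> h"
    by (intro Bochner_Integration.integral_cong refl) (simp add: H)
  finally show "laplace \<Phi> (\<lambda>x. g x + h x) =
    laplace \<Phi> g * laplace \<Phi> h" .
qed

lemma poisson_process_mean:
  assumes P: "poisson_process M \<Lambda> \<Phi>" and B: "B \<in> sets borel"
  shows "(\<integral>\<^sup>+\<omega>. emeasure (\<Phi> \<omega>) B \<partial>M) = emeasure \<Lambda> B"
proof -
  have \<Phi> [measurable]: "\<Phi> \<in> measurable M counting_space"
    and d: "distr M borel (\<lambda>\<omega>. emeasure (\<Phi> \<omega>) B) = poisson_law (emeasure \<Lambda> B)"
    using P B by (auto simp: poisson_process_def)
  have "(\<integral>\<^sup>+\<omega>. emeasure (\<Phi> \<omega>) B \<partial>M) = (\<integral>\<^sup>+x. x \<partial>poisson_law (emeasure \<Lambda> B))"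
    unfolding d[symmetric] using measurable_compose[OF \<Phi> measurable_emeasure_counting_space[OF B]]
    by (subst nn_integral_distr) auto
  also have "\<dots> = emeasure \<Lambda> B"
  proof (cases "emeasure \<Lambda> B")
    case (real r)
    then show ?thesis
    proof (cases "r = 0")
      case True
      then show ?thesis using real by (simp add: poisson_law_def nn_integral_return)
    next
      case False
      then show ?thesis using real poisson_first_moment[of r] by simp
    qed
  next
    case top
    then show ?thesis by (simp add: poisson_law_def nn_integral_return)
  qed
  finally show ?thesis .
qed

text \<open>Local finiteness passes from the configurations to \<open>\<Lambda>\<close>: an infinite
  parameter would make the count on \<open>B\<close> infinite almost surely.\<close>

lemma poisson_process_finite:
  assumes P: "poisson_process M \<Lambda> \<Phi>" and B: "B \<in> sets borel" "bounded B"
  shows "emeasure \<Lambda> B < \<infinity>"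
proof (rule ccontr)
  assume "\<not> ?thesis"
  then have top: "emeasure \<Lambda> B = \<infinity>" by (simp add: less_top[symmetric])
  have \<Phi> [measurable]: "\<Phi> \<in> measurable M counting_space"
    and d: "distr M borel (\<lambda>\<omega>. emeasure (\<Phi> \<omega>) B) = return borel \<infinity>"
    using P B top by (auto simp: poisson_process_def poisson_law_def)
  note [measurable] = measurable_compose[OF \<Phi> measurable_emeasure_counting_space[OF B(1)]]
  have "1 = emeasure (return borel \<infinity>) {\<infinity> :: ennreal}" by simp
  also have "\<dots> = emeasure M ((\<lambda>\<omega>. emeasure (\<Phi> \<omega>) B) -` {\<infinity>} \<inter> space M)"
    unfolding d[symmetric] by (subst emeasure_distr) auto
  also have "(\<lambda>\<omega>. emeasure (\<Phi> \<omega>) B) -` {\<infinity>} \<inter> space M = {}"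
  proof -
    have "emeasure (\<Phi> \<omega>) B \<noteq> \<infinity>" if "\<omega> \<in> space M" for \<omega>
      using measurable_space[OF \<Phi> that] emeasure_counting_finite[OF _ B, of "\<Phi> \<omega>"]
      by (simp add: space_counting_space)
    then show ?thesis by auto
  qed
  finally show False by simp
qed

text \<open>\<open>\<Lambda>\<close> is the mean measure, so stationarity makes it translation
  invariant, and a locally finite invariant measure is a multiple of Lebesgue measure. The unit
  cube, used to define the intensity, identifies the factor as \<open>\<gamma>\<close>.\<close>

lemma stationary_poisson_intensity_measure:
  assumes "stationary_poisson_process M \<gamma> \<Phi>" "0 < \<gamma>"
  obtains \<Lambda> where "poisson_process M \<Lambda> \<Phi>" "\<And>B. B \<in> sets borel \<Longrightarrow> emeasure \<Lambda> B = \<gamma> * emeasure lborel B"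
proof -
  from assms obtain \<Lambda> where P: "poisson_process M \<Lambda> \<Phi>" and st: "stationary M \<Phi>" and int: "intensity M \<Phi> = ennreal \<gamma>"
    by (auto simp: stationary_poisson_process_def)
  have \<Phi>: "\<Phi> \<in> measurable M counting_space" and s: "sets \<Lambda> = sets borel"
    using P by (auto simp: poisson_process_def)
  have c: "\<omega> \<in> space M \<Longrightarrow> \<Phi> \<omega> \<in> counting_measures" for \<omega>
    using measurable_space[OF \<Phi>] by (simp add: space_counting_space)
  have inv: "emeasure \<Lambda> {y. y - x \<in> B} = emeasure \<Lambda> B" if B [measurable]: "B \<in> sets borel" for B x
  proof -
    have [measurable]: "{y. y - x \<in> B} \<in> sets borel" by measurable
    have t: "(\<lambda>\<omega>. translate (\<Phi> \<omega>) x) \<in> measurable M counting_space"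
      using measurable_compose[OF measurable_Pair[OF \<Phi> measurable_const[of x borel]] translate_measurable] by simp
    have "emeasure \<Lambda> {y. y - x \<in> B} = (\<integral>\<^sup>+\<omega>. emeasure (translate (\<Phi> \<omega>) x) B \<partial>M)"
      by (subst poisson_process_mean[OF P, symmetric], measurable)
        (intro nn_integral_cong emeasure_translate[symmetric] c B)
    also have "\<dots> = (\<integral>\<^sup>+\<phi>. emeasure \<phi> B \<partial>distr M counting_space (\<lambda>\<omega>. translate (\<Phi> \<omega>) x))"
      using measurable_emeasure_counting_space[OF B]
      by (subst nn_integral_distr[OF t]) (auto simp only: measurable_distr_eq1)
    also have "\<dots> = (\<integral>\<^sup>+\<phi>. emeasure \<phi> B \<partial>distr M counting_space \<Phi>)"
      unfolding st[unfolded stationary_def, rule_format, of x] ..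
    also have "\<dots> = emeasure \<Lambda> B"
      unfolding poisson_process_mean[OF P B, symmetric]
      using measurable_emeasure_counting_space[OF B]
      by (subst nn_integral_distr[OF \<Phi>]) (auto simp only: measurable_distr_eq1)
    finally show ?thesis .
  qed
  have "emeasure \<Lambda> (cbox 0 One) = \<gamma>"
    using poisson_process_mean[OF P, of "cbox 0 One"] int by (simp add: intensity_def)
  note Q = this
  have Q1: "emeasure lborel (cbox 0 One :: 'b set) = 1"
    by (simp add: emeasure_lborel_cbox_eq)
  have "emeasure \<Lambda> B = \<gamma> * emeasure lborel B" if "B \<in> sets borel" for B
  proof -
    have "emeasure lborel B * emeasure \<Lambda> (cbox 0 One) = emeasure lborel (cbox 0 One :: 'b set) * emeasure \<Lambda> B"
      by (rule translation_invariant_product[OF s poisson_process_finite[OF P] inv that]) auto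
    then show ?thesis unfolding Q Q1 by (metis mult_1 mult.commute)
  qed
  then show ?thesis by (rule that[OF P])
qed

text \<open>The whole space has infinite Lebesgue measure, so its count follows the degenerate law
  at infinity. This fixes the index set of the enumeration almost surely.\<close>

lemma stationary_poisson_infinite:
  assumes "stationary_poisson_process M \<gamma> \<Phi>" "0 < \<gamma>"
  shows "AE \<omega> in M. emeasure (\<Phi> \<omega>) UNIV = \<infinity>"
proof -
  obtain \<Lambda> where P: "poisson_process M \<Lambda> \<Phi>" and L: "\<And>B. B \<in> sets borel \<Longrightarrow> emeasure \<Lambda> B = \<gamma> * emeasure lborel B"
    using stationary_poisson_intensity_measure[OF assms] by blast
  have "emeasure \<Lambda> UNIV = \<infinity>" using L[of UNIV] assms(2) by (simp add: ennreal_mult_top)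
  then have \<Phi> [measurable]: "\<Phi> \<in> measurable M counting_space"
    and d: "distr M borel (\<lambda>\<omega>. emeasure (\<Phi> \<omega>) UNIV) = return borel \<infinity>"
    using P by (auto simp: poisson_process_def poisson_law_def)
  note [measurable] = measurable_compose[OF \<Phi> measurable_emeasure_counting_space, of UNIV, simplified]
  have "AE x in distr M borel (\<lambda>\<omega>. emeasure (\<Phi> \<omega>) UNIV). x = \<infinity>"
    unfolding d by (subst AE_return) auto
  then show ?thesis by (subst (asm) AE_distr_iff) auto
qed

lemma stationary_poisson_moments:
  assumes "stationary_poisson_process M \<gamma> \<Phi>" "0 < \<gamma>" and B: "B \<in> sets borel" "bounded B"
  defines "r \<equiv> \<gamma> * measure lborel B"
  shows "integrable M (\<lambda>\<omega>. (measure (\<Phi> \<omega>) B)\<^sup>2)"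
    and "expectation (\<lambda>\<omega>. (measure (\<Phi> \<omega>) B)\<^sup>2) = r\<^sup>2 + r"
    and "variance (\<lambda>\<omega>. measure (\<Phi> \<omega>) B) = r"
proof -
  obtain \<Lambda> where P: "poisson_process M \<Lambda> \<Phi>" and L: "\<And>B. B \<in> sets borel \<Longrightarrow> emeasure \<Lambda> B = \<gamma> * emeasure lborel B"
    using stationary_poisson_intensity_measure[OF assms(1,2)] by blast
  have \<Phi> [measurable]: "\<Phi> \<in> measurable M counting_space"
    and d: "distr M borel (\<lambda>\<omega>. emeasure (\<Phi> \<omega>) B) = poisson_law (emeasure \<Lambda> B)"
    using P B by (auto simp: poisson_process_def)
  note [measurable] = measurable_compose[OF \<Phi> measurable_emeasure_counting_space[OF B(1)]]
    measurable_compose[OF \<Phi> measurable_measure_counting_space[OF B(1)]]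
  have "emeasure lborel B < \<infinity>" using emeasure_bounded_finite[OF B(2)] by simp
  then have \<Lambda>: "emeasure \<Lambda> B = ennreal r" and r: "0 \<le> r"
    using assms(2) L[OF B(1)] unfolding r_def
    by (auto simp: emeasure_eq_ennreal_measure less_top ennreal_mult)
  have e: "emeasure (\<Phi> \<omega>) B = ennreal (measure (\<Phi> \<omega>) B)" if "\<omega> \<in> space M" for \<omega>
    using measurable_space[OF \<Phi> that] emeasure_counting_finite[OF _ B]
    by (auto simp: space_counting_space emeasure_eq_ennreal_measure less_top)
  have "(\<integral>\<^sup>+\<omega>. ennreal ((measure (\<Phi> \<omega>) B)\<^sup>2) \<partial>M) = (\<integral>\<^sup>+\<omega>. (emeasure (\<Phi> \<omega>) B)\<^sup>2 \<partial>M)"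
    by (intro nn_integral_cong) (simp add: e ennreal_power)
  also have "\<dots> = (\<integral>\<^sup>+x. x\<^sup>2 \<partial>poisson_law (ennreal r))"
    unfolding d[unfolded \<Lambda>, symmetric] by (subst nn_integral_distr) auto
  also have "\<dots> = ennreal (r\<^sup>2 + r)"
    using r poisson_second_moment[of r] by (cases "r = 0") (auto simp: poisson_law_def nn_integral_return)
  finally have 2: "(\<integral>\<^sup>+\<omega>. ennreal ((measure (\<Phi> \<omega>) B)\<^sup>2) \<partial>M) = ennreal (r\<^sup>2 + r)" .
  show int: "integrable M (\<lambda>\<omega>. (measure (\<Phi> \<omega>) B)\<^sup>2)"
    using 2 by (intro integrableI_nonneg) auto
  then show second: "expectation (\<lambda>\<omega>. (measure (\<Phi> \<omega>) B)\<^sup>2) = r\<^sup>2 + r"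
    using 2 r by (subst integral_eq_nn_integral) (auto simp del: ennreal_plus)
  have "(\<integral>\<^sup>+\<omega>. ennreal (measure (\<Phi> \<omega>) B) \<partial>M) = ennreal r"
    using poisson_process_mean[OF P B(1)] \<Lambda> e by (simp cong: nn_integral_cong)
  then have "expectation (\<lambda>\<omega>. measure (\<Phi> \<omega>) B) = r"
    using r by (subst integral_eq_nn_integral) auto
  then show "variance (\<lambda>\<omega>. measure (\<Phi> \<omega>) B) = r"
    using int second square_integrable_imp_integrable[OF _ int] by (subst variance_eq) auto
qed

end

subsection \<open>Displaced points\<close>

lemma sets_sum_dirac [simp]: "sets (sum_dirac I x) = sets borel"
  and space_sum_dirac [simp]: "space (sum_dirac I x) = UNIV"
  by (simp_all add: sum_dirac_def)

lemma nn_integral_sum_dirac: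
  assumes "f \<in> borel_measurable borel"
  shows "(\<integral>\<^sup>+y. f y \<partial>sum_dirac I x) = (\<integral>\<^sup>+i. f (x i) \<partial>count_space I)"
  unfolding sum_dirac_def using assms by (subst nn_integral_distr) auto

lemma emeasure_sum_dirac:
  assumes "B \<in> sets borel"
  shows "emeasure (sum_dirac I x) B = emeasure (count_space I) {i\<in>I. x i \<in> B}"
proof -
  have "x -` B \<inter> I = {i\<in>I. x i \<in> B}" by auto
  then show ?thesis unfolding sum_dirac_def using assms by (subst emeasure_distr) auto
qed

lemma emeasure_sum_dirac_mono:
  assumes "B \<in> sets borel" "C \<in> sets borel" "\<And>i. i \<in> I \<Longrightarrow> x i \<in> B \<Longrightarrow> y i \<in> C"
  shows "emeasure (sum_dirac I x) B \<le> emeasure (sum_dirac I y) C"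
  using assms by (simp add: emeasure_sum_dirac) (intro emeasure_mono, auto)

lemma sum_dirac_cong: "(\<And>i. i \<in> I \<Longrightarrow> x i = y i) \<Longrightarrow> sum_dirac I x = sum_dirac I y"
  unfolding sum_dirac_def by (intro distr_cong) auto

lemma sum_dirac_counting:
  assumes "\<And>B. B \<in> sets borel \<Longrightarrow> bounded B \<Longrightarrow> emeasure (sum_dirac I x) B < \<infinity>"
  shows "sum_dirac I x \<in> counting_measures"
  using assms unfolding counting_measures_def
  by (auto simp: emeasure_sum_dirac emeasure_count_space)

lemma nn_integral_count_space_Suc:
  assumes "I \<subseteq> {1..}"
  shows "(\<integral>\<^sup>+i. f i \<partial>count_space I) = (\<Sum>i. f (Suc i) * indicator I (Suc i))"
proof -
  have "(\<integral>\<^sup>+i. f i \<partial>count_space I) = (\<integral>\<^sup>+i. f i * indicator I i \<partial>count_space {1..})"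
  proof -
    have "(\<integral>\<^sup>+i. f i \<partial>count_space I) = (\<integral>\<^sup>+i. f i * indicator I i \<partial>count_space UNIV)"
      by (rule nn_integral_count_space_indicator) simp
    also have "\<dots> = (\<integral>\<^sup>+i. f i * indicator I i * indicator {1..} i \<partial>count_space UNIV)"
      using assms by (intro nn_integral_cong) (auto simp: indicator_def)
    also have "\<dots> = (\<integral>\<^sup>+i. f i * indicator I i \<partial>count_space {1..})"
      by (rule nn_integral_count_space_indicator[symmetric]) simp
    finally show ?thesis .
  qed
  also have "\<dots> = (\<integral>\<^sup>+i. f (Suc i) * indicator I (Suc i) \<partial>count_space UNIV)"
  proof (rule nn_integral_bij_count_space[symmetric])
    have "Suc ` UNIV = {1..}" by (auto simp: image_iff Suc_le_eq gr0_conv_Suc)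
    then show "bij_betw Suc UNIV {1..}" by (simp add: bij_betw_def)
  qed
  finally show ?thesis by (simp add: nn_integral_count_space_nat)
qed

lemma point_indices_subset: "point_indices \<phi> \<subseteq> {1..}"
  by (auto simp: point_indices_def)

lemma nn_integral_sum_dirac_point_indices:
  assumes "f \<in> borel_measurable borel"
  shows "(\<integral>\<^sup>+y. f y \<partial>sum_dirac (point_indices \<phi>) x) =
    (\<Sum>i. f (x (Suc i)) * indicator {n. of_nat (Suc i) \<le> n} (emeasure \<phi> UNIV))"
  unfolding nn_integral_sum_dirac[OF assms] nn_integral_count_space_Suc[OF point_indices_subset]
  by (simp add: point_indices_def indicator_def)

text \<open>The index set is random, but it is an initial segment: index \<open>Suc i\<close> is
  present exactly if the total mass is at least \<open>Suc i\<close>, a measurable condition, so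
  every count is a series of measurable terms.\<close>

lemma measurable_sum_dirac:
  fixes Z :: "nat \<Rightarrow> 'w \<Rightarrow> 'b::euclidean_space"
  assumes [measurable]: "\<Phi> \<in> measurable N counting_space" and Z: "\<And>i. i \<ge> 1 \<Longrightarrow> Z i \<in> borel_measurable N"
    and c: "\<And>\<omega>. \<omega> \<in> space N \<Longrightarrow> sum_dirac (point_indices (\<Phi> \<omega>)) (\<lambda>i. Z i \<omega>) \<in> counting_measures"
  shows "(\<lambda>\<omega>. sum_dirac (point_indices (\<Phi> \<omega>)) (\<lambda>i. Z i \<omega>)) \<in> measurable N counting_space"
proof (rule measurable_counting_spaceI[OF c])
  fix B :: "'b set" assume [measurable]: "B \<in> sets borel"
  have [measurable]: "Z (Suc i) \<in> borel_measurable N" for i using Z by simp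
  have "emeasure (sum_dirac (point_indices (\<Phi> \<omega>)) (\<lambda>i. Z i \<omega>)) B =
      (\<Sum>i. indicator B (Z (Suc i) \<omega>) * indicator {n. of_nat (Suc i) \<le> n} (emeasure (\<Phi> \<omega>) UNIV))" for \<omega>
    using nn_integral_sum_dirac_point_indices[of "indicator B" "\<Phi> \<omega>" "\<lambda>i. Z i \<omega>"] by simp
  then show "(\<lambda>\<omega>. emeasure (sum_dirac (point_indices (\<Phi> \<omega>)) (\<lambda>i. Z i \<omega>)) B) \<in> borel_measurable N"
    by simp
qed auto

text \<open>Fubini for the product law. The inner expectation freezes \<open>X\<close> and resamples
  \<open>Y\<close>; it will be used with the enumerated points as \<open>X\<close> and the marks as
  \<open>Y\<close>.\<close>

lemma (in prob_space) indep_var_expectation: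
  fixes f :: "'b \<times> 'b \<Rightarrow> real"
  assumes ind: "indep_var S X T Y" and f [measurable]: "f \<in> borel_measurable (S \<Otimes>\<^sub>M T)"
    and bound: "\<And>z. \<bar>f z\<bar> \<le> c"
  shows "expectation (\<lambda>\<omega>. f (X \<omega>, Y \<omega>)) = expectation (\<lambda>\<omega>. expectation (\<lambda>\<omega>'. f (X \<omega>, Y \<omega>')))"
proof -
  have X [measurable]: "X \<in> measurable M S" and Y [measurable]: "Y \<in> measurable M T"
    using ind by (auto dest: indep_var_rv1 indep_var_rv2)
  interpret PX: prob_space "distr M S X" by (rule prob_space_distr) fact
  interpret PY: prob_space "distr M T Y" by (rule prob_space_distr) fact
  interpret pair: pair_prob_space "distr M S X" "distr M T Y" ..
  have "expectation (\<lambda>\<omega>. f (X \<omega>, Y \<omega>)) = (\<integral>z. f z \<partial>distr M (S \<Otimes>\<^sub>M T) (\<lambda>\<omega>. (X \<omega>, Y \<omega>)))"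
    by (subst integral_distr) auto
  also have "\<dots> = (\<integral>z. f z \<partial>(distr M S X \<Otimes>\<^sub>M distr M T Y))"
    using ind by (simp add: indep_var_distribution_eq)
  also have "\<dots> = (\<integral>x. \<integral>y. f (x, y) \<partial>distr M T Y \<partial>distr M S X)"
    using bound by (intro pair.integral_fst'[symmetric] pair.P.integrable_const_bound[where B = c]) auto
  also have "\<dots> = expectation (\<lambda>\<omega>. \<integral>y. f (X \<omega>, y) \<partial>distr M T Y)"
  proof (rule integral_distr[OF X])
    have "(\<lambda>x. \<integral>y. f (x, y) \<partial>distr M T Y) \<in> borel_measurable (distr M S X)"
      using bound by (intro PY.borel_measurable_lebesgue_integral) (simp add: measurable_split_conv)
    then show "(\<lambda>x. \<integral>y. f (x, y) \<partial>distr M T Y) \<in> borel_measurable S" by simp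
  qed
  also have "\<dots> = expectation (\<lambda>\<omega>. expectation (\<lambda>\<omega>'. f (X \<omega>, Y \<omega>')))"
  proof (intro Bochner_Integration.integral_cong refl)
    fix \<omega> assume "\<omega> \<in> space M"
    then have "X \<omega> \<in> space S" using measurable_space[OF X] by blast
    then show "(\<integral>y. f (X \<omega>, y) \<partial>distr M T Y) = expectation (\<lambda>\<omega>'. f (X \<omega>, Y \<omega>'))"
      using measurable_Pair2[OF f] by (intro integral_distr Y)
  qed
  finally show ?thesis .
qed

text \<open>A single step, from the process \<open>\<Phi>\<close> with enumeration \<open>X\<close>
  to \<open>moved\<close>, driven by one row \<open>U\<close> of the marks. Measurability and almost
  sure infinity of \<open>\<Phi>\<close> are supplied by the induction over the steps.\<close>

locale displacement = prob_space M for M :: "'w measure" +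
  fixes \<Phi> :: "'w \<Rightarrow> 'a::euclidean_space measure" and X U :: "nat \<Rightarrow> 'w \<Rightarrow> 'a"
    and Y1 :: "'a measure \<Rightarrow> real" and Y2 :: "'a measure \<Rightarrow> 'a"
  assumes \<Phi> [measurable]: "\<Phi> \<in> measurable M counting_space"
    and infinite: "AE \<omega> in M. emeasure (\<Phi> \<omega>) UNIV = \<infinity>"
    and Y1 [measurable]: "Y1 \<in> borel_measurable counting_space"
    and Y1_range: "\<And>\<phi>. \<phi> \<in> counting_measures \<Longrightarrow> Y1 \<phi> \<in> {0, 1}"
    and Y1_local: "\<And>\<phi>. \<phi> \<in> counting_measures \<Longrightarrow> Y1 \<phi> = Y1 (restrict_to \<phi> (cball 0 1))"
    and Y2 [measurable]: "Y2 \<in> borel_measurable counting_space"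
    and Y2_range: "\<And>\<phi>. \<phi> \<in> counting_measures \<Longrightarrow> Y2 \<phi> \<in> cball 0 1"
    and Y2_local: "\<And>\<phi>. \<phi> \<in> counting_measures \<Longrightarrow> Y2 \<phi> = Y2 (restrict_to \<phi> (cball 0 1))"
    and enum: "\<And>\<omega>. \<omega> \<in> space M \<Longrightarrow> enumerates (\<lambda>i. X i \<omega>) (\<Phi> \<omega>)"
    and X_U_indep: "indep_var (PiM {1..} (\<lambda>_. borel)) (\<lambda>\<omega>. \<lambda>i\<in>{1..}. X i \<omega>)
           (PiM {1..} (\<lambda>_. borel)) (\<lambda>\<omega>. \<lambda>i\<in>{1..}. U i \<omega>)"
    and U_indep: "indep_vars (\<lambda>_. borel) U {1..}"
    and U_ident: "\<And>i. i \<ge> 1 \<Longrightarrow> distr M borel (U i) = distr M borel (U 1)"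
    and U_range: "\<And>i \<omega>. i \<ge> 1 \<Longrightarrow> \<omega> \<in> space M \<Longrightarrow> U i \<omega> \<in> cball 0 1"
begin

abbreviation indices :: "'w \<Rightarrow> nat set" where
  "indices \<omega> \<equiv> point_indices (\<Phi> \<omega>)"

definition move :: "'a measure \<Rightarrow> 'a \<Rightarrow> 'a \<Rightarrow> 'a" where
  "move \<phi> x u = x + Y1 (translate \<phi> x) *\<^sub>R (Y2 (translate \<phi> x) + u)"

abbreviation target :: "'w \<Rightarrow> nat \<Rightarrow> 'a" where
  "target \<omega> i \<equiv> move (\<Phi> \<omega>) (X i \<omega>) (U i \<omega>)"

text \<open>Whether a point crosses the sphere depends on both ends of its move, so the process of
  (start, end) pairs on the product space is studied in place of the two marginal processes.\<close>

definition pairs :: "'w \<Rightarrow> ('a \<times> 'a) measure" where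
  "pairs \<omega> = sum_dirac (indices \<omega>) (\<lambda>i. (X i \<omega>, target \<omega> i))"

definition moved :: "'w \<Rightarrow> 'a measure" where
  "moved \<omega> = displace Y1 Y2 (\<lambda>i. X i \<omega>) (\<lambda>i. U i \<omega>) (\<Phi> \<omega>)"

lemma moved_eq: "moved \<omega> = sum_dirac (indices \<omega>) (\<lambda>i. target \<omega> i)"
  by (simp add: moved_def displace_def move_def)

lemma counting: "\<omega> \<in> space M \<Longrightarrow> \<Phi> \<omega> \<in> counting_measures"
  using measurable_space[OF \<Phi>] by (simp add: space_counting_space)

lemma \<Phi>_eq: "\<omega> \<in> space M \<Longrightarrow> \<Phi> \<omega> = sum_dirac (indices \<omega>) (\<lambda>i. X i \<omega>)"
  using enum by (simp add: enumerates_def)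

lemma measurable_X: "i \<ge> 1 \<Longrightarrow> X i \<in> borel_measurable M"
  and measurable_U: "i \<ge> 1 \<Longrightarrow> U i \<in> borel_measurable M"
  using measurable_compose[OF indep_var_rv1[OF X_U_indep] measurable_component_singleton[of i "{1..}"]]
    measurable_compose[OF indep_var_rv2[OF X_U_indep] measurable_component_singleton[of i "{1..}"]]
  by auto

lemma measurable_move:
  assumes [measurable]: "f \<in> measurable N counting_space" "g \<in> borel_measurable N" "h \<in> borel_measurable N"
  shows "(\<lambda>z. move (f z) (g z) (h z)) \<in> borel_measurable N"
proof -
  have [measurable]: "(\<lambda>z. translate (f z) (g z)) \<in> measurable N counting_space"
    using measurable_compose[OF measurable_Pair[OF assms(1,2)] translate_measurable] by simp
  show ?thesis unfolding move_def by measurable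
qed

text \<open>One unit of length from \<open>Y2\<close> and one from the mark; every later enlargement
  by 2 comes from here.\<close>

lemma dist_move:
  assumes "\<phi> \<in> counting_measures" "norm u \<le> 1"
  shows "dist x (move \<phi> x u) \<le> 2"
proof -
  have c: "translate \<phi> x \<in> counting_measures" by (rule translate_counting[OF assms(1)])
  have "norm (Y2 (translate \<phi> x) + u) \<le> 2"
    using Y2_range[OF c] assms(2) norm_triangle_ineq[of "Y2 (translate \<phi> x)" u] by simp
  with Y1_range[OF c] show ?thesis by (auto simp: move_def dist_norm)
qed

lemma dist_move_point:
  assumes "\<omega> \<in> space M" "i \<in> indices \<omega>"
  shows "dist (X i \<omega>) (target \<omega> i) \<le> 2"
  using U_range[of i \<omega>] assms by (intro dist_move counting) (auto simp: point_indices_def)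

lemma move_restrict_to:
  assumes "\<phi> \<in> counting_measures" "K \<in> sets borel" "cball x 1 \<subseteq> K"
  shows "move (restrict_to \<phi> K) x u = move \<phi> x u"
proof -
  have c: "translate (restrict_to \<phi> K) x \<in> counting_measures" "translate \<phi> x \<in> counting_measures"
    by (intro translate_counting restrict_to_counting assms)+
  show ?thesis
    using restrict_translate_restrict[OF assms] Y1_local[OF c(1)] Y1_local[OF c(2)] Y2_local[OF c(1)] Y2_local[OF c(2)]
    by (simp add: move_def)
qed

lemma pairs_counting: "\<omega> \<in> space M \<Longrightarrow> pairs \<omega> \<in> counting_measures"
  unfolding pairs_def
proof (rule sum_dirac_counting)
  fix B :: "('a \<times> 'a) set" assume \<omega>: "\<omega> \<in> space M" and B: "B \<in> sets borel" "bounded B"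
  then obtain R where R: "\<And>z. z \<in> B \<Longrightarrow> norm z \<le> R" by (auto simp: bounded_iff)
  have "emeasure (sum_dirac (indices \<omega>) (\<lambda>i. (X i \<omega>, target \<omega> i))) B
      \<le> emeasure (sum_dirac (indices \<omega>) (\<lambda>i. X i \<omega>)) (cball 0 R)"
  proof (rule emeasure_sum_dirac_mono[OF B(1)])
    fix i assume "(X i \<omega>, target \<omega> i) \<in> B"
    from R[OF this] norm_fst_le[of "X i \<omega>" "target \<omega> i"]
    show "X i \<omega> \<in> cball 0 R" by simp
  qed simp
  also have "\<dots> < \<infinity>"
    unfolding \<Phi>_eq[OF \<omega>, symmetric] by (rule emeasure_counting_finite[OF counting[OF \<omega>]]) auto
  finally show "emeasure (sum_dirac (indices \<omega>) (\<lambda>i. (X i \<omega>, target \<omega> i))) B < \<infinity>" .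
qed

lemma emeasure_moved_cball_le:
  assumes \<omega>: "\<omega> \<in> space M"
  shows "emeasure (moved \<omega>) (cball z R) \<le> emeasure (\<Phi> \<omega>) (cball z (R + 2))"
proof -
  have "emeasure (moved \<omega>) (cball z R) \<le> emeasure (sum_dirac (indices \<omega>) (\<lambda>i. X i \<omega>)) (cball z (R + 2))"
    unfolding moved_eq
  proof (rule emeasure_sum_dirac_mono)
    fix i assume "i \<in> indices \<omega>" "target \<omega> i \<in> cball z R"
    with dist_move_point[OF \<omega>, of i] show "X i \<omega> \<in> cball z (R + 2)"
      using dist_triangle[of z "X i \<omega>" "target \<omega> i"] by (auto simp: dist_commute)
  qed auto
  then show ?thesis by (simp add: \<Phi>_eq[OF \<omega>, symmetric])
qed

lemma moved_counting: "\<omega> \<in> space M \<Longrightarrow> moved \<omega> \<in> counting_measures"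
proof -
  assume \<omega>: "\<omega> \<in> space M"
  have "emeasure (moved \<omega>) B < \<infinity>" if B: "B \<in> sets borel" "bounded B" for B
  proof -
    obtain R where R: "B \<subseteq> cball 0 R" using B(2) by (auto simp: bounded_iff subset_eq)
    then have "emeasure (moved \<omega>) B \<le> emeasure (moved \<omega>) (cball 0 R)"
      by (rule emeasure_mono) (simp add: moved_eq)
    also have "\<dots> \<le> emeasure (\<Phi> \<omega>) (cball 0 (R + 2))" by (rule emeasure_moved_cball_le[OF \<omega>])
    also have "\<dots> < \<infinity>" by (rule emeasure_counting_finite[OF counting[OF \<omega>]]) auto
    finally show ?thesis .
  qed
  then show ?thesis unfolding moved_eq by (rule sum_dirac_counting)
qed

lemma pairs_measurable: "pairs \<in> measurable M counting_space"
proof -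
  have "(\<lambda>\<omega>. (X i \<omega>, target \<omega> i)) \<in> borel_measurable M" if "i \<ge> 1" for i
  proof -
    note [measurable] = measurable_X[OF that] measurable_U[OF that] 
    note [measurable] = measurable_move[OF \<Phi> measurable_X[OF that] measurable_U[OF that]]
    show ?thesis by measurable
  qed
  from measurable_sum_dirac[OF \<Phi> this] pairs_counting show ?thesis by (simp add: pairs_def[abs_def])
qed

lemma moved_measurable: "moved \<in> measurable M counting_space"
  using measurable_sum_dirac[OF \<Phi> measurable_move[OF \<Phi> measurable_X measurable_U]] moved_counting
  by (simp add: moved_eq[abs_def])

lemma moved_infinite: "AE \<omega> in M. emeasure (moved \<omega>) UNIV = \<infinity>"
  using infinite
proof (rule AE_mp, intro AE_I2 impI)
  fix \<omega> assume "\<omega> \<in> space M" "emeasure (\<Phi> \<omega>) UNIV = \<infinity>"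
  then have "emeasure (sum_dirac (indices \<omega>) (\<lambda>i. X i \<omega>)) UNIV = \<infinity>"
    by (simp add: \<Phi>_eq[symmetric])
  then show "emeasure (moved \<omega>) UNIV = \<infinity>"
    by (simp add: moved_eq emeasure_sum_dirac)
qed

end

section \<open>Recovering the configuration from its enumerating sequence\<close>

lemma null_measure_counting: "null_measure borel \<in> counting_measures"
  by (auto simp: counting_measures_def intro!: exI[of _ 0])

lemma emeasure_sum_dirac_Suc:
  assumes "B \<in> sets borel"
  shows "emeasure (sum_dirac {1..} x) B = (\<Sum>i. indicator B (x (Suc i)))"
  using nn_integral_sum_dirac[of "indicator B" "{1..}" x] nn_integral_count_space_Suc[OF order_refl, of "\<lambda>i. indicator B (x i)"] assms
  by simp

lemma bounded_subset_cball_nat: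
  fixes B :: "'a::real_normed_vector set"
  assumes "bounded B" obtains n :: nat where "B \<subseteq> cball 0 (real n)"
proof -
  obtain R where R: "\<And>z. z \<in> B \<Longrightarrow> norm z \<le> R" using assms by (auto simp: bounded_iff)
  obtain n :: nat where "R \<le> real n" using real_arch_simple by blast
  then have "B \<subseteq> cball 0 (real n)" using R by force
  then show ?thesis by (rule that)
qed

text \<open>Local finiteness becomes countably many measurable conditions on the sequence, one for
  each integer radius. This is what makes the case distinction in \<open>points_measure\<close>
  measurable.\<close>

lemma sum_dirac_counting_iff:
  "sum_dirac {1..} x \<in> counting_measures \<longleftrightarrow> (\<forall>n::nat. (\<Sum>i. indicator (cball 0 (real n)) (x (Suc i)) :: ennreal) < \<infinity>)"
proof
  assume "sum_dirac {1..} x \<in> counting_measures"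
  then have "emeasure (sum_dirac {1..} x) (cball 0 (real n)) < \<infinity>" for n
    by (rule emeasure_counting_finite) auto
  then show "\<forall>n::nat. (\<Sum>i. indicator (cball 0 (real n)) (x (Suc i)) :: ennreal) < \<infinity>"
    by (simp add: emeasure_sum_dirac_Suc del: One_nat_def)
next
  assume *: "\<forall>n::nat. (\<Sum>i. indicator (cball 0 (real n)) (x (Suc i)) :: ennreal) < \<infinity>"
  show "sum_dirac {1..} x \<in> counting_measures"
  proof (rule sum_dirac_counting)
    fix B :: "'a set" assume B: "B \<in> sets borel" "bounded B"
    then obtain n where "B \<subseteq> cball 0 (real n)" using bounded_subset_cball_nat by blast
    then have "emeasure (sum_dirac {1..} x) B \<le> emeasure (sum_dirac {1..} x) (cball 0 (real n))"
      by (rule emeasure_mono) simp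
    also have "\<dots> < \<infinity>" using * by (simp add: emeasure_sum_dirac_Suc del: One_nat_def)
    finally show "emeasure (sum_dirac {1..} x) B < \<infinity>" .
  qed
qed

text \<open>The junk value makes this a measurable function of the whole sequence.\<close>

definition points_measure :: "(nat \<Rightarrow> 'a::euclidean_space) \<Rightarrow> 'a measure" where
  "points_measure x = (if sum_dirac {1..} x \<in> counting_measures then sum_dirac {1..} x else null_measure borel)"

lemma points_measure_counting: "points_measure x \<in> counting_measures"
  by (simp add: points_measure_def null_measure_counting)

lemma measurable_points_measure:
  "points_measure \<in> measurable (PiM {1..} (\<lambda>_. borel)) (counting_space :: 'a::euclidean_space measure measure)"
proof (rule measurable_counting_spaceI[OF points_measure_counting])
  fix B :: "'a set" assume [measurable]: "B \<in> sets borel"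
  have [measurable]: "(\<lambda>x. x (Suc i)) \<in> borel_measurable (PiM {1..} (\<lambda>_. borel :: 'a measure))" for i
    by (rule measurable_component_singleton) simp
  have "emeasure (points_measure x) B =
      (if \<forall>n::nat. (\<Sum>i. indicator (cball 0 (real n)) (x (Suc i)) :: ennreal) < \<infinity> then \<Sum>i. indicator B (x (Suc i)) else 0)" for x
    unfolding points_measure_def sum_dirac_counting_iff by (simp add: emeasure_sum_dirac_Suc del: One_nat_def)
  moreover have [measurable]: "(\<lambda>x. \<Sum>i. indicator A (x (Suc i)) :: ennreal) \<in> borel_measurable (PiM {1..} (\<lambda>_. borel :: 'a measure))"
    if [measurable]: "A \<in> sets borel" for A
    by measurable
  have "(\<lambda>x. if \<forall>n::nat. (\<Sum>i. indicator (cball 0 (real n)) (x (Suc i)) :: ennreal) < top then \<Sum>i. indicator B (x (Suc i)) :: ennreal else 0)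
      \<in> borel_measurable (PiM {1..} (\<lambda>_. borel :: 'a measure))"
    by measurable
  ultimately show "(\<lambda>x. emeasure (points_measure x) B) \<in> borel_measurable (PiM {1..} (\<lambda>_. borel))"
    by (simp only: infinity_ennreal_def)
qed

lemma integral_eq_enn2real:
  assumes "h \<in> borel_measurable \<phi>" "\<And>x. 0 \<le> h x"
  shows "(\<integral>x. h x \<partial>\<phi>) = enn2real (\<integral>\<^sup>+x. ennreal (h x) \<partial>\<phi>)"
  using assms by (intro integral_eq_nn_integral) auto

text \<open>The part of the configuration on which moves with start in the projection of
  \<open>C\<close> depend. A union of open balls is Borel whatever the projection is, and radius 2
  leaves room for the closed unit balls inspected by \<open>Y1\<close> and
  \<open>Y2\<close>.\<close>

definition fst_nbhd :: "('a::euclidean_space \<times> 'a) set \<Rightarrow> 'a set" where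
  "fst_nbhd C = (\<Union>p\<in>C. ball (fst p) 2)"

lemma fst_nbhd:
  shows sets_fst_nbhd: "fst_nbhd C \<in> sets borel"
    and bounded_fst_nbhd: "bounded C \<Longrightarrow> bounded (fst_nbhd C)"
    and fst_subset_fst_nbhd: "p \<in> C \<Longrightarrow> fst p \<in> fst_nbhd C"
    and cball_subset_fst_nbhd: "p \<in> C \<Longrightarrow> cball (fst p) 1 \<subseteq> fst_nbhd C"
proof -
  show "fst_nbhd C \<in> sets borel" unfolding fst_nbhd_def by (intro borel_open open_UN ballI open_ball)
  show "p \<in> C \<Longrightarrow> fst p \<in> fst_nbhd C" by (force simp: fst_nbhd_def)
  show "p \<in> C \<Longrightarrow> cball (fst p) 1 \<subseteq> fst_nbhd C" by (force simp: fst_nbhd_def)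
  assume "bounded C"
  then obtain R where R: "\<And>z. z \<in> C \<Longrightarrow> norm z \<le> R" by (auto simp: bounded_iff)
  have "norm y \<le> R + 2" if y: "y \<in> fst_nbhd C" for y
  proof -
    from y obtain p where p: "p \<in> C" "dist (fst p) y < 2" by (auto simp: fst_nbhd_def)
    then show ?thesis using R[OF p(1)] norm_fst_le[of "fst p" "snd p"] norm_triangle_sub[of y "fst p"]
      by (simp add: dist_norm norm_minus_commute)
  qed
  then show "bounded (fst_nbhd C)" by (auto simp: bounded_iff)
qed

section \<open>The conditional Laplace functional of the pairs given the starting points\<close>

context displacement
begin

abbreviation step_law :: "'a measure" where "step_law \<equiv> distr M borel (U 1)"

lemma prob_space_step_law: "prob_space step_law"
  using measurable_U[of 1] by (intro prob_space_distr) simp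

text \<open>The conditional Laplace functional of the displaced points given their starting points
  is \<open>exp (- \<integral> cumulant h \<phi> x \<phi>(dx))\<close>; it does not depend on the enumeration.\<close>

definition cumulant :: "('a \<times> 'a \<Rightarrow> real) \<Rightarrow> 'a measure \<Rightarrow> 'a \<Rightarrow> real" where
  "cumulant h \<phi> x = - ln (\<integral>u. exp (- h (x, move \<phi> x u)) \<partial>step_law)"

definition cond_laplace :: "('a \<times> 'a \<Rightarrow> real) \<Rightarrow> 'a measure \<Rightarrow> real" where
  "cond_laplace h \<phi> = exp (- enn2real (\<integral>\<^sup>+x. ennreal (cumulant h \<phi> x) \<partial>\<phi>))"

lemma measurable_test_fun_move:
  assumes h: "test_fun C h" and \<phi>: "\<phi> \<in> counting_measures"
  shows "(\<lambda>u. h (x, move \<phi> x u)) \<in> borel_measurable borel"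
proof -
  have "(\<lambda>u. move \<phi> x u) \<in> borel_measurable borel"
    by (rule measurable_move) (use \<phi> in \<open>auto simp: space_counting_space\<close>)
  then have [measurable]: "(\<lambda>u. (x, move \<phi> x u)) \<in> measurable borel borel" by measurable
  show ?thesis using measurable_compose[OF _ test_funD(2)[OF h]] by measurable
qed

text \<open>If \<open>h\<close> is bounded by \<open>c\<close>, the averaged exponential lies
  between \<open>exp (- c)\<close> and 1. It is therefore positive, its negative logarithm is
  genuine, and that logarithm lies between 0 and \<open>c\<close>.\<close>

lemma cumulant:
  assumes h: "test_fun C h" and \<phi>: "\<phi> \<in> counting_measures"
  shows cumulant_nonneg: "0 \<le> cumulant h \<phi> x"
    and cumulant_le: "(\<And>z. h z \<le> c) \<Longrightarrow> cumulant h \<phi> x \<le> c"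
    and exp_cumulant: "exp (- cumulant h \<phi> x) = (\<integral>u. exp (- h (x, move \<phi> x u)) \<partial>step_law)"
    and cumulant_eq_0: "x \<notin> fst ` C \<Longrightarrow> cumulant h \<phi> x = 0"
proof -
  interpret step: prob_space step_law by (rule prob_space_step_law)
  have [measurable]: "(\<lambda>u. h (x, move \<phi> x u)) \<in> borel_measurable borel"
    by (rule measurable_test_fun_move[OF h \<phi>])
  have int: "integrable step_law (\<lambda>u. exp (- h (x, move \<phi> x u)))"
    using test_funD(3)[OF h] by (intro step.integrable_const_bound[where B = 1]) auto
  obtain c' where c': "\<And>z. h z \<le> c'" using test_fun_bounded[OF h] by blast
  have low: "exp (- c) \<le> (\<integral>u. exp (- h (x, move \<phi> x u)) \<partial>step_law)" if "\<And>z. h z \<le> c" for c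
  proof -
    have "(\<integral>u. exp (- c) \<partial>step_law) \<le> (\<integral>u. exp (- h (x, move \<phi> x u)) \<partial>step_law)"
      using int that step.integrable_const[of "exp (- c)"] by (intro integral_mono) simp_all
    then show ?thesis using step.prob_space by simp
  qed
  have up: "(\<integral>u. exp (- h (x, move \<phi> x u)) \<partial>step_law) \<le> 1"
  proof -
    have "(\<integral>u. exp (- h (x, move \<phi> x u)) \<partial>step_law) \<le> (\<integral>u. 1 \<partial>step_law)"
      using int test_funD(3)[OF h] step.integrable_const[of 1] by (intro integral_mono) simp_all
    then show ?thesis using step.prob_space by simp
  qed
  have pos: "0 < (\<integral>u. exp (- h (x, move \<phi> x u)) \<partial>step_law)"
    using low[OF c'] exp_gt_zero[of "-c'"] by linarith
  show "0 \<le> cumulant h \<phi> x" using up pos by (simp add: cumulant_def)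
  show "exp (- cumulant h \<phi> x) = (\<integral>u. exp (- h (x, move \<phi> x u)) \<partial>step_law)"
    using pos by (simp add: cumulant_def)
  show "cumulant h \<phi> x \<le> c" if "\<And>z. h z \<le> c"
    using ln_mono[OF low[OF that]] pos by (simp add: cumulant_def)
  show "cumulant h \<phi> x = 0" if "x \<notin> fst ` C"
  proof -
    have "h (x, y) = 0" for y using test_funD(4)[OF h, of "(x, y)"] that by force
    then show ?thesis using step.prob_space by (simp add: cumulant_def)
  qed
qed

lemma measurable_cumulant:
  assumes h: "test_fun C h"
  shows "(\<lambda>(\<phi>, x). cumulant h \<phi> x) \<in> borel_measurable (counting_space \<Otimes>\<^sub>M borel)"
proof -
  interpret step: prob_space step_law by (rule prob_space_step_law)
  have [measurable]: "(\<lambda>z. move (fst (fst z)) (snd (fst z)) (snd z)) \<in> borel_measurable ((counting_space \<Otimes>\<^sub>M borel) \<Otimes>\<^sub>M step_law)"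
    by (rule measurable_move) auto
  have "(\<lambda>z. (snd (fst z), move (fst (fst z)) (snd (fst z)) (snd z))) \<in> measurable ((counting_space \<Otimes>\<^sub>M borel) \<Otimes>\<^sub>M step_law) borel"
    by measurable
  from measurable_compose[OF this test_funD(2)[OF h]]
  have "(\<lambda>z. exp (- h (snd (fst z), move (fst (fst z)) (snd (fst z)) (snd z)))) \<in> borel_measurable ((counting_space \<Otimes>\<^sub>M borel) \<Otimes>\<^sub>M step_law)"
    by measurable
  then have "(\<lambda>p. \<integral>u. exp (- h (snd p, move (fst p) (snd p) u)) \<partial>step_law) \<in> borel_measurable (counting_space \<Otimes>\<^sub>M borel)"
    by (intro step.borel_measurable_lebesgue_integral) (simp add: case_prod_beta)
  then show ?thesis unfolding cumulant_def case_prod_beta by measurable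
qed

lemma measurable_cond_laplace:
  assumes h: "test_fun C h"
  shows "cond_laplace h \<in> borel_measurable counting_space"
proof -
  have "(\<lambda>\<phi>. \<integral>\<^sup>+x. ennreal (cumulant h \<phi> x) \<partial>\<phi>) \<in> borel_measurable counting_space"
    using measurable_cumulant[OF h]
    by (intro measurable_nn_integral_counting') (auto simp: case_prod_beta)
  then show ?thesis unfolding cond_laplace_def by measurable
qed

lemma measurable_cumulant_section:
  assumes h: "test_fun C h" and \<phi>: "\<phi> \<in> counting_measures"
  shows "cumulant h \<phi> \<in> borel_measurable borel"
  using measurable_Pair2[OF measurable_cumulant[OF h], of \<phi>] \<phi> by (simp add: space_counting_space)

text \<open>The integrand is bounded and vanishes off a bounded neighbourhood. Finiteness is what
  lets \<open>enn2real\<close> respect sums in \<open>cond_laplace_add\<close>.\<close>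

lemma nn_integral_cumulant_finite:
  assumes h: "test_fun C h" and C: "bounded C" and \<phi>: "\<phi> \<in> counting_measures"
  shows "(\<integral>\<^sup>+x. ennreal (cumulant h \<phi> x) \<partial>\<phi>) < \<infinity>"
proof -
  obtain c where c: "0 \<le> c" "\<And>z. h z \<le> c" using test_fun_bounded[OF h] by blast
  have "(\<integral>\<^sup>+x. ennreal (cumulant h \<phi> x) \<partial>\<phi>) \<le> (\<integral>\<^sup>+x. ennreal c * indicator (fst_nbhd C) x \<partial>\<phi>)"
  proof (rule nn_integral_mono)
    fix x
    have "cumulant h \<phi> x = 0" if "x \<notin> fst_nbhd C"
      using that fst_subset_fst_nbhd by (intro cumulant_eq_0[OF h \<phi>]) blast
    then show "ennreal (cumulant h \<phi> x) \<le> ennreal c * indicator (fst_nbhd C) x"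
      using cumulant_le[OF h \<phi> c(2), of x] by (auto simp: indicator_def intro: ennreal_leI)
  qed
  also have "\<dots> = ennreal c * emeasure \<phi> (fst_nbhd C)"
    by (intro nn_integral_cmult_indicator) (simp add: sets_counting[OF \<phi>] sets_fst_nbhd)
  also have "\<dots> < \<infinity>"
    using emeasure_counting_finite[OF \<phi> sets_fst_nbhd bounded_fst_nbhd[OF C]]
    by (simp add: ennreal_mult_less_top)
  finally show ?thesis .
qed

lemma cond_laplace_range:
  "0 \<le> cond_laplace h \<phi>" "cond_laplace h \<phi> \<le> 1"
  by (auto simp: cond_laplace_def)

text \<open>Only points that can start a pair in \<open>C\<close> contribute, and the move of such a
  point depends on the configuration within distance 1 of it. Independence of \<open>\<Phi>\<close>
  on distant sets thereby carries over to conditional Laplace functionals.\<close>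

lemma cond_laplace_restrict_to:
  assumes h: "test_fun C h" and \<phi>: "\<phi> \<in> counting_measures"
  shows "cond_laplace h (restrict_to \<phi> (fst_nbhd C)) = cond_laplace h \<phi>"
proof -
  let ?K = "fst_nbhd C"
  have r: "restrict_to \<phi> ?K \<in> counting_measures" by (rule restrict_to_counting[OF \<phi> sets_fst_nbhd])
  have eq: "cumulant h (restrict_to \<phi> ?K) x = cumulant h \<phi> x" for x
  proof (cases "x \<in> fst ` C")
    case True
    then have "cball x 1 \<subseteq> ?K" using cball_subset_fst_nbhd by blast
    then show ?thesis by (simp add: cumulant_def move_restrict_to[OF \<phi> sets_fst_nbhd])
  next
    case False
    then show ?thesis by (simp add: cumulant_eq_0[OF h] r \<phi>)
  qed
  have "(\<integral>\<^sup>+x. ennreal (cumulant h \<phi> x) \<partial>restrict_to \<phi> ?K) = (\<integral>\<^sup>+x. indicator ?K x * ennreal (cumulant h \<phi> x) \<partial>\<phi>)"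
    unfolding restrict_to_def
    using measurable_cumulant_section[OF h \<phi>] sets_fst_nbhd
    by (intro nn_integral_density borel_measurable_indicator)
      (auto simp: measurable_counting[OF \<phi>] sets_counting[OF \<phi>])
  also have "\<dots> = (\<integral>\<^sup>+x. ennreal (cumulant h \<phi> x) \<partial>\<phi>)"
  proof (rule nn_integral_cong)
    fix x
    have "cumulant h \<phi> x = 0" if "x \<notin> ?K"
      using that fst_subset_fst_nbhd by (intro cumulant_eq_0[OF h \<phi>]) blast
    then show "indicator ?K x * ennreal (cumulant h \<phi> x) = ennreal (cumulant h \<phi> x)"
      by (auto simp: indicator_def)
  qed
  finally show ?thesis by (simp add: cond_laplace_def eq)
qed

text \<open>For each starting point at most one of \<open>g\<close> and \<open>h\<close> can be
  nonzero, since the projections of \<open>C\<close> and \<open>D\<close> are disjoint; hence the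
  cumulants add pointwise.\<close>

lemma cond_laplace_add:
  assumes g: "test_fun C g" and h: "test_fun D h" and disj: "fst ` C \<inter> fst ` D = {}"
    and C: "bounded C" "bounded D" and \<phi>: "\<phi> \<in> counting_measures"
  shows "cond_laplace (\<lambda>p. g p + h p) \<phi> = cond_laplace g \<phi> * cond_laplace h \<phi>"
proof -
  note gh = test_fun_add[OF g h]
  have eq: "cumulant (\<lambda>p. g p + h p) \<phi> x = cumulant g \<phi> x + cumulant h \<phi> x" for x
  proof (cases "x \<in> fst ` C")
    case True
    then have "x \<notin> fst ` D" using disj by blast
    then have "h (x, y) = 0" for y using test_funD(4)[OF h, of "(x, y)"] by force
    then show ?thesis using cumulant_eq_0[OF h \<phi> \<open>x \<notin> fst ` D\<close>] by (simp add: cumulant_def)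
  next
    case False
    then have "g (x, y) = 0" for y using test_funD(4)[OF g, of "(x, y)"] by force
    then show ?thesis using cumulant_eq_0[OF g \<phi> False] by (simp add: cumulant_def)
  qed
  have "(\<integral>\<^sup>+x. ennreal (cumulant (\<lambda>p. g p + h p) \<phi> x) \<partial>\<phi>) =
      (\<integral>\<^sup>+x. ennreal (cumulant g \<phi> x) \<partial>\<phi>) + (\<integral>\<^sup>+x. ennreal (cumulant h \<phi> x) \<partial>\<phi>)"
    unfolding eq ennreal_plus[OF cumulant_nonneg[OF g \<phi>] cumulant_nonneg[OF h \<phi>]]
    using measurable_cumulant_section[OF g \<phi>] measurable_cumulant_section[OF h \<phi>]
    by (intro nn_integral_add) (auto simp: measurable_counting[OF \<phi>])
  then show ?thesis
    using nn_integral_cumulant_finite[OF g C(1) \<phi>] nn_integral_cumulant_finite[OF h C(2) \<phi>]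
    by (simp add: cond_laplace_def enn2real_plus exp_add[symmetric])
qed

text \<open>The Laplace functional written as a function of the sequence of points and the sequence
  of marks alone, with the configuration rebuilt from the former. In this form Fubini for two
  independent sequences applies.\<close>

definition path_laplace :: "('a \<times> 'a \<Rightarrow> real) \<Rightarrow> (nat \<Rightarrow> 'a) \<times> (nat \<Rightarrow> 'a) \<Rightarrow> real" where
  "path_laplace h z = exp (- enn2real (\<Sum>i. ennreal (h (fst z (Suc i),
     move (points_measure (fst z)) (fst z (Suc i)) (snd z (Suc i))))))"

lemma measurable_path_laplace:
  assumes h: "test_fun C h"
  shows "path_laplace h \<in> borel_measurable (PiM {1..} (\<lambda>_. borel) \<Otimes>\<^sub>M PiM {1..} (\<lambda>_. borel))"
proof -
  let ?P = "PiM {1..} (\<lambda>_. borel) :: (nat \<Rightarrow> 'a) measure"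
  have c: "(\<lambda>x. x (Suc i)) \<in> borel_measurable ?P" for i
    by (rule measurable_component_singleton) simp
  have [measurable]: "(\<lambda>z. fst z (Suc i)) \<in> borel_measurable (?P \<Otimes>\<^sub>M ?P)" "(\<lambda>z. snd z (Suc i)) \<in> borel_measurable (?P \<Otimes>\<^sub>M ?P)" for i
    using measurable_compose[OF measurable_fst c] measurable_compose[OF measurable_snd c] by auto
  have [measurable]: "(\<lambda>z. points_measure (fst z)) \<in> measurable (?P \<Otimes>\<^sub>M ?P) counting_space"
    using measurable_compose[OF measurable_fst measurable_points_measure] .
  have [measurable]: "(\<lambda>z. move (points_measure (fst z)) (fst z (Suc i)) (snd z (Suc i))) \<in> borel_measurable (?P \<Otimes>\<^sub>M ?P)" for i
    by (rule measurable_move) measurable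
  have "(\<lambda>z. (fst z (Suc i), move (points_measure (fst z)) (fst z (Suc i)) (snd z (Suc i)))) \<in> measurable (?P \<Otimes>\<^sub>M ?P) borel" for i
    by measurable
  note [measurable] = measurable_compose[OF this test_funD(2)[OF h]]
  show ?thesis unfolding path_laplace_def[abs_def] by measurable
qed

text \<open>With infinitely many points every index from 1 on is in use, so the sequence
  \<open>X\<close> alone determines the configuration; this holds almost surely.\<close>

lemma good_points:
  "AE \<omega> in M. indices \<omega> = {1..} \<and> points_measure (\<lambda>i\<in>{1..}. X i \<omega>) = \<Phi> \<omega>"
  using infinite
proof (rule AE_mp, intro AE_I2 impI)
  fix \<omega> assume \<omega>: "\<omega> \<in> space M" and inf: "emeasure (\<Phi> \<omega>) UNIV = \<infinity>"
  have *: "indices \<omega> = {1..}" using inf by (auto simp: point_indices_def)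
  have "sum_dirac {1..} (\<lambda>i\<in>{1..}. X i \<omega>) = sum_dirac {1..} (\<lambda>i. X i \<omega>)" by (rule sum_dirac_cong) simp
  also have "\<dots> = \<Phi> \<omega>" using \<Phi>_eq[OF \<omega>] unfolding * ..
  finally show "indices \<omega> = {1..} \<and> points_measure (\<lambda>i\<in>{1..}. X i \<omega>) = \<Phi> \<omega>"
    using counting[OF \<omega>] * by (simp add: points_measure_def)
qed

lemma path_laplace_eq:
  assumes h: "test_fun C h" and \<omega>: "\<omega> \<in> space M"
    and good: "indices \<omega> = {1..}" "points_measure (\<lambda>i\<in>{1..}. X i \<omega>) = \<Phi> \<omega>"
  shows "path_laplace h (\<lambda>i\<in>{1..}. X i \<omega>, \<lambda>i\<in>{1..}. U i \<omega>) = exp (- (\<integral>p. h p \<partial>pairs \<omega>))"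
proof -
  have "(\<integral>p. h p \<partial>pairs \<omega>) = enn2real (\<integral>\<^sup>+p. ennreal (h p) \<partial>pairs \<omega>)"
    using test_funD(2,3)[OF h]
    by (intro integral_eq_enn2real) (auto simp: measurable_counting[OF pairs_counting[OF \<omega>]])
  also have "(\<integral>\<^sup>+p. ennreal (h p) \<partial>pairs \<omega>) =
      (\<integral>\<^sup>+i. ennreal (h (X i \<omega>, target \<omega> i)) \<partial>count_space {1..})"
    unfolding pairs_def good(1) using test_funD(2)[OF h] by (subst nn_integral_sum_dirac) auto
  also have "\<dots> = (\<Sum>i. ennreal (h (X (Suc i) \<omega>, move (\<Phi> \<omega>) (X (Suc i) \<omega>) (U (Suc i) \<omega>))))"
    by (subst nn_integral_count_space_Suc) auto
  finally show ?thesis by (simp add: path_laplace_def good(2) del: One_nat_def)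
qed

text \<open>The points are frozen at \<open>\<omega>\<close> and only the marks are averaged. The
  finitely many indices in \<open>S\<close> whose points lie near \<open>C\<close> contribute; their
  marks are independent with the common law \<open>step_law\<close>, so the expectation is a product
  of factors \<open>exp (- cumulant ...)\<close>, whose logarithm is an integral over the
  configuration.\<close>

lemma expectation_path_laplace:
  assumes h: "test_fun C h" and C: "bounded C" and \<omega>: "\<omega> \<in> space M"
    and good: "indices \<omega> = {1..}" "points_measure (\<lambda>i\<in>{1..}. X i \<omega>) = \<Phi> \<omega>"
  shows "expectation (\<lambda>\<omega>'. path_laplace h (\<lambda>i\<in>{1..}. X i \<omega>, \<lambda>i\<in>{1..}. U i \<omega>')) = cond_laplace h (\<Phi> \<omega>)"
proof -
  define \<phi> where "\<phi> = \<Phi> \<omega>"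
  have \<phi>: "\<phi> \<in> counting_measures" by (simp add: \<phi>_def counting[OF \<omega>])
  have \<phi>_sum: "\<phi> = sum_dirac {1..} (\<lambda>i. X i \<omega>)" using \<Phi>_eq[OF \<omega>] by (simp add: \<phi>_def good(1))
  define S where "S = {i\<in>{1..}. X i \<omega> \<in> fst_nbhd C}"
  have "emeasure (count_space {1..}) S < \<infinity>"
    using emeasure_counting_finite[OF \<phi> sets_fst_nbhd bounded_fst_nbhd[OF C]]
    unfolding S_def by (subst (asm) \<phi>_sum) (simp add: emeasure_sum_dirac sets_fst_nbhd)
  then have S: "finite S" by (subst (asm) emeasure_count_space) (auto simp: S_def split: if_splits)
  have h0: "h (X i \<omega>, y) = 0" if "i \<in> {1..} - S" for i y
    using that fst_subset_fst_nbhd[of "(X i \<omega>, y)" C] by (intro test_funD(4)[OF h]) (auto simp: S_def)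
  have H0: "cumulant h \<phi> (X i \<omega>) = 0" if "i \<in> {1..} - S" for i
  proof (rule cumulant_eq_0[OF h \<phi>])
    show "X i \<omega> \<notin> fst ` C" using that fst_subset_fst_nbhd by (fastforce simp: S_def)
  qed
  define f where "f i u = exp (- h (X i \<omega>, move \<phi> (X i \<omega>) u))" for i u
  have f_meas [measurable]: "f i \<in> borel_measurable borel" for i
    using measurable_test_fun_move[OF h \<phi>, of "X i \<omega>"] unfolding f_def by measurable
  have f01: "0 \<le> f i u" "f i u \<le> 1" for i u using test_funD(3)[OF h] by (auto simp: f_def)
  have "path_laplace h (\<lambda>i\<in>{1..}. X i \<omega>, \<lambda>i\<in>{1..}. U i \<omega>') = (\<Prod>i\<in>S. f i (U i \<omega>'))" for \<omega>'
  proof -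
    have "(\<Sum>i. ennreal (h (X (Suc i) \<omega>, move \<phi> (X (Suc i) \<omega>) (U (Suc i) \<omega>')))) =
        (\<integral>\<^sup>+i. ennreal (h (X i \<omega>, move \<phi> (X i \<omega>) (U i \<omega>'))) \<partial>count_space {1..})"
      by (subst nn_integral_count_space_Suc) auto
    also have "\<dots> = (\<Sum>i\<in>S. ennreal (h (X i \<omega>, move \<phi> (X i \<omega>) (U i \<omega>'))))"
      using S h0 by (intro nn_integral_count_space') (auto simp: S_def)
    also have "\<dots> = ennreal (\<Sum>i\<in>S. h (X i \<omega>, move \<phi> (X i \<omega>) (U i \<omega>')))"
      using test_funD(3)[OF h] by (intro sum_ennreal) auto
    finally show ?thesis
      using S test_funD(3)[OF h]
      by (simp add: path_laplace_def good(2) \<phi>_def[symmetric] f_def exp_sum sum_negf[symmetric] sum_nonneg del: One_nat_def)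
  qed
  then have "expectation (\<lambda>\<omega>'. path_laplace h (\<lambda>i\<in>{1..}. X i \<omega>, \<lambda>i\<in>{1..}. U i \<omega>')) =
      expectation (\<lambda>\<omega>'. \<Prod>i\<in>S. f i (U i \<omega>'))" by simp
  also have "\<dots> = (\<Prod>i\<in>S. expectation (\<lambda>\<omega>'. f i (U i \<omega>')))"
  proof (rule indep_vars_lebesgue_integral[OF S])
    have "indep_vars (\<lambda>_. borel) U S" using U_indep by (rule indep_vars_subset) (auto simp: S_def)
    then show "indep_vars (\<lambda>_. borel) (\<lambda>i \<omega>'. f i (U i \<omega>')) S"
      by (rule indep_vars_compose2) measurable
    fix i assume "i \<in> S"
    then have [measurable]: "U i \<in> borel_measurable M" by (intro measurable_U) (auto simp: S_def)
    show "integrable M (\<lambda>\<omega>'. f i (U i \<omega>'))"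
      using f01 by (intro integrable_bounded[where c = 1]) auto
  qed
  also have "\<dots> = (\<Prod>i\<in>S. exp (- cumulant h \<phi> (X i \<omega>)))"
  proof (rule prod.cong[OF refl])
    fix i assume "i \<in> S"
    then have i: "i \<ge> 1" by (auto simp: S_def)
    have "expectation (\<lambda>\<omega>'. f i (U i \<omega>')) = (\<integral>u. f i u \<partial>distr M borel (U i))"
      using measurable_U[OF i] by (subst integral_distr) auto
    also have "\<dots> = (\<integral>u. f i u \<partial>step_law)" by (simp only: U_ident[OF i])
    finally show "expectation (\<lambda>\<omega>'. f i (U i \<omega>')) = exp (- cumulant h \<phi> (X i \<omega>))"
      by (simp add: exp_cumulant[OF h \<phi>] f_def)
  qed
  also have "\<dots> = exp (- (\<Sum>i\<in>S. cumulant h \<phi> (X i \<omega>)))" using S by (simp add: exp_sum sum_negf[symmetric])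
  also have "(\<Sum>i\<in>S. cumulant h \<phi> (X i \<omega>)) = enn2real (\<integral>\<^sup>+x. ennreal (cumulant h \<phi> x) \<partial>\<phi>)"
  proof -
    have "(\<integral>\<^sup>+x. ennreal (cumulant h \<phi> x) \<partial>\<phi>) = (\<integral>\<^sup>+x. ennreal (cumulant h \<phi> x) \<partial>sum_dirac {1..} (\<lambda>i. X i \<omega>))"
      by (subst \<phi>_sum) (rule refl)
    also have "\<dots> = (\<integral>\<^sup>+i. ennreal (cumulant h \<phi> (X i \<omega>)) \<partial>count_space {1..})"
      using measurable_cumulant_section[OF h \<phi>] by (subst nn_integral_sum_dirac) auto
    also have "\<dots> = (\<Sum>i\<in>S. ennreal (cumulant h \<phi> (X i \<omega>)))"
      using S H0 by (intro nn_integral_count_space') (auto simp: S_def)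
    also have "\<dots> = ennreal (\<Sum>i\<in>S. cumulant h \<phi> (X i \<omega>))"
      using cumulant_nonneg[OF h \<phi>] by (intro sum_ennreal) auto
    finally show ?thesis using cumulant_nonneg[OF h \<phi>] by (simp add: sum_nonneg)
  qed
  finally show ?thesis by (simp only: cond_laplace_def \<phi>_def)
qed

text \<open>Almost surely the exponential is \<open>path_laplace\<close> of the two independent
  sequences. Averaging over the marks first leaves a function of the configuration.\<close>

lemma laplace_pairs:
  assumes h: "test_fun C h" and C: "bounded C"
  shows "laplace pairs h = expectation (\<lambda>\<omega>. cond_laplace h (\<Phi> \<omega>))"
proof -
  note [measurable] = measurable_path_laplace[OF h] measurable_cond_laplace[OF h]
  let ?X = "\<lambda>\<omega>. \<lambda>i\<in>{1..}. X i \<omega>" and ?U = "\<lambda>\<omega>. \<lambda>i\<in>{1..}. U i \<omega>"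
  note [measurable] = indep_var_rv1[OF X_U_indep] indep_var_rv2[OF X_U_indep]
  have m: "(\<lambda>\<omega>. expectation (\<lambda>\<omega>'. path_laplace h (?X \<omega>, ?U \<omega>'))) \<in> borel_measurable M"
    by (rule borel_measurable_lebesgue_integral) measurable
  have "(\<lambda>\<omega>. exp (- (\<integral>p. h p \<partial>pairs \<omega>))) \<in> borel_measurable M"
  proof -
    have "(\<lambda>\<omega>. exp (- enn2real (\<integral>\<^sup>+p. ennreal (h p) \<partial>pairs \<omega>))) \<in> borel_measurable M"
    proof -
      have "(\<lambda>z. ennreal (h (snd z))) \<in> borel_measurable (M \<Otimes>\<^sub>M borel)"
        using measurable_compose[OF measurable_snd test_funD(2)[OF h]] by measurable
      then have "(\<lambda>\<omega>. (\<integral>\<^sup>+p. ennreal (h p) \<partial>pairs \<omega>)) \<in> borel_measurable M"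
        by (intro measurable_nn_integral_counting' pairs_measurable) (simp add: case_prod_beta)
      then show ?thesis by measurable
    qed
    also have "?this \<longleftrightarrow> ?thesis"
      using test_funD(2,3)[OF h]
      by (intro measurable_cong) (auto simp: integral_eq_enn2real measurable_counting[OF pairs_counting])
    finally show ?thesis .
  qed
  then have "laplace pairs h = expectation (\<lambda>\<omega>. path_laplace h (?X \<omega>, ?U \<omega>))"
  proof (rule integral_cong_AE)
    show "(\<lambda>\<omega>. path_laplace h (?X \<omega>, ?U \<omega>)) \<in> borel_measurable M"
      by (rule measurable_compose[OF measurable_Pair[OF indep_var_rv1[OF X_U_indep] indep_var_rv2[OF X_U_indep]] measurable_path_laplace[OF h]])
    show "AE \<omega> in M. exp (- (\<integral>p. h p \<partial>pairs \<omega>)) = path_laplace h (?X \<omega>, ?U \<omega>)"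
      using good_points AE_space by eventually_elim (use path_laplace_eq[OF h] in simp)
  qed
  also have "\<dots> = expectation (\<lambda>\<omega>. expectation (\<lambda>\<omega>'. path_laplace h (?X \<omega>, ?U \<omega>')))"
    by (rule indep_var_expectation[OF X_U_indep measurable_path_laplace[OF h], where c = 1]) (simp add: path_laplace_def)
  also have "\<dots> = expectation (\<lambda>\<omega>. cond_laplace h (\<Phi> \<omega>))"
  proof (rule integral_cong_AE[OF m])
    show "(\<lambda>\<omega>. cond_laplace h (\<Phi> \<omega>)) \<in> borel_measurable M"
      by (rule measurable_compose[OF \<Phi> measurable_cond_laplace[OF h]])
    show "AE \<omega> in M. expectation (\<lambda>\<omega>'. path_laplace h (?X \<omega>, ?U \<omega>')) = cond_laplace h (\<Phi> \<omega>)"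
      using good_points AE_space by eventually_elim (use expectation_path_laplace[OF h C] in simp)
  qed
  finally show ?thesis .
qed

end

subsection \<open>Finite range of dependence\<close>

text \<open>This is m-dependence, tested on bounded windows. With strict separation the case
  \<open>m = 0\<close> covers all disjoint windows, which is the Poisson case.\<close>

definition (in prob_space) finite_range :: "('a \<Rightarrow> 'b::euclidean_space measure) \<Rightarrow> real \<Rightarrow> bool" where
  "finite_range \<Phi> m \<longleftrightarrow> (\<forall>A B. A \<in> sets borel \<longrightarrow> B \<in> sets borel \<longrightarrow> bounded A \<longrightarrow> bounded B \<longrightarrow>
    (\<forall>a\<in>A. \<forall>b\<in>B. m < dist a b) \<longrightarrow>
    indep_var counting_space (\<lambda>\<omega>. restrict_to (\<Phi> \<omega>) A) counting_space (\<lambda>\<omega>. restrict_to (\<Phi> \<omega>) B))"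

lemma (in prob_space) finite_rangeD:
  assumes "finite_range \<Phi> m" "A \<in> sets borel" "bounded A" "B \<in> sets borel" "bounded B"
    "\<And>a b. a \<in> A \<Longrightarrow> b \<in> B \<Longrightarrow> m < dist a b"
  shows "indep_var counting_space (\<lambda>\<omega>. restrict_to (\<Phi> \<omega>) A) counting_space (\<lambda>\<omega>. restrict_to (\<Phi> \<omega>) B)"
  using assms unfolding finite_range_def by blast

lemma (in prob_space) indep_var_cong:
  assumes "\<And>\<omega>. \<omega> \<in> space M \<Longrightarrow> X \<omega> = X' \<omega>" "\<And>\<omega>. \<omega> \<in> space M \<Longrightarrow> Y \<omega> = Y' \<omega>"
  shows "indep_var S X T Y \<longleftrightarrow> indep_var S X' T Y'"
  unfolding indep_var_distribution_eq
  using assms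
  by (intro conj_cong arg_cong2[where f = "(=)"] arg_cong2[where f = pair_measure] distr_cong measurable_cong refl) auto

lemma (in prob_space) finite_range_cong:
  assumes "finite_range \<Phi> m" and eq: "\<And>\<omega>. \<omega> \<in> space M \<Longrightarrow> \<Psi> \<omega> = \<Phi> \<omega>"
  shows "finite_range \<Psi> m"
proof -
  have "(indep_var counting_space (\<lambda>\<omega>. restrict_to (\<Psi> \<omega>) A) counting_space (\<lambda>\<omega>. restrict_to (\<Psi> \<omega>) B)) =
    (indep_var counting_space (\<lambda>\<omega>. restrict_to (\<Phi> \<omega>) A) counting_space (\<lambda>\<omega>. restrict_to (\<Phi> \<omega>) B))" for A B
    using eq by (intro indep_var_cong) auto
  then show ?thesis using assms(1) by (simp add: finite_range_def)
qed

lemma (in prob_space) finite_range_poisson: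
  assumes P: "poisson_process M \<Lambda> \<Phi>"
  shows "finite_range \<Phi> 0"
  unfolding finite_range_def
proof (intro allI impI)
  fix A B :: "'b set" assume AB: "A \<in> sets borel" "B \<in> sets borel" "bounded A" "bounded B" "\<forall>a\<in>A. \<forall>b\<in>B. 0 < dist a b"
  have "A \<inter> B = {}" using AB(5) by fastforce
  moreover have "\<Phi> \<in> measurable M counting_space" using P by (simp add: poisson_process_def)
  ultimately show "indep_var counting_space (\<lambda>\<omega>. restrict_to (\<Phi> \<omega>) A) counting_space (\<lambda>\<omega>. restrict_to (\<Phi> \<omega>) B)"
    using AB by (intro laplace_factorises_imp_indep_restrict poisson_process_laplace_factorises[OF P])
qed

context displacement
begin

text \<open>The conditional functionals of \<open>g\<close> and \<open>h\<close> depend on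
  \<open>\<Phi>\<close> only through neighbourhoods of radius 2 of the two sets of starting points.
  The 4 is twice this radius, so the neighbourhoods remain more than \<open>m\<close> apart.\<close>

lemma pairs_laplace_factorises:
  assumes FR: "finite_range \<Phi> m" and C: "C \<in> sets borel" "bounded C" and D: "D \<in> sets borel" "bounded D"
    and m: "0 \<le> m" and far: "\<And>p q. p \<in> C \<Longrightarrow> q \<in> D \<Longrightarrow> m + 4 < dist (fst p) (fst q)"
  shows "laplace_factorises pairs C D"
  unfolding laplace_factorises_def
proof (intro allI impI)
  fix g h assume g: "test_fun C g" and h: "test_fun D h"
  have "fst p \<noteq> fst q" if "p \<in> C" "q \<in> D" for p q using far[OF that] m by auto
  then have disj: "fst ` C \<inter> fst ` D = {}" by auto
  have "indep_var counting_space (\<lambda>\<omega>. restrict_to (\<Phi> \<omega>) (fst_nbhd C)) counting_space (\<lambda>\<omega>. restrict_to (\<Phi> \<omega>) (fst_nbhd D))"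
  proof (rule finite_rangeD[OF FR sets_fst_nbhd bounded_fst_nbhd[OF C(2)] sets_fst_nbhd bounded_fst_nbhd[OF D(2)]])
    fix a b assume "a \<in> fst_nbhd C" "b \<in> fst_nbhd D"
    then obtain p q where pq: "p \<in> C" "q \<in> D" "dist (fst p) a < 2" "dist (fst q) b < 2"
      by (auto simp: fst_nbhd_def)
    have "dist (fst p) (fst q) \<le> dist (fst p) a + dist a b + dist (fst q) b"
      using dist_triangle[of "fst p" "fst q" a] dist_triangle[of a "fst q" b] by (simp add: dist_commute)
    with far[OF pq(1,2)] pq(3,4) show "m < dist a b" by linarith
  qed
  from indep_var_compose[OF this measurable_cond_laplace[OF g] measurable_cond_laplace[OF h]]
  have ind: "indep_var borel (\<lambda>\<omega>. cond_laplace g (restrict_to (\<Phi> \<omega>) (fst_nbhd C)))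
      borel (\<lambda>\<omega>. cond_laplace h (restrict_to (\<Phi> \<omega>) (fst_nbhd D)))"
    by (simp add: comp_def)
  let ?G = "\<lambda>\<omega>. cond_laplace g (restrict_to (\<Phi> \<omega>) (fst_nbhd C))"
    and ?H = "\<lambda>\<omega>. cond_laplace h (restrict_to (\<Phi> \<omega>) (fst_nbhd D))"
  have "laplace pairs (\<lambda>x. g x + h x) = expectation (\<lambda>\<omega>. cond_laplace (\<lambda>x. g x + h x) (\<Phi> \<omega>))"
    using C D by (intro laplace_pairs[OF test_fun_add[OF g h]]) auto
  also have "\<dots> = expectation (\<lambda>\<omega>. ?G \<omega> * ?H \<omega>)"
    using counting
    by (intro Bochner_Integration.integral_cong refl)
      (simp add: cond_laplace_add[OF g h disj C(2) D(2)] cond_laplace_restrict_to[OF g] cond_laplace_restrict_to[OF h])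
  also have "\<dots> = expectation ?G * expectation ?H"
    using cond_laplace_range indep_var_rv1[OF ind] indep_var_rv2[OF ind]
    by (intro indep_var_lebesgue_integral[OF ind] integrable_bounded[where c = 1]) auto
  also have "expectation ?G = laplace pairs g"
    unfolding laplace_pairs[OF g C(2)] using counting
    by (intro Bochner_Integration.integral_cong refl) (simp add: cond_laplace_restrict_to[OF g])
  also have "expectation ?H = laplace pairs h"
    unfolding laplace_pairs[OF h D(2)] using counting
    by (intro Bochner_Integration.integral_cong refl) (simp add: cond_laplace_restrict_to[OF h])
  finally show "laplace pairs (\<lambda>x. g x + h x) =
    laplace pairs g * laplace pairs h" .
qed

lemma pairs_indep_counts:
  assumes FR: "finite_range \<Phi> m" and C: "C \<in> sets borel" "bounded C" and D: "D \<in> sets borel" "bounded D"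
    and m: "0 \<le> m" and far: "\<And>p q. p \<in> C \<Longrightarrow> q \<in> D \<Longrightarrow> m + 4 < dist (fst p) (fst q)"
  shows "indep_var borel (\<lambda>\<omega>. measure (pairs \<omega>) C) borel (\<lambda>\<omega>. measure (pairs \<omega>) D)"
proof -
  have "indep_var counting_space (\<lambda>\<omega>. restrict_to (pairs \<omega>) C) counting_space (\<lambda>\<omega>. restrict_to (pairs \<omega>) D)"
    by (rule laplace_factorises_imp_indep_restrict[OF pairs_measurable C D pairs_laplace_factorises[OF FR C D m far]])
  from indep_var_compose[OF this measurable_measure_counting_space[of UNIV] measurable_measure_counting_space[of UNIV]]
  have "indep_var borel (\<lambda>\<omega>. measure (restrict_to (pairs \<omega>) C) UNIV) borel (\<lambda>\<omega>. measure (restrict_to (pairs \<omega>) D) UNIV)"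
    by (simp add: comp_def)
  moreover have "measure (restrict_to (pairs \<omega>) E) UNIV = measure (pairs \<omega>) E" if "\<omega> \<in> space M" "E \<in> sets borel" for \<omega> E
    using emeasure_restrict_to[OF pairs_counting[OF that(1)] that(2), of UNIV] by (simp add: measure_def)
  ultimately show ?thesis
    using C(1) D(1)
    by (subst indep_var_cong[where X' = "\<lambda>\<omega>. measure (restrict_to (pairs \<omega>) C) UNIV"
          and Y' = "\<lambda>\<omega>. measure (restrict_to (pairs \<omega>) D) UNIV"]) auto
qed

text \<open>A point that ends in \<open>A\<close> started within distance 2, hence in the open set
  \<open>K\<close>; radius 3 covers distance exactly 2. Cutting off by \<open>K\<close> confines the
  lifted function to \<open>K\<close> times \<open>A\<close>, which is bounded when \<open>A\<close>
  is.\<close>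

lemma integral_moved:
  assumes g: "test_fun A g" and \<omega>: "\<omega> \<in> space M"
  defines "K \<equiv> \<Union>a\<in>A. ball a 3"
  shows "(\<integral>x. g x \<partial>moved \<omega>) = (\<integral>p. g (snd p) * indicator K (fst p) \<partial>pairs \<omega>)"
proof -
  have [measurable]: "K \<in> sets borel" unfolding K_def by (intro borel_open open_UN ballI open_ball)
  note [measurable] = test_funD(2)[OF g]
  have "(\<lambda>p. g (snd p) * indicator K (fst p)) \<in> borel_measurable (borel \<Otimes>\<^sub>M borel)" by measurable
  then have m [measurable]: "(\<lambda>p. g (snd p) * indicator K (fst p)) \<in> borel_measurable borel" by (simp add: borel_prod)
  have "(\<integral>x. g x \<partial>moved \<omega>) = enn2real (\<integral>\<^sup>+x. ennreal (g x) \<partial>moved \<omega>)"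
    using test_funD(2,3)[OF g]
    by (intro integral_eq_enn2real) (auto simp: measurable_counting[OF moved_counting[OF \<omega>]])
  also have "(\<integral>\<^sup>+x. ennreal (g x) \<partial>moved \<omega>) = (\<integral>\<^sup>+i. ennreal (g (target \<omega> i)) \<partial>count_space (indices \<omega>))"
    unfolding moved_eq by (subst nn_integral_sum_dirac) auto
  also have "\<dots> = (\<integral>\<^sup>+i. ennreal (g (target \<omega> i) * indicator K (X i \<omega>)) \<partial>count_space (indices \<omega>))"
  proof (rule nn_integral_cong)
    fix i assume "i \<in> space (count_space (indices \<omega>))"
    then have d: "dist (X i \<omega>) (target \<omega> i) \<le> 2" by (intro dist_move_point \<omega>) simp
    show "ennreal (g (target \<omega> i)) = ennreal (g (target \<omega> i) * indicator K (X i \<omega>))"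
    proof (cases "target \<omega> i \<in> A")
      case True
      then have "X i \<omega> \<in> K" using d unfolding K_def by (force simp: dist_commute)
      then show ?thesis by simp
    qed (simp add: test_funD(4)[OF g])
  qed
  also have "\<dots> = (\<integral>\<^sup>+p. ennreal (g (snd p) * indicator K (fst p)) \<partial>pairs \<omega>)"
    unfolding pairs_def by (subst nn_integral_sum_dirac) auto
  also have "enn2real \<dots> = (\<integral>p. g (snd p) * indicator K (fst p) \<partial>pairs \<omega>)"
    using m test_funD(3)[OF g]
    by (intro integral_eq_enn2real[symmetric]) (auto simp: measurable_counting[OF pairs_counting[OF \<omega>]])
  finally show ?thesis .
qed

text \<open>Test functions of end points lift to test functions of pairs whose starts lie within 3
  of the window. Two windows lose 6 of their separation in this way, and the pairs require
  \<open>m + 4\<close>: together \<open>m + 10\<close>.\<close>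

lemma moved_finite_range:
  assumes FR: "finite_range \<Phi> m" and m: "0 \<le> m"
  shows "finite_range moved (m + 10)"
  unfolding finite_range_def
proof (intro allI impI)
  fix A B :: "'a set" assume A: "A \<in> sets borel" and B: "B \<in> sets borel" and bA: "bounded A" and bB: "bounded B"
    and far: "\<forall>a\<in>A. \<forall>b\<in>B. m + 10 < dist a b"
  define K where "K A = (\<Union>a\<in>A. ball a 3)" for A :: "'a set"
  have K [measurable]: "K A \<in> sets borel" for A unfolding K_def by (intro borel_open open_UN ballI open_ball)
  define L where "L A = K A \<times> A" for A
  have L: "L A \<in> sets borel" "bounded (L A)" if A: "A \<in> sets borel" "bounded A" for A
  proof -
    have "L A \<in> sets (borel \<Otimes>\<^sub>M borel)" using A(1) K unfolding L_def by simp
    then show "L A \<in> sets borel" by (simp only: borel_prod)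
    obtain R where R: "\<And>a. a \<in> A \<Longrightarrow> norm a \<le> R" using A(2) by (auto simp: bounded_iff)
    have "norm y \<le> R + 3" if "y \<in> K A" for y
    proof -
      from that obtain a where "a \<in> A" "dist a y < 3" by (auto simp: K_def)
      then show ?thesis using R[of a] norm_triangle_sub[of y a] by (simp add: dist_norm norm_minus_commute)
    qed
    then have "bounded (K A)" by (auto simp: bounded_iff)
    then show "bounded (L A)" unfolding L_def using A(2) by (rule bounded_Times)
  qed
  define lift where "lift A g p = g (snd p) * indicator (K A) (fst p)" for A and g :: "'a \<Rightarrow> real" and p :: "'a \<times> 'a"
  have lift: "test_fun (L A) (lift A g)" if g: "test_fun A g" for A g
  proof -
    have "(\<lambda>p. g (snd p) * indicator (K A) (fst p)) \<in> borel_measurable (borel \<Otimes>\<^sub>M borel)"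
      using test_funD(2)[OF g] by measurable
    then have "lift A g \<in> borel_measurable borel" by (simp add: borel_prod lift_def[abs_def])
    moreover have "finite (range (lift A g))"
    proof (rule finite_subset)
      show "range (lift A g) \<subseteq> insert 0 (range g)" by (auto simp: lift_def indicator_def)
      show "finite (insert 0 (range g))" using simple_functionD(1)[OF test_funD(1)[OF g]] by simp
    qed
    ultimately have "simple_function borel (lift A g)" by (simp add: simple_function_borel_measurable)
    then show ?thesis using test_funD(3,4)[OF g] by (auto simp: test_fun_def lift_def L_def indicator_def)
  qed
  have LF: "laplace_factorises pairs (L A) (L B)"
  proof (rule pairs_laplace_factorises[OF FR L[OF A bA] L[OF B bB] m])
    fix p q assume "p \<in> L A" "q \<in> L B"
    then obtain a b where ab: "a \<in> A" "b \<in> B" "dist a (fst p) < 3" "dist b (fst q) < 3"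
      by (auto simp: L_def K_def)
    have "dist a b \<le> dist a (fst p) + dist (fst p) (fst q) + dist b (fst q)"
      using dist_triangle[of a b "fst p"] dist_triangle[of "fst p" b "fst q"] by (simp add: dist_commute)
    with far ab show "m + 4 < dist (fst p) (fst q)" by fastforce
  qed
  have "laplace_factorises moved A B"
    unfolding laplace_factorises_def
  proof (intro allI impI)
    fix g h assume g: "test_fun A g" and h: "test_fun B h"
    have G: "(\<integral>x. g x \<partial>moved \<omega>) = (\<integral>p. lift A g p \<partial>pairs \<omega>)" if "\<omega> \<in> space M" for \<omega>
      using integral_moved[OF g that] by (simp add: lift_def K_def)
    have H: "(\<integral>x. h x \<partial>moved \<omega>) = (\<integral>p. lift B h p \<partial>pairs \<omega>)" if "\<omega> \<in> space M" for \<omega>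
      using integral_moved[OF h that] by (simp add: lift_def K_def)
    have GH: "(\<integral>x. g x + h x \<partial>moved \<omega>) = (\<integral>p. lift A g p + lift B h p \<partial>pairs \<omega>)" if \<omega>: "\<omega> \<in> space M" for \<omega>
      using test_fun_integrable[OF g moved_counting[OF \<omega>] A bA] test_fun_integrable[OF h moved_counting[OF \<omega>] B bB]
        test_fun_integrable[OF lift[OF g] pairs_counting[OF \<omega>] L[OF A bA]]
        test_fun_integrable[OF lift[OF h] pairs_counting[OF \<omega>] L[OF B bB]]
      by (simp add: G[OF \<omega>] H[OF \<omega>])
    have "laplace pairs (\<lambda>p. lift A g p + lift B h p) =
      laplace pairs (lift A g) * laplace pairs (lift B h)"
      using LF lift[OF g] lift[OF h] unfolding laplace_factorises_def by blast
    then show "laplace moved (\<lambda>x. g x + h x) =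
      laplace moved g * laplace moved h"
      by (simp add: G H GH cong: Bochner_Integration.integral_cong)
  qed
  then show "indep_var counting_space (\<lambda>\<omega>. restrict_to (moved \<omega>) A) counting_space (\<lambda>\<omega>. restrict_to (moved \<omega>) B)"
    by (rule laplace_factorises_imp_indep_restrict[OF moved_measurable A bA B bB])
qed

end

subsection \<open>Unit cells\<close>

text \<open>The lower corner of the half-open unit cube containing \<open>x\<close>. The integer
  lattice is \<open>range cell\<close>, and the cube at a lattice point \<open>z\<close> is the
  preimage of \<open>{z}\<close>.\<close>

definition cell :: "'a::euclidean_space \<Rightarrow> 'a" where
  "cell x = (\<Sum>b\<in>Basis. of_int \<lfloor>x \<bullet> b\<rfloor> *\<^sub>R b)"

lemma cell_inner: "b \<in> Basis \<Longrightarrow> cell x \<bullet> b = of_int \<lfloor>x \<bullet> b\<rfloor>"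
  by (simp add: cell_def inner_sum_left_Basis)

lemma measurable_cell [measurable]: "cell \<in> borel_measurable borel"
  unfolding cell_def by measurable

text \<open>A crude bound through the sum of the coordinates, each a fractional part. It is the
  source of every \<open>DIM('a)\<close> in the radii below.\<close>

lemma dist_cell: "dist x (cell x) \<le> DIM('a)" for x :: "'a::euclidean_space"
proof -
  have "norm (x - cell x) \<le> (\<Sum>b\<in>Basis. \<bar>(x - cell x) \<bullet> b\<bar>)" by (rule norm_le_l1)
  also have "\<dots> \<le> (\<Sum>b\<in>(Basis :: 'a set). 1)"
  proof (rule sum_mono)
    fix b :: 'a assume "b \<in> Basis"
    then have "(x - cell x) \<bullet> b = frac (x \<bullet> b)" by (simp add: inner_diff_left cell_inner frac_def)
    then show "\<bar>(x - cell x) \<bullet> b\<bar> \<le> 1" using frac_lt_1[of "x \<bullet> b"] frac_ge_0[of "x \<bullet> b"] by simp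
  qed
  finally show ?thesis by (simp add: dist_norm)
qed

lemma cell_add_range:
  assumes "z \<in> range cell" shows "cell (z + x) = z + cell x"
proof (rule euclidean_eqI)
  fix b :: 'a assume b: "b \<in> Basis"
  from assms obtain y where "z = cell y" by auto
  then show "cell (z + x) \<bullet> b = (z + cell x) \<bullet> b"
    using b by (simp add: cell_inner inner_add_left)
qed

text \<open>Counting cells by volume uses this lower bound, for which the open unit box shifted to
  \<open>z\<close> is enough.\<close>

lemma emeasure_cell:
  assumes z: "z \<in> range cell" shows "1 \<le> emeasure lborel (cell -` {z} :: 'a::euclidean_space set)"
proof -
  have "1 = emeasure lborel (box 0 One :: 'a set)" by (simp add: emeasure_lborel_box_eq)
  also have "\<dots> = emeasure (distr lborel borel ((+) (- z))) (box 0 One :: 'a set)"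
    by (simp add: lborel_distr_plus)
  also have "\<dots> = emeasure lborel ((+) (- z) -` box 0 One)"
    by (subst emeasure_distr) auto
  also have "\<dots> \<le> emeasure lborel (cell -` {z})"
  proof (rule emeasure_mono)
    show "(+) (- z) -` box 0 One \<subseteq> cell -` {z}"
    proof
      fix x assume "x \<in> (+) (- z) -` box 0 One"
      then have x: "x - z \<in> box 0 One" by simp
      have "cell (x - z) = 0"
      proof (rule euclidean_eqI)
        fix b :: 'a assume b: "b \<in> Basis"
        with x have "0 < (x - z) \<bullet> b" "(x - z) \<bullet> b < 1" by (auto simp: mem_box)
        then have "\<lfloor>(x - z) \<bullet> b\<rfloor> = 0" by linarith
        then show "cell (x - z) \<bullet> b = 0 \<bullet> b" using b by (simp add: cell_inner)
      qed
      with cell_add_range[OF z, of "x - z"] show "x \<in> cell -` {z}" by simp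
    qed
    show "cell -` {z} \<in> sets lborel" using measurable_sets_borel[OF measurable_cell, of "{z}"] by simp
  qed
  finally show ?thesis .
qed

text \<open>Volume comparison: the cells are disjoint, have volume at least 1 and lie in
  \<open>R\<close>.\<close>

lemma card_cells_le:
  fixes S R :: "'a::euclidean_space set"
  assumes S: "finite S" "S \<subseteq> range cell" and R: "R \<in> sets borel" "bounded R"
    and sub: "\<And>x. cell x \<in> S \<Longrightarrow> x \<in> R"
  shows "real (card S) \<le> measure lborel R"
proof -
  have m: "cell -` {z} \<in> sets borel" for z :: 'a using measurable_sets_borel[OF measurable_cell, of "{z}"] by simp
  have "of_nat (card S) = (\<Sum>z\<in>S. 1 :: ennreal)" by simp
  also have "\<dots> \<le> (\<Sum>z\<in>S. emeasure lborel (cell -` {z}))" using S(2) by (intro sum_mono emeasure_cell) auto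
  also have "\<dots> = emeasure lborel (\<Union>z\<in>S. cell -` {z})"
    using m S(1) by (intro sum_emeasure) (auto simp: disjoint_family_on_def)
  also have "\<dots> \<le> emeasure lborel R" using sub R by (intro emeasure_mono) auto
  also have "\<dots> = ennreal (measure lborel R)"
    using emeasure_bounded_finite[OF R(2)] by (simp add: emeasure_eq_ennreal_measure less_top)
  finally have "ennreal (real (card S)) \<le> ennreal (measure lborel R)" by (simp add: ennreal_of_nat_eq_real_of_nat)
  then show ?thesis by simp
qed

text \<open>The volume comparison bounds the size of all finite subsets of \<open>T\<close> by the
  same number, so \<open>T\<close> itself is finite.\<close>

lemma finite_cells:
  assumes "bounded (T :: 'a::euclidean_space set)" "T \<subseteq> range cell"
  shows "finite T"
proof -
  obtain r where r: "\<And>z. z \<in> T \<Longrightarrow> norm z \<le> r" using assms(1) by (auto simp: bounded_iff)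
  let ?R = "cball 0 (r + DIM('a)) :: 'a set"
  have "card S \<le> nat \<lceil>measure lborel ?R\<rceil>" if "S \<subseteq> T" "finite S" for S
  proof -
    have "real (card S) \<le> measure lborel ?R"
    proof (rule card_cells_le[OF that(2)])
      fix x assume "cell x \<in> S"
      then show "x \<in> ?R" using r[of "cell x"] that(1) dist_cell[of x] norm_triangle_sub[of x "cell x"] by (auto simp: dist_norm)
    qed (use that assms in auto)
    then show ?thesis by linarith
  qed
  then have "finite T \<and> card T \<le> nat \<lceil>measure lborel ?R\<rceil>" by (intro finite_if_finite_subsets_card_bdd) auto
  then show ?thesis by simp
qed

subsection \<open>Variances\<close>

context prob_space
begin

lemma square_integrable_prod:
  fixes f g :: "'a \<Rightarrow> real"
  assumes [measurable]: "f \<in> borel_measurable M" "g \<in> borel_measurable M"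
    and "integrable M (\<lambda>x. (f x)\<^sup>2)" "integrable M (\<lambda>x. (g x)\<^sup>2)"
  shows "integrable M (\<lambda>x. f x * g x)"
proof (rule Bochner_Integration.integrable_bound)
  show "integrable M (\<lambda>x. (f x)\<^sup>2 + (g x)\<^sup>2)" using assms by simp
  have "\<bar>f x * g x\<bar> \<le> (f x)\<^sup>2 + (g x)\<^sup>2" for x
  proof -
    have "2 * \<bar>f x * g x\<bar> \<le> (f x)\<^sup>2 + (g x)\<^sup>2"
      using sum_squares_bound[of "\<bar>f x\<bar>" "\<bar>g x\<bar>"] by (simp add: abs_mult)
    then show ?thesis using abs_ge_zero[of "f x * g x"] by linarith
  qed
  then show "AE x in M. norm (f x * g x) \<le> norm ((f x)\<^sup>2 + (g x)\<^sup>2)" by simp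
qed auto

lemma square_integrable_add:
  fixes f g :: "'a \<Rightarrow> real"
  assumes "f \<in> borel_measurable M" "g \<in> borel_measurable M"
    and "integrable M (\<lambda>x. (f x)\<^sup>2)" "integrable M (\<lambda>x. (g x)\<^sup>2)"
  shows "integrable M (\<lambda>x. (f x + g x)\<^sup>2)" "integrable M (\<lambda>x. (f x - g x)\<^sup>2)"
  using square_integrable_prod[OF assms] assms by (simp_all add: power2_sum power2_diff mult.assoc)

text \<open>The variance is a double sum of covariances. Far pairs contribute 0. For a near pair,
  nonnegativity allows dropping the product of the means, and AM-GM bounds the mixed moment by
  \<open>\<kappa>\<close>; each index has at most \<open>b\<close> near partners.\<close>

lemma variance_sum_le:
  fixes N :: "'i \<Rightarrow> 'a \<Rightarrow> real"
  assumes Z: "finite Z" and meas [measurable]: "\<And>z. z \<in> Z \<Longrightarrow> N z \<in> borel_measurable M"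
    and nonneg: "\<And>z x. z \<in> Z \<Longrightarrow> 0 \<le> N z x"
    and int: "\<And>z. z \<in> Z \<Longrightarrow> integrable M (\<lambda>x. (N z x)\<^sup>2)"
    and \<kappa>: "\<And>z. z \<in> Z \<Longrightarrow> expectation (\<lambda>x. (N z x)\<^sup>2) \<le> \<kappa>"
    and near: "\<And>z. z \<in> Z \<Longrightarrow> real (card {w\<in>Z. near z w}) \<le> b"
    and far: "\<And>z w. z \<in> Z \<Longrightarrow> w \<in> Z \<Longrightarrow> \<not> near z w \<Longrightarrow>
      expectation (\<lambda>x. N z x * N w x) = expectation (N z) * expectation (N w)"
  shows "variance (\<lambda>x. \<Sum>z\<in>Z. N z x) \<le> real (card Z) * b * \<kappa>"
proof -
  have int1: "integrable M (N z)" if "z \<in> Z" for z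
    using square_integrable_imp_integrable[OF meas int] that by blast
  have prod: "integrable M (\<lambda>x. N z x * N w x)" if "z \<in> Z" "w \<in> Z" for z w
    using that by (intro square_integrable_prod meas int)
  have \<kappa>0: "0 \<le> \<kappa>" if "z \<in> Z" for z
  proof -
    have "0 \<le> expectation (\<lambda>x. (N z x)\<^sup>2)" by simp
    with \<kappa>[OF that] show ?thesis by linarith
  qed
  have cov: "expectation (\<lambda>x. N z x * N w x) - expectation (N z) * expectation (N w) \<le> (if near z w then \<kappa> else 0)"
    if zw: "z \<in> Z" "w \<in> Z" for z w
  proof (cases "near z w")
    case True
    have "expectation (\<lambda>x. N z x * N w x) \<le> expectation (\<lambda>x. ((N z x)\<^sup>2 + (N w x)\<^sup>2) / 2)"
      using prod[OF zw] int[OF zw(1)] int[OF zw(2)] sum_squares_bound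
      by (intro integral_mono) (auto simp: field_simps)
    also have "\<dots> = (expectation (\<lambda>x. (N z x)\<^sup>2) + expectation (\<lambda>x. (N w x)\<^sup>2)) / 2"
      using int[OF zw(1)] int[OF zw(2)] by simp
    also have "\<dots> \<le> \<kappa>" using \<kappa>[OF zw(1)] \<kappa>[OF zw(2)] by simp
    finally have "expectation (\<lambda>x. N z x * N w x) \<le> \<kappa>" .
    moreover have "0 \<le> expectation (N z) * expectation (N w)"
      using nonneg zw by (intro mult_nonneg_nonneg integral_nonneg) auto
    ultimately show ?thesis using True by simp
  qed (simp add: far zw)
  have sq: "integrable M (\<lambda>x. (\<Sum>z\<in>Z. N z x)\<^sup>2)"
    unfolding power2_eq_square sum_product by (intro Bochner_Integration.integrable_sum prod)
  have "variance (\<lambda>x. \<Sum>z\<in>Z. N z x) = expectation (\<lambda>x. (\<Sum>z\<in>Z. N z x)\<^sup>2) - (expectation (\<lambda>x. \<Sum>z\<in>Z. N z x))\<^sup>2"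
    using int1 sq by (intro variance_eq) auto
  also have "expectation (\<lambda>x. (\<Sum>z\<in>Z. N z x)\<^sup>2) = (\<Sum>z\<in>Z. \<Sum>w\<in>Z. expectation (\<lambda>x. N z x * N w x))"
    unfolding power2_eq_square sum_product using prod
    by (subst Bochner_Integration.integral_sum) (auto intro!: sum.cong Bochner_Integration.integral_sum)
  also have "(expectation (\<lambda>x. \<Sum>z\<in>Z. N z x))\<^sup>2 = (\<Sum>z\<in>Z. \<Sum>w\<in>Z. expectation (N z) * expectation (N w))"
    using int1 by (simp add: Bochner_Integration.integral_sum power2_eq_square sum_product)
  also have "(\<Sum>z\<in>Z. \<Sum>w\<in>Z. expectation (\<lambda>x. N z x * N w x)) - (\<Sum>z\<in>Z. \<Sum>w\<in>Z. expectation (N z) * expectation (N w))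
      = (\<Sum>z\<in>Z. \<Sum>w\<in>Z. expectation (\<lambda>x. N z x * N w x) - expectation (N z) * expectation (N w))"
    by (simp add: sum_subtractf)
  also have "\<dots> \<le> (\<Sum>z\<in>Z. \<Sum>w\<in>Z. if near z w then \<kappa> else 0)" by (intro sum_mono cov)
  also have "\<dots> = (\<Sum>z\<in>Z. real (card {w\<in>Z. near z w}) * \<kappa>)"
    using Z by (simp add: sum.If_cases Int_def)
  also have "\<dots> \<le> (\<Sum>z\<in>Z. b * \<kappa>)"
    using near \<kappa>0 by (intro sum_mono mult_right_mono) auto
  finally show ?thesis by simp
qed

text \<open>AM-GM: \<open>2 \<bar>a b\<bar> \<le> \<epsilon> a\<^sup>2 + b\<^sup>2 / \<epsilon>\<close>.\<close>

lemma variance_add_approx: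
  fixes f g :: "'a \<Rightarrow> real"
  assumes [measurable]: "f \<in> borel_measurable M" "g \<in> borel_measurable M"
    and f: "integrable M (\<lambda>x. (f x)\<^sup>2)" and g: "integrable M (\<lambda>x. (g x)\<^sup>2)" and \<epsilon>: "0 < \<epsilon>"
  shows "\<bar>variance (\<lambda>x. f x + g x) - variance f\<bar> \<le> \<epsilon> * variance f + (1 + 1 / \<epsilon>) * variance g"
proof -
  have f1: "integrable M f" by (rule square_integrable_imp_integrable[OF assms(1) f])
  have g1: "integrable M g" by (rule square_integrable_imp_integrable[OF assms(2) g])
  define a where "a x = f x - expectation f" for x
  define b where "b x = g x - expectation g" for x
  have [measurable]: "a \<in> borel_measurable M" "b \<in> borel_measurable M" unfolding a_def b_def by measurable
  have a: "integrable M (\<lambda>x. (a x)\<^sup>2)" and b: "integrable M (\<lambda>x. (b x)\<^sup>2)"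
    unfolding a_def b_def using f g f1 g1 by (auto intro!: square_integrable_add(2))
  have ab: "integrable M (\<lambda>x. a x * b x)" by (intro square_integrable_prod a b) auto
  have "variance (\<lambda>x. f x + g x) = expectation (\<lambda>x. (a x + b x)\<^sup>2)"
    using f1 g1 by (simp add: a_def b_def algebra_simps)
  also have "\<dots> = expectation (\<lambda>x. (a x)\<^sup>2) + expectation (\<lambda>x. (b x)\<^sup>2) + 2 * expectation (\<lambda>x. a x * b x)"
    using a b ab by (simp add: power2_sum mult.assoc)
  finally have v: "variance (\<lambda>x. f x + g x) - variance f = variance g + 2 * expectation (\<lambda>x. a x * b x)"
    by (simp add: a_def b_def)
  have pt: "\<bar>2 * (a x * b x)\<bar> \<le> \<epsilon> * (a x)\<^sup>2 + 1 / \<epsilon> * (b x)\<^sup>2" for x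
  proof -
    have "2 * (sqrt \<epsilon> * \<bar>a x\<bar>) * (\<bar>b x\<bar> / sqrt \<epsilon>) \<le> (sqrt \<epsilon> * \<bar>a x\<bar>)\<^sup>2 + (\<bar>b x\<bar> / sqrt \<epsilon>)\<^sup>2"
      by (rule sum_squares_bound)
    then show ?thesis using \<epsilon> by (simp add: power_mult_distrib power_divide abs_mult)
  qed
  have "\<bar>2 * expectation (\<lambda>x. a x * b x)\<bar> = \<bar>expectation (\<lambda>x. 2 * (a x * b x))\<bar>" by simp
  also have "\<dots> \<le> expectation (\<lambda>x. \<bar>2 * (a x * b x)\<bar>)" by (rule integral_abs_bound)
  also have "\<dots> \<le> expectation (\<lambda>x. \<epsilon> * (a x)\<^sup>2 + 1 / \<epsilon> * (b x)\<^sup>2)"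
    using a b ab pt by (intro integral_mono integrable_abs integrable_mult_right Bochner_Integration.integrable_add)
  also have "\<dots> = \<epsilon> * variance f + 1 / \<epsilon> * variance g" using a b by (simp add: a_def b_def)
  finally have "\<bar>2 * expectation (\<lambda>x. a x * b x)\<bar> \<le> \<epsilon> * variance f + 1 / \<epsilon> * variance g" .
  moreover have "0 \<le> variance g" by (rule variance_positive)
  ultimately have "\<bar>variance g + 2 * expectation (\<lambda>x. a x * b x)\<bar> \<le> variance g + (\<epsilon> * variance f + 1 / \<epsilon> * variance g)"
    by linarith
  then show ?thesis unfolding v by (simp add: algebra_simps)
qed

text \<open>The comparison above with \<open>\<epsilon> = 1\<close>, applied to \<open>f\<close> and
  \<open>- g\<close>.\<close>

lemma variance_diff_le:
  fixes f g :: "'a \<Rightarrow> real"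
  assumes "f \<in> borel_measurable M" "g \<in> borel_measurable M"
    and "integrable M (\<lambda>x. (f x)\<^sup>2)" "integrable M (\<lambda>x. (g x)\<^sup>2)"
  shows "variance (\<lambda>x. f x - g x) \<le> 2 * variance f + 2 * variance g"
proof -
  have g1: "integrable M g" using square_integrable_imp_integrable[OF assms(2,4)] by simp
  have neg: "variance (\<lambda>x. - g x) = variance g"
    using g1 by (intro Bochner_Integration.integral_cong refl) (simp add: power2_commute)
  have "\<bar>variance (\<lambda>x. f x + - g x) - variance f\<bar> \<le> 1 * variance f + (1 + 1 / 1) * variance (\<lambda>x. - g x)"
    by (rule variance_add_approx) (use assms in auto)
  then show ?thesis unfolding neg by simp
qed

end

section \<open>Variance of the number of moves that start in a shell\<close>

definition annulus :: "real \<Rightarrow> real \<Rightarrow> 'a::euclidean_space set" where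
  "annulus a b = {x. a \<le> norm x \<and> norm x \<le> b}"

lemma sets_annulus [measurable]: "annulus a b \<in> sets borel"
  unfolding annulus_def by measurable

lemma bounded_annulus: "bounded (annulus a b)"
  by (auto simp: annulus_def bounded_iff)

context displacement
begin

text \<open>Each pair is assigned to the cell of its starting point, and the pairs of one cell are
  dominated by the points of \<open>\<Phi>\<close> in a ball about the corner. The three factors
  bound the number of cells, the number of partners of a cell that may be dependent on it, and the
  second moment per cell.\<close>

lemma variance_pairs_annulus:
  fixes a b :: real
  assumes FR: "finite_range \<Phi> m" and m: "0 \<le> m"
    and mom: "\<And>z. integrable M (\<lambda>\<omega>. (measure (\<Phi> \<omega>) (cball z DIM('a)))\<^sup>2)"
      "\<And>z. expectation (\<lambda>\<omega>. (measure (\<Phi> \<omega>) (cball z DIM('a)))\<^sup>2) \<le> \<kappa>"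
    and S: "S \<in> sets borel" "bounded S" and ann: "\<And>p. p \<in> S \<Longrightarrow> fst p \<in> annulus a b"
  shows "variance (\<lambda>\<omega>. measure (pairs \<omega>) S) \<le>
      measure lborel (annulus (a - 2 * DIM('a)) (b + 2 * DIM('a)) :: 'a set) *
      measure lborel (cball 0 (m + 5 + 3 * DIM('a)) :: 'a set) * \<kappa>"
    and "integrable M (\<lambda>\<omega>. (measure (pairs \<omega>) S)\<^sup>2)"
proof -
  \<comment> \<open>Corners of cells that meet the shell. The corners may leave the shell by
    \<open>DIM('a)\<close>, and their cells by another \<open>DIM('a)\<close>, whence the shell
    enlarged by twice the dimension.\<close>
  define Z where "Z = cell ` (annulus a b :: 'a set)"
  have Zann: "z \<in> annulus (a - DIM('a)) (b + DIM('a))" if "z \<in> Z" for z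
  proof -
    from that obtain x where "z = cell x" "x \<in> annulus a b" by (auto simp: Z_def)
    then show ?thesis using dist_cell[of x] norm_triangle_sub[of x "cell x"] norm_triangle_sub[of "cell x" x]
      by (auto simp: annulus_def dist_norm norm_minus_commute)
  qed
  have Zr: "Z \<subseteq> range cell" by (auto simp: Z_def)
  have Z: "finite Z"
    using bounded_subset[OF bounded_annulus[of "a - DIM('a)" "b + DIM('a)"]] Zann Zr
    by (intro finite_cells) auto
  have cardZ: "real (card Z) \<le> measure lborel (annulus (a - 2 * DIM('a)) (b + 2 * DIM('a)) :: 'a set)"
  proof (rule card_cells_le[OF Z Zr sets_annulus bounded_annulus])
    fix x assume "cell x \<in> Z"
    from Zann[OF this] show "x \<in> annulus (a - 2 * DIM('a)) (b + 2 * DIM('a))"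
      using dist_cell[of x] norm_triangle_sub[of x "cell x"] norm_triangle_sub[of "cell x" x]
      by (auto simp: annulus_def dist_norm norm_minus_commute)
  qed
  define T where "T z = {p\<in>S. cell (fst p) = z}" for z
  have T: "T z \<in> sets borel" "bounded (T z)" for z
  proof -
    have "(\<lambda>p. cell (fst p)) \<in> borel_measurable (borel \<Otimes>\<^sub>M borel :: ('a \<times> 'a) measure)" by measurable
    then have "(\<lambda>p :: 'a \<times> 'a. cell (fst p)) \<in> borel_measurable borel" by (simp only: borel_prod)
    from measurable_sets_borel[OF this, of "{z}"]
    have "S \<inter> (\<lambda>p. cell (fst p)) -` {z} \<in> sets borel" using S(1) by auto
    also have "S \<inter> (\<lambda>p. cell (fst p)) -` {z} = T z" by (auto simp: T_def)
    finally show "T z \<in> sets borel" .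
    show "bounded (T z)" by (rule bounded_subset[OF S(2)]) (auto simp: T_def)
  qed
  define N where "N z \<omega> = measure (pairs \<omega>) (T z)" for z \<omega>
  have Nm [measurable]: "N z \<in> borel_measurable M" for z
    using measurable_compose[OF pairs_measurable measurable_measure_counting_space[OF T(1)]] unfolding N_def .
  have Nle: "N z \<omega> \<le> measure (\<Phi> \<omega>) (cball z DIM('a))" if \<omega>: "\<omega> \<in> space M" for z \<omega>
  proof -
    have "emeasure (pairs \<omega>) (T z) \<le> emeasure (sum_dirac (indices \<omega>) (\<lambda>i. X i \<omega>)) (cball z DIM('a))"
      unfolding pairs_def
    proof (rule emeasure_sum_dirac_mono[OF T(1)])
      fix i assume "(X i \<omega>, target \<omega> i) \<in> T z"
      then show "X i \<omega> \<in> cball z DIM('a)" using dist_cell[of "X i \<omega>"] by (auto simp: T_def dist_commute)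
    qed simp
    then have "emeasure (pairs \<omega>) (T z) \<le> emeasure (\<Phi> \<omega>) (cball z DIM('a))" by (simp add: \<Phi>_eq[OF \<omega>, symmetric])
    then show ?thesis unfolding N_def measure_def
      using emeasure_counting_finite[OF counting[OF \<omega>], of "cball z DIM('a)"] by (intro enn2real_mono) auto
  qed
  have N0: "0 \<le> N z \<omega>" for z \<omega> by (simp add: N_def)
  have Nint: "integrable M (\<lambda>\<omega>. (N z \<omega>)\<^sup>2)" for z
    using Nle N0 by (intro Bochner_Integration.integrable_bound[OF mom(1)[of z]]) (auto intro!: power_mono)
  have N\<kappa>: "expectation (\<lambda>\<omega>. (N z \<omega>)\<^sup>2) \<le> \<kappa>" for z
  proof -
    have "expectation (\<lambda>\<omega>. (N z \<omega>)\<^sup>2) \<le> expectation (\<lambda>\<omega>. (measure (\<Phi> \<omega>) (cball z DIM('a)))\<^sup>2)"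
      using Nle N0 by (intro integral_mono Nint mom(1)) (auto intro!: power_mono)
    with mom(2)[of z] show ?thesis by linarith
  qed
  have \<kappa>0: "0 \<le> \<kappa>"
  proof -
    have "0 \<le> expectation (\<lambda>\<omega>. (N 0 \<omega>)\<^sup>2)" by simp
    with N\<kappa>[of 0] show ?thesis by linarith
  qed
  have sum: "measure (pairs \<omega>) S = (\<Sum>z\<in>Z. N z \<omega>)" if \<omega>: "\<omega> \<in> space M" for \<omega>
  proof -
    have "S = (\<Union>z\<in>Z. T z)" using ann by (auto simp: T_def Z_def)
    moreover have "measure (pairs \<omega>) (\<Union>z\<in>Z. T z) = (\<Sum>z\<in>Z. N z \<omega>)"
      unfolding N_def
    proof (rule measure_finite_Union[OF Z])
      show "T ` Z \<subseteq> sets (pairs \<omega>)" using T(1) by (auto simp: sets_counting[OF pairs_counting[OF \<omega>]])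
      show "disjoint_family_on T Z" by (auto simp: disjoint_family_on_def T_def)
      show "emeasure (pairs \<omega>) (T z) \<noteq> \<infinity>" for z
        using emeasure_counting_finite[OF pairs_counting[OF \<omega>] T, of z] by simp
    qed
    ultimately show ?thesis by simp
  qed
  let ?b = "measure lborel (cball 0 (m + 5 + 3 * DIM('a)) :: 'a set)"
  have "variance (\<lambda>\<omega>. \<Sum>z\<in>Z. N z \<omega>) \<le> real (card Z) * ?b * \<kappa>"
  \<comment> \<open>Starting points lie within \<open>DIM('a)\<close> of their corners, so corners
    more than \<open>m + 4 + 2 * DIM('a)\<close> apart give starts more than \<open>m + 4\<close>
    apart. The cells of near corners fill at most a further \<open>DIM('a)\<close>; the stated
    radius leaves a margin of 1.\<close>
  proof (rule variance_sum_le[where near = "\<lambda>z w. dist z w \<le> m + 4 + 2 * DIM('a)", OF Z Nm N0 Nint N\<kappa>])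
    fix z assume "z \<in> Z"
    have "real (card {w\<in>Z. dist z w \<le> m + 4 + 2 * DIM('a)}) \<le> measure lborel (cball z (m + 5 + 3 * DIM('a)))"
    proof (rule card_cells_le)
      fix x assume "cell x \<in> {w\<in>Z. dist z w \<le> m + 4 + 2 * DIM('a)}"
      then show "x \<in> cball z (m + 5 + 3 * DIM('a))"
        using dist_triangle[of z x "cell x"] dist_cell[of x] by (auto simp: dist_commute)
    qed (use Z Zr in auto)
    then show "real (card {w\<in>Z. dist z w \<le> m + 4 + 2 * DIM('a)}) \<le> ?b"
      using m by (simp add: content_cball)
  next
    fix z w :: 'a assume far: "\<not> dist z w \<le> m + 4 + 2 * DIM('a)"
    have "indep_var borel (\<lambda>\<omega>. measure (pairs \<omega>) (T z)) borel (\<lambda>\<omega>. measure (pairs \<omega>) (T w))"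
    proof (rule pairs_indep_counts[OF FR T T m])
      fix p q assume "p \<in> T z" "q \<in> T w"
      then have "dist (fst p) z \<le> DIM('a)" "dist (fst q) w \<le> DIM('a)"
        using dist_cell[of "fst p"] dist_cell[of "fst q"] by (auto simp: T_def)
      moreover have "dist z w \<le> dist (fst p) z + dist (fst p) (fst q) + dist (fst q) w"
        using dist_triangle[of z w "fst p"] dist_triangle[of "fst p" w "fst q"] by (simp add: dist_commute)
      ultimately show "m + 4 < dist (fst p) (fst q)" using far by linarith
    qed
    then have "indep_var borel (N z) borel (N w)" by (simp add: N_def[abs_def])
    then show "expectation (\<lambda>\<omega>. N z \<omega> * N w \<omega>) = expectation (N z) * expectation (N w)"
      by (intro indep_var_lebesgue_integral square_integrable_imp_integrable[OF Nm Nint])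
  qed
  also have "\<dots> \<le> measure lborel (annulus (a - 2 * DIM('a)) (b + 2 * DIM('a)) :: 'a set) * ?b * \<kappa>"
    using cardZ \<kappa>0 by (intro mult_right_mono) auto
  finally show "variance (\<lambda>\<omega>. measure (pairs \<omega>) S) \<le> measure lborel (annulus (a - 2 * DIM('a)) (b + 2 * DIM('a)) :: 'a set) * ?b * \<kappa>"
    using sum by (simp cong: Bochner_Integration.integral_cong)
  have "integrable M (\<lambda>x. (\<Sum>z\<in>Z. N z x)\<^sup>2)"
    unfolding power2_eq_square sum_product
    by (intro Bochner_Integration.integrable_sum square_integrable_prod Nm Nint)
  then show "integrable M (\<lambda>\<omega>. (measure (pairs \<omega>) S)\<^sup>2)"
    using sum by (simp cong: Bochner_Integration.integrable_cong)
qed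

end

text \<open>For \<open>r > c\<close> the shell lies between two concentric balls, and after dividing
  by the volume of the ball of radius \<open>r\<close> the bound (1 + c/r)^d - (1 - c/r)^d remains,
  which tends to 0.\<close>

lemma annulus_volume_ratio:
  assumes c: "0 < c"
  shows "((\<lambda>r. measure lborel (annulus (r - c) (r + c) :: 'a::euclidean_space set) / measure lborel (cball (0 :: 'a) r)) \<longlongrightarrow> 0) at_top"
proof (rule tendsto_sandwich[OF _ _ tendsto_const])
  let ?d = "DIM('a)"
  have "((\<lambda>r. (1 + c * inverse r) ^ ?d - (1 - c * inverse r) ^ ?d) \<longlongrightarrow> (1 + c * 0) ^ ?d - (1 - c * 0) ^ ?d) at_top"
    by (intro tendsto_intros tendsto_inverse_0_at_top filterlim_ident)
  then show "((\<lambda>r. (1 + c * inverse r) ^ ?d - (1 - c * inverse r) ^ ?d) \<longlongrightarrow> 0) at_top" by simp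
  show "\<forall>\<^sub>F r in at_top. 0 \<le> measure lborel (annulus (r - c) (r + c) :: 'a set) / measure lborel (cball (0 :: 'a) r)"
    by (intro always_eventually allI divide_nonneg_nonneg) auto
  show "\<forall>\<^sub>F r in at_top. measure lborel (annulus (r - c) (r + c) :: 'a set) / measure lborel (cball (0 :: 'a) r)
      \<le> (1 + c * inverse r) ^ ?d - (1 - c * inverse r) ^ ?d"
    using eventually_gt_at_top[of c]
  proof eventually_elim
    case (elim r)
    let ?v = "unit_ball_vol (real ?d)"
    have v: "0 < ?v" by simp
    have fin: "emeasure lborel (cball (0 :: 'a) (r + c)) \<noteq> \<infinity>"
      using emeasure_bounded_finite[of "cball (0 :: 'a) (r + c)"] by simp
    have "measure lborel (annulus (r - c) (r + c) :: 'a set) \<le> measure lborel (cball (0 :: 'a) (r + c) - ball 0 (r - c))"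
    proof (rule measure_mono_fmeasurable)
      show "cball (0 :: 'a) (r + c) - ball 0 (r - c) \<in> fmeasurable lborel"
        using fin by (intro fmeasurable_Diff fmeasurableI) (auto simp: less_top)
    qed (auto simp: annulus_def)
    also have "\<dots> = measure lborel (cball (0 :: 'a) (r + c)) - measure lborel (ball (0 :: 'a) (r - c))"
      using fin elim c by (intro measure_Diff) auto
    also have "\<dots> = ?v * ((r + c) ^ ?d - (r - c) ^ ?d)"
      using elim c by (simp add: content_cball content_ball right_diff_distrib)
    finally have "measure lborel (annulus (r - c) (r + c) :: 'a set) / measure lborel (cball (0 :: 'a) r)
        \<le> ?v * ((r + c) ^ ?d - (r - c) ^ ?d) / measure lborel (cball (0 :: 'a) r)"
      by (rule divide_right_mono) simp
    also have "\<dots> = ?v * ((r + c) ^ ?d - (r - c) ^ ?d) / (?v * r ^ ?d)"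
      using elim c by (simp add: content_cball)
    also have "\<dots> = ((r + c) / r) ^ ?d - ((r - c) / r) ^ ?d"
      by (simp only: mult_divide_mult_cancel_left[OF less_imp_neq[OF v, symmetric]] power_divide
          diff_divide_distrib[of "(r + c) ^ ?d" "(r - c) ^ ?d"])
    also have "(r + c) / r = 1 + c * inverse r" using elim c by (simp add: field_simps)
    also have "(r - c) / r = 1 - c * inverse r" using elim c by (simp add: field_simps)
    finally show ?case .
  qed
qed

text \<open>Passes from the doubly indexed family of marks to one of its rows, seen as a
  sequence.\<close>

lemma (in prob_space) indep_vars_reindex:
  assumes inj: "inj_on f I" and ind: "indep_vars M' X (f ` I)"
  shows "indep_vars (\<lambda>i. M' (f i)) (\<lambda>i. X (f i)) I"
  unfolding indep_vars_def2
proof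
  show "\<forall>i\<in>I. random_variable (M' (f i)) (X (f i))" using ind by (auto simp: indep_vars_def2)
  have s: "indep_sets (\<lambda>i. {X i -` A \<inter> space M | A. A \<in> sets (M' i)}) (f ` I)"
    using ind by (simp add: indep_vars_def2)
  show "indep_sets (\<lambda>i. {X (f i) -` A \<inter> space M | A. A \<in> sets (M' (f i))}) I"
  proof (rule indep_setsI)
    show "i \<in> I \<Longrightarrow> {X (f i) -` A \<inter> space M | A. A \<in> sets (M' (f i))} \<subseteq> events" for i
      using s unfolding indep_sets_def by blast
    fix A J assume J: "J \<noteq> {}" "J \<subseteq> I" "finite J" and A: "\<forall>j\<in>J. A j \<in> {X (f j) -` A \<inter> space M | A. A \<in> sets (M' (f j))}"
    have injJ: "inj_on f J" using inj J(2) by (rule inj_on_subset)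
    define A' where "A' i = A (the_inv_into J f i)" for i
    have A': "A' (f j) = A j" if "j \<in> J" for j using the_inv_into_f_f[OF injJ that] by (simp add: A'_def)
    have "prob (\<Inter>i\<in>f ` J. A' i) = (\<Prod>i\<in>f ` J. prob (A' i))"
      using J A A' by (intro indep_setsD[OF s]) auto
    then show "prob (\<Inter>j\<in>J. A j) = (\<Prod>j\<in>J. prob (A j))"
      by (simp add: A' prod.reindex[OF injJ])
  qed
qed

section \<open>The property preserved by a step, and the induction over the steps\<close>

text \<open>The induction hypothesis of the whole proof. The second moments are bounded uniformly in
  the centre, as is needed for all cells at once, and for every radius \<open>R\<close>, because
  each step consumes 2 of it.\<close>

definition (in prob_space) tame_process :: "real \<Rightarrow> ('a \<Rightarrow> 'b::euclidean_space measure) \<Rightarrow> bool" where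
  "tame_process \<gamma> \<Phi> \<longleftrightarrow> \<Phi> \<in> measurable M counting_space \<and>
    (AE \<omega> in M. emeasure (\<Phi> \<omega>) UNIV = \<infinity>) \<and> (\<exists>m\<ge>0. finite_range \<Phi> m) \<and>
    (\<forall>R. \<exists>\<kappa>. \<forall>z. integrable M (\<lambda>\<omega>. (measure (\<Phi> \<omega>) (cball z R))\<^sup>2) \<and> expectation (\<lambda>\<omega>. (measure (\<Phi> \<omega>) (cball z R))\<^sup>2) \<le> \<kappa>) \<and>
    ((\<lambda>r. var_count M \<Phi> (cball 0 r) / measure lborel (cball (0::'b) r)) \<longlongrightarrow> \<gamma>) at_top"

lemma (in prob_space) tame_process_cong:
  assumes "tame_process \<gamma> \<Phi>" and eq: "\<And>\<omega>. \<omega> \<in> space M \<Longrightarrow> \<Psi> \<omega> = \<Phi> \<omega>"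
  shows "tame_process \<gamma> \<Psi>"
proof -
  have m: "integrable M (\<lambda>\<omega>. (measure (\<Psi> \<omega>) B)\<^sup>2) = integrable M (\<lambda>\<omega>. (measure (\<Phi> \<omega>) B)\<^sup>2)"
    "expectation (\<lambda>\<omega>. (measure (\<Psi> \<omega>) B)\<^sup>2) = expectation (\<lambda>\<omega>. (measure (\<Phi> \<omega>) B)\<^sup>2)"
    "var_count M \<Psi> B = var_count M \<Phi> B" for B
    unfolding var_count_def by (simp_all add: eq cong: Bochner_Integration.integral_cong Bochner_Integration.integrable_cong)
  have f: "\<Psi> \<in> measurable M counting_space" if "\<Phi> \<in> measurable M counting_space"
    using that by (subst measurable_cong[OF eq])
  have ae: "AE \<omega> in M. emeasure (\<Psi> \<omega>) UNIV = \<infinity>" if "AE \<omega> in M. emeasure (\<Phi> \<omega>) UNIV = \<infinity>"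
    using that AE_space by eventually_elim (simp add: eq)
  have fr: "\<exists>m\<ge>0. finite_range \<Psi> m" if "\<exists>m\<ge>0. finite_range \<Phi> m"
    using that finite_range_cong[of \<Phi> _ \<Psi>, OF _ eq] by blast
  show ?thesis using assms(1) f ae fr unfolding tame_process_def m by blast
qed

lemma (in prob_space) tame_stationary_poisson:
  assumes P: "stationary_poisson_process M \<gamma> (\<Phi> :: 'a \<Rightarrow> 'b::euclidean_space measure)" and \<gamma>: "0 < \<gamma>"
  shows "tame_process \<gamma> \<Phi>"
  unfolding tame_process_def
proof (intro conjI allI)
  obtain \<Lambda> where \<Lambda>: "poisson_process M \<Lambda> \<Phi>" using P by (auto simp: stationary_poisson_process_def)
  then show "\<Phi> \<in> measurable M counting_space" by (simp add: poisson_process_def)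
  show "AE \<omega> in M. emeasure (\<Phi> \<omega>) UNIV = \<infinity>" by (rule stationary_poisson_infinite[OF P \<gamma>])
  show "\<exists>m\<ge>0. finite_range \<Phi> m" using finite_range_poisson[OF \<Lambda>] by auto
  show "\<exists>\<kappa>. \<forall>z. integrable M (\<lambda>\<omega>. (measure (\<Phi> \<omega>) (cball z R))\<^sup>2) \<and> expectation (\<lambda>\<omega>. (measure (\<Phi> \<omega>) (cball z R))\<^sup>2) \<le> \<kappa>" for R
  proof (intro exI allI conjI)
    fix z
    show "integrable M (\<lambda>\<omega>. (measure (\<Phi> \<omega>) (cball z R))\<^sup>2)"
      by (rule stationary_poisson_moments(1)[OF P \<gamma>]) auto
    \<comment> \<open>Translation invariance of volume makes the moment bound independent of the
      centre.\<close>
    have "measure lborel (cball z R) = measure lborel (cball (0 :: 'b) R)"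
      by (cases "0 \<le> R") (simp_all add: content_cball)
    then show "expectation (\<lambda>\<omega>. (measure (\<Phi> \<omega>) (cball z R))\<^sup>2) \<le>
        (\<gamma> * measure lborel (cball (0 :: 'b) R))\<^sup>2 + \<gamma> * measure lborel (cball (0 :: 'b) R)"
      by (subst stationary_poisson_moments(2)[OF P \<gamma>]) auto
  qed
  have "\<forall>\<^sub>F r in at_top. var_count M \<Phi> (cball 0 r) / measure lborel (cball (0::'b) r) = \<gamma>"
    using eventually_gt_at_top[of 0]
  proof eventually_elim
    case (elim r)
    then have "0 < measure lborel (cball (0::'b) r)" by (simp add: content_cball)
    then show ?case unfolding var_count_def by (subst stationary_poisson_moments(3)[OF P \<gamma>]) auto
  qed
  then show "((\<lambda>r. var_count M \<Phi> (cball 0 r) / measure lborel (cball (0::'b) r)) \<longlongrightarrow> \<gamma>) at_top"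
    by (rule tendsto_eventually)
qed

context displacement
begin

text \<open>For an actual move the bound \<open>r + 2\<close> is automatic. Written into the set, it
  places the starting points in a shell and makes the set bounded; likewise for \<open>r - 2\<close>
  and \<open>r + 2\<close> in \<open>leaving\<close>.\<close>

definition entering :: "real \<Rightarrow> ('a \<times> 'a) set" where
  "entering r = {p. r < norm (fst p) \<and> norm (fst p) \<le> r + 2 \<and> norm (snd p) \<le> r}"

definition leaving :: "real \<Rightarrow> ('a \<times> 'a) set" where
  "leaving r = {p. r - 2 \<le> norm (fst p) \<and> norm (fst p) \<le> r \<and> r < norm (snd p) \<and> norm (snd p) \<le> r + 2}"

lemma sets_entering [measurable]: "entering r \<in> sets borel"
  and sets_leaving [measurable]: "leaving r \<in> sets borel"
proof -
  let ?P = "borel \<Otimes>\<^sub>M borel :: ('a \<times> 'a) measure"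
  have "{p\<in>space ?P. r < norm (fst p) \<and> norm (fst p) \<le> r + 2 \<and> norm (snd p) \<le> r} \<in> sets ?P"
    "{p\<in>space ?P. r - 2 \<le> norm (fst p) \<and> norm (fst p) \<le> r \<and> r < norm (snd p) \<and> norm (snd p) \<le> r + 2} \<in> sets ?P"
    by measurable
  then have "entering r \<in> sets ?P" "leaving r \<in> sets ?P"
    by (simp_all add: entering_def leaving_def space_pair_measure)
  then show "entering r \<in> sets borel" "leaving r \<in> sets borel" by (simp_all only: borel_prod)
qed

lemma bounded_entering: "bounded (entering r)"
  and bounded_leaving: "bounded (leaving r)"
proof -
  have "entering r \<union> leaving r \<subseteq> cball 0 (r + 2) \<times> cball 0 (r + 2)"
    by (auto simp: entering_def leaving_def)
  then have "bounded (entering r \<union> leaving r)"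
    by (rule bounded_subset[rotated]) (intro bounded_Times bounded_cball)
  then show "bounded (entering r)" "bounded (leaving r)" by auto
qed

text \<open>Points that are inside both before and after the step, the set \<open>S\<close>, cancel.
  The counts are first added as extended reals; finiteness then permits subtraction in the
  reals.\<close>

lemma measure_moved_cball:
  assumes \<omega>: "\<omega> \<in> space M"
  shows "measure (moved \<omega>) (cball 0 r) =
    measure (\<Phi> \<omega>) (cball 0 r) + (measure (pairs \<omega>) (entering r) - measure (pairs \<omega>) (leaving r))"
proof -
  define I where "I = indices \<omega>"
  define x where "x i = X i \<omega>" for i
  define t where "t i = target \<omega> i" for i
  have d: "norm (t i) \<le> norm (x i) + 2" "norm (x i) \<le> norm (t i) + 2" if "i \<in> I" for i
    using dist_move_point[OF \<omega>, of i] that norm_triangle_sub[of "t i" "x i"] norm_triangle_sub[of "x i" "t i"]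
    unfolding I_def x_def t_def by (auto simp: dist_norm norm_minus_commute)
  let ?c = "emeasure (count_space I)"
  define S where "S = {i\<in>I. norm (x i) \<le> r \<and> norm (t i) \<le> r}"
  have 1: "emeasure (\<Phi> \<omega>) (cball 0 r) = ?c (S \<union> {i\<in>I. (x i, t i) \<in> leaving r})"
  proof -
    have "emeasure (\<Phi> \<omega>) (cball 0 r) = ?c {i\<in>I. x i \<in> cball 0 r}"
      by (subst \<Phi>_eq[OF \<omega>]) (simp add: emeasure_sum_dirac I_def x_def)
    also have "{i\<in>I. x i \<in> cball 0 r} = S \<union> {i\<in>I. (x i, t i) \<in> leaving r}"
      using d by (force simp: S_def leaving_def)
    finally show ?thesis .
  qed
  have 2: "emeasure (moved \<omega>) (cball 0 r) = ?c (S \<union> {i\<in>I. (x i, t i) \<in> entering r})"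
  proof -
    have "emeasure (moved \<omega>) (cball 0 r) = ?c {i\<in>I. t i \<in> cball 0 r}"
      by (simp add: moved_eq emeasure_sum_dirac I_def t_def)
    also have "{i\<in>I. t i \<in> cball 0 r} = S \<union> {i\<in>I. (x i, t i) \<in> entering r}"
      using d by (force simp: S_def entering_def)
    finally show ?thesis .
  qed
  have p: "emeasure (pairs \<omega>) C = ?c {i\<in>I. (x i, t i) \<in> C}" if "C \<in> sets borel" for C
    using that by (simp add: pairs_def emeasure_sum_dirac I_def x_def t_def)
  have 3: "emeasure (\<Phi> \<omega>) (cball 0 r) = ?c S + emeasure (pairs \<omega>) (leaving r)"
    unfolding 1 p[OF sets_leaving] by (intro plus_emeasure[symmetric]) (auto simp: S_def leaving_def)
  have 4: "emeasure (moved \<omega>) (cball 0 r) = ?c S + emeasure (pairs \<omega>) (entering r)"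
    unfolding 2 p[OF sets_entering] by (intro plus_emeasure[symmetric]) (auto simp: S_def entering_def)
  have fin: "emeasure (\<Phi> \<omega>) (cball 0 r) < \<infinity>" "emeasure (pairs \<omega>) (entering r) < \<infinity>" "emeasure (pairs \<omega>) (leaving r) < \<infinity>"
    using emeasure_counting_finite[OF counting[OF \<omega>], of "cball 0 r"]
      emeasure_counting_finite[OF pairs_counting[OF \<omega>] sets_entering bounded_entering]
      emeasure_counting_finite[OF pairs_counting[OF \<omega>] sets_leaving bounded_leaving] by auto
  then have S: "?c S < \<infinity>" unfolding 3 by (simp add: less_top)
  have "measure (\<Phi> \<omega>) (cball 0 r) = enn2real (?c S) + measure (pairs \<omega>) (leaving r)"
    "measure (moved \<omega>) (cball 0 r) = enn2real (?c S) + measure (pairs \<omega>) (entering r)"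
    unfolding measure_def 3 4 using fin S by (simp_all add: enn2real_plus)
  then show ?thesis by simp
qed

text \<open>The new count is the old one plus the boundary term \<open>D r\<close>. With
  \<open>s r\<close> bounding the variance of \<open>D r\<close> divided by the volume, the weight
  \<open>\<epsilon> = sqrt (s r)\<close> in \<open>variance_add_approx\<close> makes both error
  contributions vanish: \<epsilon> times the old ratio, and (1 + 1/\<epsilon>) s = s + sqrt
  s.\<close>

lemma variance_ratio_moved:
  assumes FR: "finite_range \<Phi> m" and m: "0 \<le> m"
    and mom: "\<And>z. integrable M (\<lambda>\<omega>. (measure (\<Phi> \<omega>) (cball z DIM('a)))\<^sup>2)"
      "\<And>z. expectation (\<lambda>\<omega>. (measure (\<Phi> \<omega>) (cball z DIM('a)))\<^sup>2) \<le> \<kappa>"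
    and sq: "\<And>r. integrable M (\<lambda>\<omega>. (measure (\<Phi> \<omega>) (cball 0 r))\<^sup>2)"
    and lim: "((\<lambda>r. var_count M \<Phi> (cball 0 r) / measure lborel (cball (0::'a) r)) \<longlongrightarrow> \<gamma>) at_top"
  shows "((\<lambda>r. var_count M moved (cball 0 r) / measure lborel (cball (0::'a) r)) \<longlongrightarrow> \<gamma>) at_top"
proof -
  \<comment> \<open>Half the width of the shell: 2 for the length of a move,
    \<open>2 * DIM('a)\<close> for the enlargement by cells.\<close>
  define c where "c = 2 + 2 * real DIM('a)"
  define A where "A r = measure lborel (annulus (r - c) (r + c) :: 'a set)" for r
  define V where "V r = measure lborel (cball (0::'a) r)" for r
  \<comment> \<open>The 4 collects the entering and leaving terms, each taken with factor 2 by
    \<open>variance_diff_le\<close>.\<close>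
  define K where "K = 4 * measure lborel (cball 0 (m + 5 + 3 * DIM('a)) :: 'a set) * \<kappa>"
  \<comment> \<open>Adding \<open>inverse r\<close> keeps \<open>s r\<close> strictly positive even
    if the boundary term has variance 0, so that \<open>sqrt (s r)\<close> is an admissible
    weight.\<close>
  define s where "s r = K * (A r / V r) + inverse r" for r
  define f where "f r = var_count M \<Phi> (cball 0 r) / V r" for r
  define D where "D r \<omega> = measure (pairs \<omega>) (entering r) - measure (pairs \<omega>) (leaving r)" for r \<omega>
  have \<kappa>0: "0 \<le> \<kappa>"
  proof -
    have "0 \<le> expectation (\<lambda>\<omega>. (measure (\<Phi> \<omega>) (cball 0 DIM('a)))\<^sup>2)" by simp
    with mom(2)[of 0] show ?thesis by linarith
  qed
  have K0: "0 \<le> K" using \<kappa>0 by (simp add: K_def)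
  have c0: "0 < c" by (simp add: c_def)
  have ann: "fst p \<in> annulus (r - 2) (r + 2)" if "p \<in> entering r \<union> leaving r" for p r
    using that by (auto simp: entering_def leaving_def annulus_def)
  note [measurable] = measurable_compose[OF pairs_measurable measurable_measure_counting_space[OF sets_entering]]
    measurable_compose[OF pairs_measurable measurable_measure_counting_space[OF sets_leaving]]
    measurable_compose[OF \<Phi> measurable_measure_counting_space]
  have in_var: "variance (\<lambda>\<omega>. measure (pairs \<omega>) (entering r)) \<le> A r * (K / 4)"
    and in_int: "integrable M (\<lambda>\<omega>. (measure (pairs \<omega>) (entering r))\<^sup>2)" for r
  proof -
    have "A r = measure lborel (annulus (r - 2 - 2 * DIM('a)) (r + 2 + 2 * DIM('a)) :: 'a set)"
      by (simp add: A_def c_def algebra_simps)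
    then show "variance (\<lambda>\<omega>. measure (pairs \<omega>) (entering r)) \<le> A r * (K / 4)"
      "integrable M (\<lambda>\<omega>. (measure (pairs \<omega>) (entering r))\<^sup>2)"
      using variance_pairs_annulus[OF FR m mom sets_entering bounded_entering ann[OF UnI1], of r]
      unfolding K_def by (simp_all add: mult.assoc)
  qed
  have out_var: "variance (\<lambda>\<omega>. measure (pairs \<omega>) (leaving r)) \<le> A r * (K / 4)"
    and out_int: "integrable M (\<lambda>\<omega>. (measure (pairs \<omega>) (leaving r))\<^sup>2)" for r
  proof -
    have "A r = measure lborel (annulus (r - 2 - 2 * DIM('a)) (r + 2 + 2 * DIM('a)) :: 'a set)"
      by (simp add: A_def c_def algebra_simps)
    then show "variance (\<lambda>\<omega>. measure (pairs \<omega>) (leaving r)) \<le> A r * (K / 4)"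
      "integrable M (\<lambda>\<omega>. (measure (pairs \<omega>) (leaving r))\<^sup>2)"
      using variance_pairs_annulus[OF FR m mom sets_leaving bounded_leaving ann[OF UnI2], of r]
      unfolding K_def by (simp_all add: mult.assoc)
  qed
  have D_meas: "D r \<in> borel_measurable M" for r unfolding D_def by measurable
  have D_int: "integrable M (\<lambda>\<omega>. (D r \<omega>)\<^sup>2)" for r
    unfolding D_def by (intro square_integrable_add(2) in_int out_int) measurable
  have D_var: "variance (D r) \<le> K * A r" for r
  proof -
    have "variance (D r) \<le> 2 * variance (\<lambda>\<omega>. measure (pairs \<omega>) (entering r)) + 2 * variance (\<lambda>\<omega>. measure (pairs \<omega>) (leaving r))"
      unfolding D_def by (intro variance_diff_le in_int out_int) measurable
    also have "\<dots> \<le> K * A r" using in_var[of r] out_var[of r] by (simp add: algebra_simps)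
    finally show ?thesis .
  qed
  have "((\<lambda>r. K * (A r / V r) + inverse r) \<longlongrightarrow> K * 0 + 0) at_top"
    unfolding A_def V_def
    by (intro tendsto_add tendsto_mult_left annulus_volume_ratio c0 tendsto_inverse_0_at_top filterlim_ident)
  then have s_lim: "(s \<longlongrightarrow> 0) at_top" by (simp add: s_def[abs_def])
  have f_lim: "(f \<longlongrightarrow> \<gamma>) at_top" using lim by (simp add: f_def[abs_def] V_def)
  have "((\<lambda>r. sqrt (s r) * f r + s r + sqrt (s r)) \<longlongrightarrow> sqrt 0 * \<gamma> + 0 + sqrt 0) at_top"
    by (intro tendsto_intros s_lim f_lim)
  then have bound_lim: "((\<lambda>r. sqrt (s r) * f r + s r + sqrt (s r)) \<longlongrightarrow> 0) at_top" by simp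
  have bound: "\<forall>\<^sub>F r in at_top. norm (var_count M moved (cball 0 r) / V r - f r) \<le> sqrt (s r) * f r + s r + sqrt (s r)"
    using eventually_gt_at_top[of 0]
  proof eventually_elim
    case (elim r)
    have V: "0 < V r" using elim by (simp add: V_def content_cball)
    have A: "0 \<le> A r" by (simp add: A_def)
    have s: "0 < s r" using elim K0 A V unfolding s_def by (intro add_nonneg_pos mult_nonneg_nonneg divide_nonneg_nonneg) auto
    let ?g = "\<lambda>\<omega>. measure (\<Phi> \<omega>) (cball 0 r)"
    have g_meas: "?g \<in> borel_measurable M" by measurable
    have "K * A r \<le> s r * V r" using V elim by (simp add: s_def field_simps)
    with D_var[of r] have Dv: "variance (D r) \<le> s r * V r" by linarith
    have "var_count M moved (cball 0 r) = variance (\<lambda>\<omega>. ?g \<omega> + D r \<omega>)"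
      unfolding var_count_def using measure_moved_cball[of _ r]
      by (simp add: D_def cong: Bochner_Integration.integral_cong)
    then have "\<bar>var_count M moved (cball 0 r) - var_count M \<Phi> (cball 0 r)\<bar> \<le>
        sqrt (s r) * var_count M \<Phi> (cball 0 r) + (1 + 1 / sqrt (s r)) * variance (D r)"
      using variance_add_approx[OF g_meas D_meas sq D_int, of "sqrt (s r)" r] s
      by (simp add: var_count_def)
    also have "\<dots> \<le> sqrt (s r) * var_count M \<Phi> (cball 0 r) + (1 + 1 / sqrt (s r)) * (s r * V r)"
      using Dv s by (intro add_left_mono mult_left_mono) auto
    also have "(1 + 1 / sqrt (s r)) * (s r * V r) = (s r + sqrt (s r)) * V r"
    proof -
      have "1 / sqrt (s r) * s r = sqrt (s r)" using s real_div_sqrt[of "s r"] by simp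
      then show ?thesis by (simp add: distrib_right mult.assoc[symmetric])
    qed
    finally have "\<bar>var_count M moved (cball 0 r) - var_count M \<Phi> (cball 0 r)\<bar> / V r \<le>
        (sqrt (s r) * var_count M \<Phi> (cball 0 r) + (s r + sqrt (s r)) * V r) / V r"
      using V by (simp add: divide_right_mono)
    also have "\<dots> = sqrt (s r) * f r + s r + sqrt (s r)" using V by (simp add: f_def add_divide_distrib)
    also have "\<bar>var_count M moved (cball 0 r) - var_count M \<Phi> (cball 0 r)\<bar> / V r =
        norm (var_count M moved (cball 0 r) / V r - f r)"
      using V by (simp add: f_def diff_divide_distrib[symmetric])
    finally show ?case .
  qed
  have "((\<lambda>r. (var_count M moved (cball 0 r) / V r - f r) + f r) \<longlongrightarrow> 0 + \<gamma>) at_top"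
    by (intro tendsto_add f_lim Lim_null_comparison[OF bound bound_lim])
  then show ?thesis by (simp add: V_def)
qed

text \<open>Every point in the smaller ball after the step came from the ball enlarged by 2, so the
  counts, and hence their squares, compare pointwise.\<close>

lemma moved_second_moments:
  assumes int: "integrable M (\<lambda>\<omega>. (measure (\<Phi> \<omega>) (cball z (R + 2)))\<^sup>2)"
  shows "integrable M (\<lambda>\<omega>. (measure (moved \<omega>) (cball z R))\<^sup>2)"
    and "expectation (\<lambda>\<omega>. (measure (moved \<omega>) (cball z R))\<^sup>2) \<le> expectation (\<lambda>\<omega>. (measure (\<Phi> \<omega>) (cball z (R + 2)))\<^sup>2)"
proof -
  have [measurable]: "(\<lambda>\<omega>. measure (moved \<omega>) (cball z R)) \<in> borel_measurable M"
    using measurable_compose[OF moved_measurable measurable_measure_counting_space] by simp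
  have le: "(measure (moved \<omega>) (cball z R))\<^sup>2 \<le> (measure (\<Phi> \<omega>) (cball z (R + 2)))\<^sup>2" if \<omega>: "\<omega> \<in> space M" for \<omega>
  proof (rule power_mono)
    show "measure (moved \<omega>) (cball z R) \<le> measure (\<Phi> \<omega>) (cball z (R + 2))"
      unfolding measure_def using emeasure_moved_cball_le[OF \<omega>, of z R]
        emeasure_counting_finite[OF counting[OF \<omega>], of "cball z (R + 2)"] by (intro enn2real_mono) auto
  qed simp
  show "integrable M (\<lambda>\<omega>. (measure (moved \<omega>) (cball z R))\<^sup>2)"
    using le by (intro Bochner_Integration.integrable_bound[OF int]) auto
  then show "expectation (\<lambda>\<omega>. (measure (moved \<omega>) (cball z R))\<^sup>2) \<le> expectation (\<lambda>\<omega>. (measure (\<Phi> \<omega>) (cball z (R + 2)))\<^sup>2)"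
    using le int by (intro integral_mono) auto
qed

lemma tame_moved:
  assumes "tame_process \<gamma> \<Phi>" shows "tame_process \<gamma> moved"
proof -
  obtain m where m: "0 \<le> m" "finite_range \<Phi> m" using assms by (auto simp: tame_process_def)
  have mom: "\<exists>\<kappa>. \<forall>z. integrable M (\<lambda>\<omega>. (measure (\<Phi> \<omega>) (cball z R))\<^sup>2) \<and> expectation (\<lambda>\<omega>. (measure (\<Phi> \<omega>) (cball z R))\<^sup>2) \<le> \<kappa>" for R
    using assms by (simp add: tame_process_def)
  obtain \<kappa> where \<kappa>: "\<And>z. integrable M (\<lambda>\<omega>. (measure (\<Phi> \<omega>) (cball z DIM('a)))\<^sup>2)"
      "\<And>z. expectation (\<lambda>\<omega>. (measure (\<Phi> \<omega>) (cball z DIM('a)))\<^sup>2) \<le> \<kappa>"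
    using mom[of "DIM('a)"] by blast
  have sq: "integrable M (\<lambda>\<omega>. (measure (\<Phi> \<omega>) (cball z r))\<^sup>2)" for z r using mom[of r] by blast
  have "\<exists>\<kappa>. \<forall>z. integrable M (\<lambda>\<omega>. (measure (moved \<omega>) (cball z R))\<^sup>2) \<and> expectation (\<lambda>\<omega>. (measure (moved \<omega>) (cball z R))\<^sup>2) \<le> \<kappa>" for R
  proof -
    obtain \<kappa> where "\<And>z. expectation (\<lambda>\<omega>. (measure (\<Phi> \<omega>) (cball z (R + 2)))\<^sup>2) \<le> \<kappa>" using mom[of "R + 2"] by blast
    then show ?thesis using moved_second_moments[OF sq] order_trans by blast
  qed
  moreover have "((\<lambda>r. var_count M moved (cball 0 r) / measure lborel (cball (0::'a) r)) \<longlongrightarrow> \<gamma>) at_top"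
    using assms by (intro variance_ratio_moved[OF m(2,1) \<kappa> sq]) (simp add: tame_process_def)
  moreover have "0 \<le> m + 10" using m by simp
  ultimately show ?thesis
    using moved_measurable moved_infinite moved_finite_range[OF m(2,1)] unfolding tame_process_def by blast
qed

end

theorem proposition7p2:
  fixes M :: "'w measure"
    and \<gamma> :: real
    and U :: "nat \<Rightarrow> nat \<Rightarrow> 'w \<Rightarrow> 'a::euclidean_space"
    and Y1 :: "'a measure \<Rightarrow> real"
    and Y2 :: "'a measure \<Rightarrow> 'a"
    and \<Phi> :: "nat \<Rightarrow> 'w \<Rightarrow> 'a measure"
    and X :: "nat \<Rightarrow> nat \<Rightarrow> 'w \<Rightarrow> 'a"
  assumes M: "prob_space M"
    and \<gamma>: "\<gamma> > 0"
    and \<Phi>0: "stationary_poisson_process M \<gamma> (\<Phi> 0)"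
    and U_range: "\<And>k n \<omega>. k \<ge> 1 \<Longrightarrow> n \<ge> 1 \<Longrightarrow> \<omega> \<in> space M \<Longrightarrow> U k n \<omega> \<in> cball 0 1"
    and U_indep: "prob_space.indep_vars M (\<lambda>_. borel) (\<lambda>(k, n). U k n) ({1..} \<times> {1..})"
    and U_ident: "\<And>k n. k \<ge> 1 \<Longrightarrow> n \<ge> 1 \<Longrightarrow> distr M borel (U k n) = distr M borel (U 1 1)"
    and \<Phi>0_U_indep: "indep_rvs M counting_space (\<Phi> 0)
           (PiM ({1..} \<times> {1..}) (\<lambda>_. borel)) (\<lambda>\<omega>. \<lambda>(k, n)\<in>{1..} \<times> {1..}. U k n \<omega>)"
    and Y1_meas: "Y1 \<in> borel_measurable counting_space"
    and Y1_range: "\<And>\<phi>. \<phi> \<in> counting_measures \<Longrightarrow> Y1 \<phi> \<in> {0, 1}"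
    and Y1_local: "\<And>\<phi>. \<phi> \<in> counting_measures \<Longrightarrow> Y1 \<phi> = Y1 (restrict_to \<phi> (cball 0 1))"
    and Y2_meas: "Y2 \<in> borel_measurable counting_space"
    and Y2_range: "\<And>\<phi>. \<phi> \<in> counting_measures \<Longrightarrow> Y2 \<phi> \<in> cball 0 1"
    and Y2_local: "\<And>\<phi>. \<phi> \<in> counting_measures \<Longrightarrow> Y2 \<phi> = Y2 (restrict_to \<phi> (cball 0 1))"
    and X_enum: "\<And>k \<omega>. k \<ge> 1 \<Longrightarrow> \<omega> \<in> space M \<Longrightarrow> enumerates (\<lambda>i. X k i \<omega>) (\<Phi> (k - 1) \<omega>)"
    and X_U_indep: "\<And>k. k \<ge> 1 \<Longrightarrow> prob_space.indep_var M
           (PiM {1..} (\<lambda>_. borel)) (\<lambda>\<omega>. \<lambda>i\<in>{1..}. X k i \<omega>)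
           (PiM {1..} (\<lambda>_. borel)) (\<lambda>\<omega>. \<lambda>i\<in>{1..}. U k i \<omega>)"
    and \<Phi>_step: "\<And>k \<omega>. k \<ge> 1 \<Longrightarrow> \<omega> \<in> space M \<Longrightarrow>
           \<Phi> k \<omega> = displace Y1 Y2 (\<lambda>i. X k i \<omega>) (\<lambda>i. U k i \<omega>) (\<Phi> (k - 1) \<omega>)"
  shows "\<forall>k\<ge>1.
      ((\<lambda>r::real. var_count M (\<Phi> k) (cball 0 r) / measure lborel (cball (0::'a) r))
         \<longlongrightarrow> \<gamma>) at_top \<and>
      ((\<lambda>r::real. var_count M (\<Phi> 0) (cball 0 r) / measure lborel (cball (0::'a) r))
         \<longlongrightarrow> \<gamma>) at_top"
proof -
  interpret prob_space M by (rule M)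
  have tame: "tame_process \<gamma> (\<Phi> k)" for k
  proof (induction k)
    case 0
    show ?case by (rule tame_stationary_poisson[OF \<Phi>0 \<gamma>])
  next
    case (Suc k)
    interpret displacement M "\<Phi> k" "X (Suc k)" "U (Suc k)" Y1 Y2
    proof
      show "\<Phi> k \<in> measurable M counting_space" "AE \<omega> in M. emeasure (\<Phi> k \<omega>) UNIV = \<infinity>"
        using Suc.IH by (auto simp: tame_process_def)
      show "enumerates (\<lambda>i. X (Suc k) i \<omega>) (\<Phi> k \<omega>)" if "\<omega> \<in> space M" for \<omega>
        using X_enum[of "Suc k" \<omega>] that by simp
      show "indep_var (PiM {1..} (\<lambda>_. borel)) (\<lambda>\<omega>. \<lambda>i\<in>{1..}. X (Suc k) i \<omega>)
          (PiM {1..} (\<lambda>_. borel)) (\<lambda>\<omega>. \<lambda>i\<in>{1..}. U (Suc k) i \<omega>)"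
        by (rule X_U_indep) simp
      \<comment> \<open>The step from \<open>k\<close> to \<open>Suc k\<close> uses row
        \<open>Suc k\<close> of the marks, which is an independent sequence by restriction and
        reindexing.\<close>
      have "indep_vars (\<lambda>_. borel) (\<lambda>(k, n). U k n) (Pair (Suc k) ` {1..})"
        using U_indep by (rule indep_vars_subset) auto
      from indep_vars_reindex[OF _ this] show "indep_vars (\<lambda>_. borel) (U (Suc k)) {1..}"
        by (simp add: inj_on_def del: One_nat_def)
      show "distr M borel (U (Suc k) i) = distr M borel (U (Suc k) 1)" if "i \<ge> 1" for i
        using U_ident[of "Suc k" i] U_ident[of "Suc k" 1] that by simp
      show "U (Suc k) i \<omega> \<in> cball 0 1" if "i \<ge> 1" "\<omega> \<in> space M" for i \<omega>
        using U_range[of "Suc k" i \<omega>] that by simp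
    qed (fact Y1_meas Y1_range Y1_local Y2_meas Y2_range Y2_local)+
    \<comment> \<open>The recursion determines \<open>\<Phi> (Suc k)\<close> on
      \<open>space M\<close> only, hence the passage through
      \<open>tame_process_cong\<close>.\<close>
    show ?case
      by (rule tame_process_cong[OF tame_moved[OF Suc.IH]]) (simp add: \<Phi>_step moved_def)
  qed
  then show ?thesis by (simp add: tame_process_def)
qed


end
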